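(* Let $n\ge 2$ and $\lambda_1,\dots,\lambda_{n-1}\in\mathbb{C}$. The formula $$\sigma_i(f)=\sum_{j\in\mathbb{Z}}\eta_i^{\mu_{(j)}(h_i)+1}(f_j),\qquad i=1,\dots,n-1,$$ for $f=\sum_{j\in\mathbb{Z}}f_j\in\mathcal{A}_1$ with $\zeta_i(f_j)=\mu_{(j)}(h_i)f_j$ for all $i$ and $\mu_{(j)}\in H^*$, gives a representation of the symmetric group $S_n$ on $\mathcal{A}_1$ (with $\sigma_1,\dots,\sigma_{n-1}$ the standard generators of $S_n$). Moreover, the elements $\sigma(1)$, $\sigma\in S_n$, are weighted solutions of the system of partial differential equations $d_i(z)=0$, $i=1,\dots,n-1$.
   Context: Let $\mathbb{N}$ be the set of nonnegative integers. Let $H=\sum_{i=1}^{n-1}\mathbb{C}h_i$ with $h_i=E_{i,i}-E_{i+1,i+1}$ be the Cartan subalgebra of $sl(n,\mathbb{C})$, and let $\lambda\in H^*$ be the weight with $\lambda(h_i)=\lambda_i$. Variables: $x_{i,j}$ for $1\le j<i\le n$, with $\partial_{i,j}=\partial/\partial x_{i,j}$. Let $\mathcal{A}_0=\mathbb{C}[x_{i,j}\mid 1\le j\le i-2\le n-2]$. For $\vec a=(a_1,\dots,a_{n-1})\in\mathbb{C}^{n-1}$ put $x^{\vec a}=\prod_{i=1}^{n-1}x_{i+1,i}^{a_i}$. The space of truncated-up formal power series is $$\mathcal{A}_1=\Big\{\sum_{\vec j\in\mathbb{N}^{n-1}}\sum_{i=1}^p f_{\vec a^i-\vec j}\,x^{\vec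 a^i-\vec j}\ \Big|\ 1\le p\in\mathbb{N},\ \vec a^i\in\mathbb{C}^{n-1},\ f_{\vec a^i-\vec j}\in\mathcal{A}_0\Big\},$$ with the usual formal action of the $x_{i,j}$, of complex powers of the $x_{i+1,i}$, and of the $\partial_{i,j}$ (so $\partial_{i+1,i}x_{i+1,i}^{a}=a\,x_{i+1,i}^{a-1}$). Differential operators on $\mathcal{A}_1$, for $i=1,\dots,n-1$: $$d_i=\Big(\lambda_i-\sum_{j=i+1}^n x_{j,i}\partial_{j,i}+\sum_{j=i+2}^n x_{j,i+1}\partial_{j,i+1}\Big)\partial_{i+1,i}+\sum_{j=1}^{i-1}x_{i,j}\partial_{i+1,j}-\sum_{j=i+2}^n x_{j,i+1}\partial_{j,i},$$ $$\zeta_i=\lambda_i+\sum_{p=1}^{i-1}(x_{i,p}\partial_{i,p}-x_{i+1,p}\partial_{i+1,p})+\sum_{j=i+2}^n(x_{j,i+1}\partial_{j,i+1}-x_{j,i}\partial_{j,i})-2x_{i+1,i}\partial_{i+1,i},$$ and, for $a\in\mathbb{C}$, with $\langle a\rangle_p=a(a-1)\cdots(a-p+1)$, $$\eta_i^a=\sum_{p=0}^\infty\frac{\langle a\rangle_p}{p!}\,x_{i+1,i}^{a-p}\Big(\sum_{j=1}^{i-1}x_{i+1,j}\partial_{i,j}\Big)^p .$$ A function $f$ is weighted if there are constants $\mu_1,\dots,\mu_{n-1}$ with $\zeta_i(f)=\mu_i f$ for all $i$. Any $f\in\mathcal{A}_1$ can be written as $f=\sum_{j\in\mathbb{Z}}f_j$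 with each $f_j$ weighted, $\zeta_i(f_j)=\mu_{(j)}(h_i)f_j$, $\mu_{(j)}\in H^*$. $S_n$ is the group generated by $\sigma_1,\dots,\sigma_{n-1}$ with relations $\sigma_i\sigma_{i+1}\sigma_i=\sigma_{i+1}\sigma_i\sigma_{i+1}$, $\sigma_r\sigma_s=\sigma_s\sigma_r$ for $|r-s|\ge2$, and $\sigma_r^2=1$. Here $\sigma(1)$ is the result of $\sigma\in S_n$ acting on the constant function $1\in\mathcal{A}_1$.
   Formalization: Since σ_i does not map A_1 to itself (n=2: Σ x^{-k} goes to Σ x^{λ_1+1+k}), the representation is on a larger space containing A_1 (exponents unbounded in both directions, power series coefficients in place of A_0); the formula holds for every f in A_1. *)

theory Defs
  imports Complex_Main "HOL-Library.Groups_Big_Fun" "HOL-Algebra.Sym_Groups"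
    "HOL-Algebra.Group_Action"
begin

(* A monomial  prod x_{i,j}^(al (i,j))  over 1 <= j < i <= n  is encoded by its exponent function al,
   and a formal series by its coefficient function f (f al is the coefficient of that monomial).
   The exponents of the subdiagonal variables x_{i+1,i} are arbitrary complex numbers, all other
   exponents are natural numbers; this is imposed by admissible_expo. *)

type_synonym expo = "nat \<times> nat \<Rightarrow> complex"
type_synonym fseries = "expo \<Rightarrow> complex"

definition admissible_expo :: "nat \<Rightarrow> expo \<Rightarrow> bool" where
  "admissible_expo n al \<longleftrightarrow>
     (\<forall>i j. \<not> (1 \<le> j \<and> j < i \<and> i \<le> n) \<longrightarrow> al (i, j) = 0) \<and>
     (\<forall>i j. j + 2 \<le> i \<longrightarrow> al (i, j) \<in> \<nat>)"

(* The space A_1. The finite set P consists of the leading exponents a^1, ..., a^p. The last condition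
   says that the coefficient of every x^b, a series in the variables x_{i,j} with j + 2 <= i, is a
   polynomial, i.e. lies in A_0. *)
definition truncated_up :: "nat \<Rightarrow> fseries set" where
  "truncated_up n = {f.
     (\<forall>al. f al \<noteq> 0 \<longrightarrow> admissible_expo n al) \<and>
     (\<exists>P :: (nat \<Rightarrow> complex) set. finite P \<and>
        (\<forall>al. f al \<noteq> 0 \<longrightarrow> (\<exists>a\<in>P. \<forall>i\<in>{1..<n}. a i - al (i + 1, i) \<in> \<nat>))) \<and>
     (\<forall>b :: nat \<Rightarrow> complex. finite {al. f al \<noteq> 0 \<and> (\<forall>i\<in>{1..<n}. al (i + 1, i) = b i)})}"

(* The completion of A_1 in which the exponents a^i - j may have j in Z^(n-1) and the coefficients
   may be formal power series. *)
definition untruncated :: "nat \<Rightarrow> fseries set" where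
  "untruncated n = {f.
     (\<forall>al. f al \<noteq> 0 \<longrightarrow> admissible_expo n al) \<and>
     (\<exists>P :: (nat \<Rightarrow> complex) set. finite P \<and>
        (\<forall>al. f al \<noteq> 0 \<longrightarrow> (\<exists>a\<in>P. \<forall>i\<in>{1..<n}. a i - al (i + 1, i) \<in> \<int>)))}"

definition one_series :: fseries where
  "one_series = (\<lambda>al. if al = (\<lambda>_. 0) then 1 else 0)"

(* Multiplication by x_{i,j}^a *)
definition xpow :: "nat \<Rightarrow> nat \<Rightarrow> complex \<Rightarrow> fseries \<Rightarrow> fseries" where
  "xpow i j a f = (\<lambda>al. f (al((i, j) := al (i, j) - a)))"

abbreviation xmul :: "nat \<Rightarrow> nat \<Rightarrow> fseries \<Rightarrow> fseries" where
  "xmul i j \<equiv> xpow i j 1"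

definition pd :: "nat \<Rightarrow> nat \<Rightarrow> fseries \<Rightarrow> fseries" where
  "pd i j f = (\<lambda>al. (al (i, j) + 1) * f (al((i, j) := al (i, j) + 1)))"

(* lam i stands for lambda_i = lambda(h_i), where 1 <= i <= n - 1. *)

definition d_op :: "nat \<Rightarrow> (nat \<Rightarrow> complex) \<Rightarrow> nat \<Rightarrow> fseries \<Rightarrow> fseries" where
  "d_op n lam i f = (let g = pd (i + 1) i f in (\<lambda>al.
       (lam i * g al - (\<Sum>j=i+1..n. xmul j i (pd j i g) al)
                     + (\<Sum>j=i+2..n. xmul j (i + 1) (pd j (i + 1) g) al))
     + (\<Sum>j=1..<i. xmul i j (pd (i + 1) j f) al)
     - (\<Sum>j=i+2..n. xmul j (i + 1) (pd j i f) al)))"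

definition zeta :: "nat \<Rightarrow> (nat \<Rightarrow> complex) \<Rightarrow> nat \<Rightarrow> fseries \<Rightarrow> fseries" where
  "zeta n lam i f = (\<lambda>al.
       lam i * f al
     + (\<Sum>p=1..<i. xmul i p (pd i p f) al - xmul (i + 1) p (pd (i + 1) p f) al)
     + (\<Sum>j=i+2..n. xmul j (i + 1) (pd j (i + 1) f) al - xmul j i (pd j i f) al)
     - 2 * xmul (i + 1) i (pd (i + 1) i f) al)"

(* The derivation inside eta_i *)
definition eta_der :: "nat \<Rightarrow> fseries \<Rightarrow> fseries" where
  "eta_der i f = (\<lambda>al. \<Sum>j=1..<i. xmul (i + 1) j (pd i j f) al)"

(* a gchoose p is the falling factorial of a of length p divided by p!. For a series supported on
   admissible exponents the p-th summand vanishes at al as soon as p exceeds the sum of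
   al (i + 1, j) over 1 <= j < i, so the sum over p is finite at every al. *)
definition eta :: "nat \<Rightarrow> complex \<Rightarrow> fseries \<Rightarrow> fseries" where
  "eta i a f = (\<lambda>al.
     Sum_any (\<lambda>p. (a gchoose p) * xpow (i + 1) i (a - of_nat p) ((eta_der i ^^ p) f) al))"

(* An element mu of the dual of H is given by its values mu i on the basis h_i, 1 <= i <= n - 1. *)
definition has_weight :: "nat \<Rightarrow> (nat \<Rightarrow> complex) \<Rightarrow> (nat \<Rightarrow> complex) \<Rightarrow> fseries \<Rightarrow> bool" where
  "has_weight n lam mu f \<longleftrightarrow> (\<forall>i\<in>{1..<n}. zeta n lam i f = (\<lambda>al. mu i * f al))"

definition weighted :: "nat \<Rightarrow> (nat \<Rightarrow> complex) \<Rightarrow> fseries \<Rightarrow> bool" where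
  "weighted n lam f \<longleftrightarrow> (\<exists>mu. has_weight n lam mu f)"

(* f is the formal sum of the F j over all integers j: every coefficient is a finite sum. *)
definition formal_sum :: "(int \<Rightarrow> fseries) \<Rightarrow> fseries \<Rightarrow> bool" where
  "formal_sum F f \<longleftrightarrow> (\<forall>al. finite {j. F j al \<noteq> 0} \<and> f al = Sum_any (\<lambda>j. F j al))"

(* The formula defining sigma_i, as a relation between f and g = sigma_i(f): for some decomposition
   of f into weighted components F j in V, of weights mu j,
   g is the sum of the eta_i^(mu j (h_i) + 1) (F j). *)
definition sigma_rel ::
  "fseries set \<Rightarrow> nat \<Rightarrow> (nat \<Rightarrow> complex) \<Rightarrow> nat \<Rightarrow> fseries \<Rightarrow> fseries \<Rightarrow> bool" where
  "sigma_rel V n lam i f g \<longleftrightarrow> (\<exists>(F :: int \<Rightarrow> fseries) (mu :: int \<Rightarrow> nat \<Rightarrow> complex).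
      (\<forall>j. F j \<in> V \<and> has_weight n lam (mu j) (F j)) \<and>
      formal_sum F f \<and>
      formal_sum (\<lambda>j. eta i (mu j i + 1) (F j)) g)"

(* The subspace of A_1 spanned by the weighted elements. *)
definition weighted_span :: "nat \<Rightarrow> (nat \<Rightarrow> complex) \<Rightarrow> fseries set" where
  "weighted_span n lam = {f. \<exists>W. finite W \<and>
     (\<forall>w\<in>W. w \<in> truncated_up n \<and> weighted n lam w) \<and> f = (\<lambda>al. \<Sum>w\<in>W. w al)}"

definition linear_on_series :: "fseries set \<Rightarrow> (fseries \<Rightarrow> fseries) \<Rightarrow> bool" where
  "linear_on_series V T \<longleftrightarrow>
     (\<forall>f\<in>V. \<forall>g\<in>V. T (\<lambda>al. f al + g al) = (\<lambda>al. T f al + T g al)) \<and>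
     (\<forall>c. \<forall>f\<in>V. T (\<lambda>al. c * f al) = (\<lambda>al. c * T f al))"

(* Why the completion is needed: sigma_i reverses the sign of the exponent of x_{i+1,i}, so the
   formula does not map all of A_1 into A_1. For n = 2 it sends the element  sum_k x_{2,1}^(-k)
   of A_1 to  sum_k x_{2,1}^(lam 1 + 1 + k),  whose exponents are unbounded above. *)

definition geometric_series :: fseries where
  "geometric_series = (\<lambda>al. if \<exists>k::nat. al = (\<lambda>_. 0)((2, 1) := - of_nat k) then 1 else 0)"

lemma geometric_series_in: "geometric_series \<in> truncated_up 2"
proof -
  have "\<exists>P :: (nat \<Rightarrow> complex) set. finite P \<and>
        (\<forall>al. geometric_series al \<noteq> 0 \<longrightarrow> (\<exists>a\<in>P. \<forall>i\<in>{1..<2}. a i - al (i + 1, i) \<in> \<nat>))"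
    by (rule exI[of _ "{\<lambda>_. 0}"]) (auto simp: geometric_series_def numeral_2_eq_2 split: if_splits)
  moreover have "finite {al. geometric_series al \<noteq> 0 \<and> (\<forall>i\<in>{1..<2}. al (i + 1, i) = b i)}"
    for b :: "nat \<Rightarrow> complex"
  proof (rule finite_subset)
    show "{al. geometric_series al \<noteq> 0 \<and> (\<forall>i\<in>{1..<2}. al (i + 1, i) = b i)}
        \<subseteq> {(\<lambda>_. 0)((2, 1) := b 1)}"
      by (auto simp: geometric_series_def numeral_2_eq_2 split: if_splits)
  qed simp
  ultimately show ?thesis
    by (auto simp: truncated_up_def geometric_series_def admissible_expo_def split: if_splits)
qed

lemma eta_rank_one: "eta 1 a h = xpow 2 1 a h"
proof
  fix al
  have z: "(eta_der 1 ^^ p) h = (\<lambda>_. 0)" if "p \<noteq> 0" for p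
    using that by (cases p) (auto simp: eta_der_def)
  let ?t = "\<lambda>p. (a gchoose p) * xpow (1 + 1) 1 (a - of_nat p) ((eta_der 1 ^^ p) h) al"
  have "?t p = 0" if "p \<noteq> 0" for p
    by (simp only: z[OF that]) (simp add: xpow_def)
  then have "{p. ?t p \<noteq> 0} \<subseteq> {0}" by blast
  then have "Sum_any ?t = sum ?t {0}"
    by (intro Sum_any.expand_superset) simp_all
  also have "\<dots> = xpow 2 1 a h al" by (simp add: numeral_2_eq_2)
  finally show "eta 1 a h al = xpow 2 1 a h al" by (simp only: eta_def)
qed

lemma sigma_leaves_truncated_up:
  assumes "sigma_rel V 2 lam 1 geometric_series g"
  shows "g \<notin> truncated_up 2"
proof
  assume g: "g \<in> truncated_up 2"
  obtain F mu where F: "\<And>j. has_weight 2 lam (mu j) (F j)"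
    and f: "formal_sum F geometric_series"
    and gs: "formal_sum (\<lambda>j. eta 1 (mu j 1 + 1) (F j)) g"
    using assms unfolding sigma_rel_def by blast
  have wt: "lam 1 - 2 * al (2, 1) = mu j 1" if "F j al \<noteq> 0" for j al
  proof -
    have "zeta 2 lam 1 (F j) al = mu j 1 * F j al"
      using F[of j] unfolding has_weight_def by simp
    moreover have "zeta 2 lam 1 (F j) al = (lam 1 - 2 * al (2, 1)) * F j al"
      by (simp add: zeta_def xpow_def pd_def numeral_2_eq_2 algebra_simps)
    ultimately show ?thesis using that by simp
  qed
  define B where "B = (\<lambda>c. (\<lambda>_. 0 :: complex)((2::nat, 1::nat) := c))"
  have B_upd: "(B c)((2, 1) := d) = B d" and B_at: "B c (2, 1) = c" for c d
    by (auto simp: B_def)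
  have aux: "x - 2 * (x + y - m) = m \<Longrightarrow> m = x + 2 * y" "x - 2 * (- y) = m \<Longrightarrow> m = x + 2 * y"
    for x y m :: complex
  proof -
    have "m = x + 2 * y + (x - 2 * (x + y - m) - m)" by (simp add: algebra_simps)
    then show "m = x + 2 * y" if "x - 2 * (x + y - m) = m"
      using that by (metis add.right_neutral diff_self)
  qed auto
  have gB: "g (B (lam 1 + 1 + of_nat k)) = 1" for k :: nat
  proof -
    have "eta 1 (mu j 1 + 1) (F j) (B (lam 1 + 1 + of_nat k)) = F j (B (- of_nat k))" for j
    proof -
      have e: "eta 1 (mu j 1 + 1) (F j) (B (lam 1 + 1 + of_nat k))
          = F j (B (lam 1 + of_nat k - mu j 1))"
        unfolding eta_rank_one xpow_def B_at B_upd by (simp add: algebra_simps)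
      show ?thesis
      proof (cases "mu j 1 = lam 1 + 2 * of_nat k")
        case True
        then show ?thesis unfolding e by simp
      next
        case False
        have "F j (B (lam 1 + of_nat k - mu j 1)) = 0"
        proof (rule ccontr)
          assume "F j (B (lam 1 + of_nat k - mu j 1)) \<noteq> 0"
          then have "lam 1 - 2 * B (lam 1 + of_nat k - mu j 1) (2, 1) = mu j 1" by (rule wt)
          then have "lam 1 - 2 * (lam 1 + of_nat k - mu j 1) = mu j 1" unfolding B_at .
          then have "mu j 1 = lam 1 + 2 * of_nat k" by (rule aux(1))
          with False show False ..
        qed
        moreover have "F j (B (- of_nat k)) = 0"
        proof (rule ccontr)
          assume "F j (B (- of_nat k)) \<noteq> 0"
          then have "lam 1 - 2 * B (- of_nat k) (2, 1) = mu j 1" by (rule wt)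
          then have "lam 1 - 2 * (- of_nat k) = mu j 1" unfolding B_at .
          then have "mu j 1 = lam 1 + 2 * of_nat k" by (rule aux(2))
          with False show False ..
        qed
        ultimately show ?thesis unfolding e by simp
      qed
    qed
    then have "g (B (lam 1 + 1 + of_nat k)) = Sum_any (\<lambda>j. F j (B (- of_nat k)))"
      using gs unfolding formal_sum_def by simp
    also have "\<dots> = geometric_series (B (- of_nat k))"
      using f unfolding formal_sum_def by simp
    also have "\<dots> = 1" by (auto simp: geometric_series_def B_def)
    finally show ?thesis .
  qed
  obtain P :: "(nat \<Rightarrow> complex) set" where P: "finite P"
    and Pa: "\<And>al. g al \<noteq> 0 \<Longrightarrow> \<exists>a\<in>P. \<forall>i\<in>{1..<2}. a i - al (i + 1, i) \<in> \<nat>"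
    using g unfolding truncated_up_def by blast
  define M where "M = (\<Sum>a\<in>P. \<bar>Re (a 1 - lam 1 - 1)\<bar>)"
  obtain k :: nat where k: "M < real k" using reals_Archimedean2 by blast
  obtain a where a: "a \<in> P" and "a 1 - B (lam 1 + 1 + of_nat k) (2, 1) \<in> \<nat>"
    using Pa[of "B (lam 1 + 1 + of_nat k)"] gB[of k] by (auto simp: numeral_2_eq_2)
  then obtain m :: nat where "a 1 - (lam 1 + 1 + of_nat k) = of_nat m"
    unfolding B_at by (auto elim: Nats_cases)
  then have "a 1 - lam 1 - 1 = of_nat (k + m)" by (simp add: algebra_simps)
  then have "Re (a 1 - lam 1 - 1) = real (k + m)" by (metis Re_complex_of_real of_real_of_nat_eq)
  moreover have "\<bar>Re (a 1 - lam 1 - 1)\<bar> \<le> M"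
    unfolding M_def by (rule member_le_sum[OF a]) (use P in auto)
  ultimately show False using k by simp
qed

end

theory Submission
  imports Defs "HOL-Library.Function_Algebras" "HOL-Library.Countable_Set"
    "HOL-Computational_Algebra.Polynomial"
begin

text \<open>
  Put f_i = x_{i+1,i} + D_i, where D_i is the derivation inside eta_i. The two summands commute, so
  eta_i^a is the a-th power of f_i, expanded by the binomial series at x_{i+1,i}, and sigma_i acts as
  f_i^(mu_i + 1) on series of weight mu. The operators f_i, d_i and zeta_i are the Chevalley
  generators of sl(n): f_i comes from left multiplication on the enveloping algebra of the strictly
  lower triangular matrices (comm_low), and the commutator of d_k and f_i is zeta_i if i = k and 0
  otherwise (comm_raise_low).

  For natural exponents all identities between powers of the f_i hold in the ring of linear operators.
  The commutator of f_{i+1} and f_i commutes with both, and in such a Heisenberg algebra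
  f^a g^(a+b) f^b = g^b f^(a+b) g^a (heisenberg_braid). In an sl(2) triple,
  e f^m = f^m e + m f^(m-1) (h - m + 1) (sl2_power). To pass to complex exponents, fix a series and
  follow the coefficient of its image at a monomial whose exponents move with a in a fixed direction:
  it is a finite sum of binomial coefficients in a, hence a polynomial in a, and two polynomials that
  agree at all natural numbers are equal (poly_family_eqI). This yields the additivity of exponents
  (eta_eta), the commutation of distant powers (eta_commute), the braid identity (eta_braid) and the
  commutation rule with d_k (raise_eta).

  The weight of a monomial is recorded by a vector nu with nu_i - nu_{i+1} = mu_i + 1 and prescribed
  sum of entries. In these coordinates sigma_i exchanges the entries i and i + 1 and acts by
  f_i^(nu_i - nu_{i+1}) (reflect_homog). Hence on both sides of the braid relation the three exponents
  are those of eta_braid, with a = nu_{i+1} - nu_{i+2} and b = nu_i - nu_{i+1}; likewise sigma_i^2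
  has exponents a and -a. The relations extend to all series because sigma_i is compatible with the
  projections onto weight components (proj_reflect). The Coxeter presentation of the symmetric group
  (sym_group_presentation) turns them into an action.

  The formula for sigma_i does not depend on the decomposition into weighted series since every
  coefficient of eta_i^a(f) involves finitely many coefficients of f (formal_sum_reflect), and a
  decomposition exists since a series has countably many monomials (monomial_decomposition). A weighted
  series has finitely many monomials with given exponents of the x_{i+1,i} (homog_finite), so sigma_i
  preserves the weighted elements of the space of truncated-up series. Finally, d_k commutes with
  f_i^a for i \<noteq> k, while d_i f_i^a = f_i^a d_i + a f_i^(a-1) (zeta_i - a + 1) kills a solution of
  weight mu when a = mu_i + 1; so the weighted solutions are stable under all sigma_i, and 1 is one
  of them.
\<close>

section \<open>The algebra of linear operators on formal series\<close>

text \<open>The differential operators and their powers live in a ring, so that commutators can be computed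
  by ring arithmetic instead of on coefficients.\<close>

typedef linop = "{T :: fseries \<Rightarrow> fseries.
    (\<forall>f g. T (f + g) = T f + T g) \<and> (\<forall>c f. T (\<lambda>al. c * f al) = (\<lambda>al. c * T f al))}"
  morphisms app Linop
  by (rule exI[of _ "\<lambda>f. f"]) simp

setup_lifting type_definition_linop

lemma app_add: "app T (f + g) = app T f + app T g"
  using app[of T] by simp

lemma app_scale: "app T (\<lambda>al. c * f al) = (\<lambda>al. c * app T f al)"
  using app[of T] by simp

lemma app_0: "app T 0 = 0"
  using app_add[of T 0 0] by simp

instantiation linop :: ring_1
begin

lift_definition zero_linop :: linop is "\<lambda>_. 0" by (simp add: fun_eq_iff)
lift_definition one_linop :: linop is "\<lambda>f. f" by simp
lift_definition plus_linop :: "linop \<Rightarrow> linop \<Rightarrow> linop" is "\<lambda>S T f. S f + T f"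
  by (auto simp: fun_eq_iff algebra_simps)
lift_definition uminus_linop :: "linop \<Rightarrow> linop" is "\<lambda>S f. - S f"
  by (auto simp: fun_eq_iff)
lift_definition minus_linop :: "linop \<Rightarrow> linop \<Rightarrow> linop" is "\<lambda>S T f. S f - T f"
  by (auto simp: fun_eq_iff algebra_simps)
lift_definition times_linop :: "linop \<Rightarrow> linop \<Rightarrow> linop" is "\<lambda>S T f. S (T f)"
  by simp

instance
proof
  show "(0 :: linop) \<noteq> 1"
  proof
    assume "(0 :: linop) = 1"
    then have "app 0 f = app 1 f" for f by simp
    then have "(0 :: fseries) = (\<lambda>_. 1)" by (simp add: zero_linop.rep_eq one_linop.rep_eq)
    then show False by (simp add: fun_eq_iff)
  qed
qed (transfer; simp add: fun_eq_iff algebra_simps)+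

end

lemmas app_simps = plus_linop.rep_eq minus_linop.rep_eq uminus_linop.rep_eq times_linop.rep_eq
  zero_linop.rep_eq one_linop.rep_eq

lemma app_sum: "app (sum T I) f al = (\<Sum>i\<in>I. app (T i) f al)"
  by (induction I rule: infinite_finite_induct) (simp_all add: app_simps)

lemma app_power_Suc: "app (T ^ Suc m) f = app T (app (T ^ m) f)"
  by (simp add: app_simps)

definition comm :: "'a::ring \<Rightarrow> 'a \<Rightarrow> 'a" where
  "comm a b = a * b - b * a"

lemma comm_add_left: "comm (a + b) c = comm a c + comm b c"
  and comm_add_right: "comm c (a + b) = comm c a + comm c b"
  and comm_diff_left: "comm (a - b) c = comm a c - comm b c"
  and comm_diff_right: "comm c (a - b) = comm c a - comm c b"
  and comm_mult_left: "comm (a * b) c = a * comm b c + comm a c * b"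
  by (simp_all add: comm_def algebra_simps)

lemma comm_sum_left: "comm (sum f A) b = (\<Sum>a\<in>A. comm (f a) b)"
  and comm_sum_right: "comm b (sum f A) = (\<Sum>a\<in>A. comm b (f a))"
  by (simp_all add: comm_def sum_distrib_left sum_distrib_right sum_subtractf)

section \<open>The Weyl algebra\<close>

lift_definition xvar :: "nat \<Rightarrow> nat \<Rightarrow> linop" is "\<lambda>i j. xmul i j"
  by (auto simp: xpow_def fun_eq_iff)

lift_definition par :: "nat \<Rightarrow> nat \<Rightarrow> linop" is pd
  by (auto simp: pd_def fun_eq_iff algebra_simps)

lift_definition scalar :: "complex \<Rightarrow> linop" is "\<lambda>c f al. c * f al"
  by (auto simp: fun_eq_iff algebra_simps)

lemma comm_scalar: "comm (scalar c) T = 0"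
  unfolding comm_def by transfer (simp add: fun_eq_iff)

lemma comm_x_x: "comm (xvar i j) (xvar k l) = 0"
proof -
  have "xvar i j * xvar k l = xvar k l * xvar i j"
  proof (cases "(i, j) = (k, l)")
    case False
    then show ?thesis
      by transfer (auto simp: xpow_def fun_eq_iff fun_upd_twist)
  qed simp
  then show ?thesis by (simp add: comm_def)
qed

lemma comm_par_par: "comm (par i j) (par k l) = 0"
proof -
  have "par i j * par k l = par k l * par i j"
  proof (cases "(i, j) = (k, l)")
    case False
    then show ?thesis
      by transfer (auto simp: pd_def fun_eq_iff fun_upd_twist)
  qed simp
  then show ?thesis by (simp add: comm_def)
qed

lemma comm_par_x: "comm (par i j) (xvar k l) = (if i = k \<and> j = l then 1 else 0)"
proof (cases "(i, j) = (k, l)")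
  case True
  then show ?thesis
    unfolding comm_def by (auto, transfer) (auto simp: pd_def xpow_def fun_eq_iff algebra_simps)
next
  case False
  then show ?thesis
    unfolding comm_def
    by (auto; transfer) (auto simp: pd_def xpow_def fun_eq_iff fun_upd_twist)
qed

lemma comm_x_par: "comm (xvar k l) (par i j) = - (if i = k \<and> j = l then 1 else 0)"
  using comm_par_x[of i j k l] by (simp add: comm_def algebra_simps split: if_splits)

lemma comm_mult_right: "comm c (a * b) = a * comm c b + comm c a * b"
  by (simp add: comm_def algebra_simps)

text \<open>Up to the quadratic terms of d_k, the operators in question are sums of such vector fields and
  variables, so their commutators reduce to these.\<close>

lemma comm_vector_fields:
  "comm (xvar a b * par c d) (xvar e f * par g h) =
     (if c = e \<and> d = f then xvar a b * par g h else 0)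
   - (if a = g \<and> b = h then xvar e f * par c d else 0)"
  unfolding comm_mult_left comm_mult_right comm_x_x comm_par_par comm_par_x comm_x_par
  by (cases "c = e \<and> d = f"; cases "a = g \<and> b = h") auto

section \<open>Lowering operators\<close>

text \<open>For q < p this is the action of the matrix unit E_{p,q} by left multiplication on the enveloping
  algebra of the strictly lower triangular matrices, in ordered monomials. The operator inside
  eta_i^a is low (Suc i) i.\<close>

definition low :: "nat \<Rightarrow> nat \<Rightarrow> linop" where
  "low p q = xvar p q + (\<Sum>j=1..<q. xvar p j * par q j)"

lemma if_conj: "(if P \<and> Q then t else 0) = (if P then if Q then t else 0 else 0)"
  by simp

lemma sum_diag:
  fixes F :: "nat \<Rightarrow> nat \<Rightarrow> 'a::comm_monoid_add"
  assumes "s \<le> q"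
  shows "(\<Sum>j=1..<q. \<Sum>k=1..<s. if j = k then F j k else 0) = (\<Sum>j=1..<s. F j j)"
    "(\<Sum>j=1..<s. \<Sum>k=1..<q. if j = k then F j k else 0) = (\<Sum>j=1..<s. F j j)"
proof -
  have "(\<Sum>j=1..<q. \<Sum>k=1..<s. if j = k then F j k else 0) = (\<Sum>j=1..<q. if j < s then F j j else 0)"
    by (intro sum.cong) auto
  also have "\<dots> = (\<Sum>j=1..<s. F j j)"
    using assms by (intro sum.mono_neutral_cong_right) auto
  finally show "(\<Sum>j=1..<q. \<Sum>k=1..<s. if j = k then F j k else 0) = (\<Sum>j=1..<s. F j j)" .
  show "(\<Sum>j=1..<s. \<Sum>k=1..<q. if j = k then F j k else 0) = (\<Sum>j=1..<s. F j j)"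
    using assms by (intro sum.cong) auto
qed

text \<open>These are the relations of the matrix units. Setting x_{q,q} = 1 formally, low p q is the sum of
  x_{p,j} d_{q,j} over j \<le> q, and contracting the second index of one factor with the first index of
  the other leaves a sum over the shorter of the two ranges, which is again of this form.\<close>

lemma comm_low:
  assumes "1 \<le> q" "q < p" "1 \<le> s" "s < r"
  shows "comm (low p q) (low r s) = (if q = r then low p s else 0) - (if s = p then low r q else 0)"
proof -
  let ?D = "\<lambda>p q. \<Sum>j=1..<q. xvar p j * par q j"
  have 1: "comm (xvar p q) (?D r s) = - (if s = p then xvar r q else 0)"
    using assms by (simp add: comm_sum_right comm_mult_right comm_x_x comm_x_par sum_negf
        if_distrib[where f="\<lambda>t. _ * t"] cong: if_cong)
  have 2: "comm (?D p q) (xvar r s) = (if q = r then xvar p s else 0)"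
    using assms by (simp add: comm_sum_left comm_mult_left comm_x_x comm_par_x
        if_distrib[where f="\<lambda>t. _ * t"] cong: if_cong)
  have 3: "comm (?D p q) (?D r s) =
      (\<Sum>j=1..<q. \<Sum>k=1..<s. if q = r then (if j = k then xvar p j * par s k else 0) else 0)
    - (\<Sum>j=1..<q. \<Sum>k=1..<s. if s = p then (if j = k then xvar r k * par q j else 0) else 0)"
    unfolding comm_sum_left unfolding comm_sum_right comm_vector_fields sum_subtractf if_conj
    by (simp only: eq_commute[of p s])
  have 4: "(\<Sum>j=1..<q. \<Sum>k=1..<s. if q = r then (if j = k then xvar p j * par s k else 0) else 0)
      = (if q = r then ?D p s else 0)"
    using assms sum_diag(1)[of s q "\<lambda>j k. xvar p j * par s k"] by (cases "q = r") simp_all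
  have 5: "(\<Sum>j=1..<q. \<Sum>k=1..<s. if s = p then (if j = k then xvar r k * par q j else 0) else 0)
      = (if s = p then ?D r q else 0)"
    using assms sum_diag(2)[of q s "\<lambda>j k. xvar r k * par q j"] by (cases "s = p") simp_all
  show ?thesis
    unfolding low_def comm_add_left comm_add_right comm_x_x 1 2 3 4 5 by simp
qed

section \<open>Raising operators\<close>

text \<open>The bracket in front of the derivative in d_i.\<close>

definition cartan :: "nat \<Rightarrow> (nat \<Rightarrow> complex) \<Rightarrow> nat \<Rightarrow> linop" where
  "cartan n lam i = scalar (lam i) - (\<Sum>j=i+1..n. xvar j i * par j i)
     + (\<Sum>j=i+2..n. xvar j (i + 1) * par j (i + 1))"

definition raise :: "nat \<Rightarrow> (nat \<Rightarrow> complex) \<Rightarrow> nat \<Rightarrow> linop" where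
  "raise n lam i = cartan n lam i * par (i + 1) i + (\<Sum>j=1..<i. xvar i j * par (i + 1) j)
     - (\<Sum>j=i+2..n. xvar j (i + 1) * par j i)"

definition coroot :: "nat \<Rightarrow> (nat \<Rightarrow> complex) \<Rightarrow> nat \<Rightarrow> linop" where
  "coroot n lam i = scalar (lam i) + (\<Sum>p=1..<i. xvar i p * par i p - xvar (i + 1) p * par (i + 1) p)
     + (\<Sum>j=i+2..n. xvar j (i + 1) * par j (i + 1) - xvar j i * par j i)
     - 2 * (xvar (i + 1) i * par (i + 1) i)"

lemma app_at:
  "app (S + T) f al = app S f al + app T f al"
  "app (S - T) f al = app S f al - app T f al"
  "app (- T) f al = - app T f al"
  "app 0 f al = 0"
  by (simp_all add: app_simps)

lemma app_times: "app (S * T) f = app S (app T f)"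
  by (simp add: app_simps)

lemmas app_generators = xvar.rep_eq par.rep_eq scalar.rep_eq

lemma app_raise: "app (raise n lam i) f = d_op n lam i f"
  unfolding raise_def cartan_def d_op_def Let_def app_times app_generators app_at app_sum
  by (rule ext) (simp only: app_times app_at app_sum app_generators)

lemma app_coroot: "app (coroot n lam i) f = zeta n lam i f"
  unfolding coroot_def zeta_def mult_2
  by (rule ext) (simp only: app_times app_at app_sum app_generators)

text \<open>The sum over j is an Euler operator, counting the degree in the variables of column k from row l
  on. A term x_{i+1,k} d_{i,k} of low (Suc i) i keeps that degree unless the range separates the rows i
  and i + 1.\<close>

lemma comm_euler_column:
  assumes "1 \<le> i" "Suc i \<le> n" "1 \<le> k"
  shows "comm (\<Sum>j=l..n. xvar j k * par j k) (low (Suc i) i) =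
     (if k = i \<and> l \<le> Suc i then xvar (Suc i) i else 0)
   + (if k < i \<and> l = Suc i then xvar (Suc i) k * par i k else 0)"
proof -
  have 1: "comm (xvar j k * par j k) (xvar (Suc i) i) =
      (if j = Suc i then if k = i then xvar (Suc i) i else 0 else 0)" for j
    by (simp add: comm_mult_left comm_x_x comm_par_x)
  have 2: "(\<Sum>m=1..<i. comm (xvar j k * par j k) (xvar (Suc i) m * par i m)) =
     (if j = Suc i then if k < i then xvar (Suc i) k * par i k else 0 else 0)
   - (if j = i then if k < i then xvar (Suc i) k * par i k else 0 else 0)" for j
    using assms unfolding comm_vector_fields if_conj sum_subtractf by auto
  show ?thesis
    using assms unfolding comm_sum_left
    unfolding low_def comm_add_right comm_sum_right 1 2 sum.distrib sum_subtractf by auto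
qed

lemma comm_cartan_low:
  assumes "1 \<le> i" "i < n" "1 \<le> k" "k < n"
  shows "comm (cartan n lam k) (low (Suc i) i) =
     (if i = Suc k then xvar (Suc i) i else 0) - (if i = k then xvar (Suc i) i else 0)"
  using assms unfolding cartan_def
  by (simp add: comm_add_left comm_diff_left comm_scalar comm_euler_column)

lemma comm_par_low:
  assumes "1 \<le> i"
  shows "comm (par (Suc k) k) (low (Suc i) i) = (if i = k then 1 else 0)"
  unfolding low_def comm_add_right comm_sum_right comm_mult_right comm_par_par comm_par_x
  by auto

lemma comm_row_low:
  assumes "1 \<le> i" "1 \<le> k"
  shows "comm (\<Sum>j=1..<k. xvar k j * par (Suc k) j) (low (Suc i) i) =
    (if i = k then \<Sum>j=1..<k. xvar k j * par k j - xvar (Suc k) j * par (Suc k) j else 0)"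
proof -
  have 1: "comm (xvar k j * par (Suc k) j) (xvar (Suc i) i) = 0" if "j \<in> {1..<k}" for j
    using that by (auto simp: comm_mult_left comm_x_x comm_par_x)
  have 2: "(\<Sum>m=1..<i. comm (xvar k j * par (Suc k) j) (xvar (Suc i) m * par i m)) =
     (if i = k then xvar k j * par k j - xvar (Suc k) j * par (Suc k) j else 0)" if "j \<in> {1..<k}" for j
    using that assms unfolding comm_vector_fields if_conj sum_subtractf by auto
  have "comm (\<Sum>j=1..<k. xvar k j * par (Suc k) j) (low (Suc i) i)
      = (\<Sum>j=1..<k. if i = k then xvar k j * par k j - xvar (Suc k) j * par (Suc k) j else 0)"
    unfolding comm_sum_left
    unfolding low_def comm_add_right comm_sum_right
    by (intro sum.cong refl) (simp only: 1 2 add_0)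
  then show ?thesis by auto
qed

lemma comm_column_low:
  assumes "1 \<le> i" "i < n" "1 \<le> k"
  shows "comm (\<Sum>j=k+2..n. xvar j (Suc k) * par j k) (low (Suc i) i) =
    (if i = Suc k then xvar (Suc i) i * par i k else 0)"
proof -
  have 1: "comm (xvar j (Suc k) * par j k) (xvar (Suc i) i) = 0" if "j \<in> {k+2..n}" for j
    using that by (auto simp: comm_mult_left comm_x_x comm_par_x)
  have 2: "(\<Sum>m=1..<i. comm (xvar j (Suc k) * par j k) (xvar (Suc i) m * par i m)) =
      (if j = Suc i then if k < i then xvar (Suc i) (Suc k) * par i k else 0 else 0)
    - (if j = i then if Suc k < i then xvar (Suc i) (Suc k) * par i k else 0 else 0)" if "j \<in> {k+2..n}" for j
    using that assms unfolding comm_vector_fields if_conj sum_subtractf by auto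
  have "comm (\<Sum>j=k+2..n. xvar j (Suc k) * par j k) (low (Suc i) i) =
     (\<Sum>j=k+2..n. (if j = Suc i then if k < i then xvar (Suc i) (Suc k) * par i k else 0 else 0)
    - (if j = i then if Suc k < i then xvar (Suc i) (Suc k) * par i k else 0 else 0))"
    unfolding comm_sum_left
    unfolding low_def comm_add_right comm_sum_right
    by (intro sum.cong refl) (simp only: 1 2 add_0)
  also have "\<dots> = (if i = Suc k then xvar (Suc i) i * par i k else 0)"
    using assms unfolding sum_subtractf by auto
  finally show ?thesis .
qed

text \<open>For i = k + 1 the contribution of the Cartan part cancels that of the last sum in d_k; for
  i = k the remaining terms add up to zeta_k.\<close>

lemma comm_raise_low:
  assumes "1 \<le> i" "i < n" "1 \<le> k" "k < n"
  shows "comm (raise n lam k) (low (Suc i) i) = (if i = k then coroot n lam k else 0)"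
proof -
  have "comm (raise n lam k) (low (Suc i) i) =
     cartan n lam k * (if i = k then 1 else 0)
   + ((if i = Suc k then xvar (Suc i) i else 0) - (if i = k then xvar (Suc i) i else 0)) * par (Suc k) k
   + (if i = k then \<Sum>j=1..<k. xvar k j * par k j - xvar (Suc k) j * par (Suc k) j else 0)
   - (if i = Suc k then xvar (Suc i) i * par i k else 0)"
    using assms comm_row_low[of i k] comm_column_low[of i n k] comm_cartan_low[OF assms, of lam]
      comm_par_low[of i k]
    by (simp add: raise_def comm_add_left comm_diff_left comm_mult_left)
  also have "\<dots> = (if i = k then coroot n lam k else 0)"
  proof (cases "i = k")
    case True
    have "{k + 1..n} = insert (Suc k) {k + 2..n}" using assms by auto
    then have "(\<Sum>j=k+1..n. xvar j k * par j k)
        = xvar (Suc k) k * par (Suc k) k + (\<Sum>j=k+2..n. xvar j k * par j k)"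
      by simp
    then show ?thesis using True
      by (simp add: cartan_def coroot_def sum_subtractf mult_2)
  qed auto
  finally show ?thesis .
qed

lemma comm_coroot_low:
  assumes "1 \<le> i" "i < n"
  shows "comm (coroot n lam i) (low (Suc i) i) = - 2 * low (Suc i) i"
proof -
  let ?D = "\<Sum>m=1..<i. xvar (Suc i) m * par i m"
  have row: "comm (\<Sum>p=1..<i. xvar i p * par i p - xvar (i + 1) p * par (i + 1) p) (low (Suc i) i) = - 2 * ?D"
  proof -
    have 1: "comm (xvar i p * par i p - xvar (i + 1) p * par (i + 1) p) (xvar (Suc i) i)
        = 0" if "p \<in> {1..<i}" for p
      using that by (auto simp: comm_diff_left comm_mult_left comm_x_x comm_par_x)
    have 2: "(\<Sum>m=1..<i. comm (xvar i p * par i p - xvar (i + 1) p * par (i + 1) p) (xvar (Suc i) m * par i m))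
       = - 2 * (xvar (Suc i) p * par i p)" if "p \<in> {1..<i}" for p
      using that assms unfolding comm_vector_fields comm_diff_left if_conj sum_subtractf by (auto simp: mult_2)
    have "comm (\<Sum>p=1..<i. xvar i p * par i p - xvar (i + 1) p * par (i + 1) p) (low (Suc i) i)
       = (\<Sum>p=1..<i. - 2 * (xvar (Suc i) p * par i p))"
      unfolding comm_sum_left
    unfolding low_def comm_add_right comm_sum_right
      by (intro sum.cong refl) (simp only: 1 2 add_0)
    then show ?thesis by (simp add: sum_distrib_left)
  qed
  have col: "comm (\<Sum>j=i+2..n. xvar j (i + 1) * par j (i + 1) - xvar j i * par j i) (low (Suc i) i) = 0"
    using assms by (simp add: sum_subtractf comm_diff_left comm_euler_column)
  have "comm (xvar (i + 1) i * par (i + 1) i) (low (Suc i) i) = xvar (Suc i) i"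
    using comm_euler_column[of i "Suc i" i "Suc i"] assms by simp
  then have diag: "comm (2 * (xvar (i + 1) i * par (i + 1) i)) (low (Suc i) i) = 2 * xvar (Suc i) i"
    by (simp add: mult_2 comm_add_left)
  show ?thesis
    unfolding coroot_def comm_add_left[of "_ + _"] comm_add_left[of "scalar _"] comm_diff_left[of "_ + _"]
      row col diag comm_scalar
    by (simp add: low_def algebra_simps)
qed

section \<open>Identities for integral powers\<close>

text \<open>With N = A B, both A^m B^m and B^m A^m are polynomials in the commuting elements N and Z.
  Hence A^a B^a commutes with B^b A^b, and the two sides are the two products of these elements.\<close>

lemma heisenberg_braid:
  fixes A B Z :: "'a::ring_1"
  assumes BA: "B * A = A * B + Z" and ZA: "Z * A = A * Z" and ZB: "Z * B = B * Z"
  shows "A ^ a * B ^ (a + b) * A ^ b = B ^ b * A ^ (a + b) * B ^ a"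
proof -
  define N where "N = A * B"
  have NZ: "N * Z = Z * N"
    by (metis N_def ZA ZB mult.assoc)
  have Zc: "of_nat m * Z * y = y * (of_nat m * Z)" if "Z * y = y * Z" for m y
    by (metis that mult.assoc mult_of_nat_commute)
  (* moving N through a power of A or B adds a multiple of Z, so A^m B^m is a product of factors N - k Z *)
  have NA: "N * A ^ m = A ^ m * (N + of_nat m * Z)" for m
  proof (induction m)
    case (Suc m)
    have "N * A = A * (N + Z)" by (simp add: N_def BA mult.assoc distrib_left)
    then have 1: "(N + of_nat m * Z) * A = A * (N + of_nat (Suc m) * Z)"
      by (simp add: distrib_left distrib_right Zc[OF ZA])
    have "N * A ^ Suc m = (N * A ^ m) * A" by (simp only: power_Suc2 mult.assoc)
    also have "\<dots> = A ^ m * ((N + of_nat m * Z) * A)" by (simp only: Suc mult.assoc)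
    also have "\<dots> = A ^ Suc m * (N + of_nat (Suc m) * Z)" by (simp only: 1 power_Suc2 mult.assoc)
    finally show ?case .
  qed simp
  have NB: "N * B ^ m = B ^ m * (N - of_nat m * Z)" for m
  proof (induction m)
    case (Suc m)
    have "A * B = B * A - Z" by (simp add: BA)
    then have "N * B = B * (N - Z)"
      by (metis N_def ZB left_diff_distrib mult.assoc right_diff_distrib)
    then have "(N - of_nat m * Z) * B = B * (N - Z) - B * (of_nat m * Z)"
      by (simp only: left_diff_distrib Zc[OF ZB])
    then have 1: "(N - of_nat m * Z) * B = B * (N - of_nat (Suc m) * Z)"
      by (simp add: algebra_simps)
    have "N * B ^ Suc m = (N * B ^ m) * B" by (simp only: power_Suc2 mult.assoc)
    also have "\<dots> = B ^ m * ((N - of_nat m * Z) * B)" by (simp only: Suc mult.assoc)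
    also have "\<dots> = B ^ Suc m * (N - of_nat (Suc m) * Z)" by (simp only: 1 power_Suc2 mult.assoc)
    finally show ?case .
  qed simp
  have AB_comm: "(A ^ m * B ^ m) * y = y * (A ^ m * B ^ m)" if y: "N * y = y * N" "Z * y = y * Z" for y m
  proof (induction m)
    case (Suc m)
    have "A ^ Suc m * B ^ Suc m = A ^ m * (N * B ^ m)"
      by (simp only: power_Suc2[of A] power_Suc[of B] mult.assoc N_def)
    also have "\<dots> = A ^ m * B ^ m * (N - of_nat m * Z)" by (simp only: NB mult.assoc)
    finally have eq: "A ^ Suc m * B ^ Suc m = A ^ m * B ^ m * (N - of_nat m * Z)" .
    have "(N - of_nat m * Z) * y = y * (N - of_nat m * Z)"
      by (simp add: left_diff_distrib right_diff_distrib y Zc[OF y(2)])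
    then show ?case unfolding eq by (metis Suc mult.assoc)
  qed simp
  have BA_comm: "(B ^ m * A ^ m) * y = y * (B ^ m * A ^ m)" if y: "N * y = y * N" "Z * y = y * Z" for y m
  proof (induction m)
    case (Suc m)
    have "B ^ Suc m * A ^ Suc m = B ^ m * ((N + Z) * A ^ m)"
      by (simp only: power_Suc2[of B] power_Suc[of A] mult.assoc N_def flip: BA)
    also have "(N + Z) * A ^ m = A ^ m * (N + of_nat (Suc m) * Z)"
    proof -
      have "Z * A ^ m = A ^ m * Z" by (simp add: ZA power_commuting_commutes)
      then show ?thesis by (simp add: distrib_left distrib_right NA)
    qed
    finally have eq: "B ^ Suc m * A ^ Suc m = B ^ m * A ^ m * (N + of_nat (Suc m) * Z)"
      by (simp only: mult.assoc)
    have "(N + of_nat (Suc m) * Z) * y = y * (N + of_nat (Suc m) * Z)"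
      by (simp only: distrib_left distrib_right y Zc[OF y(2)])
    then show ?case unfolding eq by (metis Suc mult.assoc)
  qed simp
  have "N * (B ^ b * A ^ b) = (B ^ b * A ^ b) * N" "Z * (B ^ b * A ^ b) = (B ^ b * A ^ b) * Z"
    using BA_comm[of N b] BA_comm[of Z b] NZ by auto
  then have "(A ^ a * B ^ a) * (B ^ b * A ^ b) = (B ^ b * A ^ b) * (A ^ a * B ^ a)"
    by (rule AB_comm)
  moreover have "A ^ a * B ^ (a + b) * A ^ b = (A ^ a * B ^ a) * (B ^ b * A ^ b)"
    by (simp only: power_add mult.assoc)
  moreover have "B ^ b * A ^ (a + b) * B ^ a = (B ^ b * A ^ b) * (A ^ a * B ^ a)"
    by (simp only: add.commute[of a b] power_add mult.assoc)
  ultimately show ?thesis by simp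
qed

lemma sl2_power:
  fixes e f h :: "'a::ring_1"
  assumes ef: "e * f = f * e + h" and hf: "h * f = f * h - 2 * f"
  shows "e * f ^ Suc m = f ^ Suc m * e + of_nat (Suc m) * (f ^ m * (h - of_nat m))"
proof (induction m)
  case (Suc m)
  have 1: "(h - of_nat m) * f = f * (h - of_nat m - 2)"
    by (simp add: algebra_simps hf mult_of_nat_commute mult_2 mult_2_right)
  have "e * f ^ Suc (Suc m) = (e * f ^ Suc m) * f" by (simp only: power_Suc2 mult.assoc)
  also have "\<dots> = f ^ Suc m * (e * f) + of_nat (Suc m) * (f ^ m * ((h - of_nat m) * f))"
    unfolding Suc by (simp only: distrib_right mult.assoc)
  also have "\<dots> = f ^ Suc (Suc m) * e + (f ^ Suc m * h + of_nat (Suc m) * (f ^ Suc m * (h - of_nat m - 2)))"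
    unfolding 1 ef by (simp only: distrib_left power_Suc2 mult.assoc add.assoc)
  also have "f ^ Suc m * h + of_nat (Suc m) * (f ^ Suc m * (h - of_nat m - 2))
      = f ^ Suc m * (h + of_nat (Suc m) * (h - of_nat m - 2))"
    by (simp only: distrib_left mult.assoc mult_of_nat_commute)
  also have "h + of_nat (Suc m) * (h - of_nat m - 2) = of_nat (Suc (Suc m)) * (h - of_nat (Suc m))"
    by (simp add: algebra_simps flip: one_add_one)
  also have "f ^ Suc m * (of_nat (Suc (Suc m)) * (h - of_nat (Suc m)))
      = of_nat (Suc (Suc m)) * (f ^ Suc m * (h - of_nat (Suc m)))"
    by (metis mult.assoc mult_of_nat_commute)
  finally show ?case .
qed (simp add: ef)

section \<open>Complex powers of the lowering operators\<close>

text \<open>On series supported on admissible exponents the sum over p in eta_i^a is finite at every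
  monomial.\<close>

definition adm :: "nat \<Rightarrow> fseries set" where
  "adm n = {f. \<forall>al. f al \<noteq> 0 \<longrightarrow> admissible_expo n al}"

definition shift :: "nat \<Rightarrow> linop" where
  "shift i = (\<Sum>j=1..<i. xvar (Suc i) j * par i j)"

lemma low_shift: "low (Suc i) i = xvar (Suc i) i + shift i"
  by (simp add: low_def shift_def)

lemma eta_der_shift: "eta_der i f = app (shift i) f"
  by (rule ext) (simp add: eta_der_def shift_def app_sum app_times xvar.rep_eq par.rep_eq)

text \<open>Applying the derivation D_i, the coefficient at al is a combination of the coefficients at these
  exponents.\<close>

definition step :: "nat \<Rightarrow> nat \<Rightarrow> expo \<Rightarrow> expo" where
  "step i j al = al((Suc i, j) := al (Suc i, j) - 1, (i, j) := al (i, j) + 1)"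

lemma app_of_nat: "app (of_nat m) f al = of_nat m * f al"
  by (induction m) (simp_all add: app_at one_linop.rep_eq algebra_simps)

lemma shift_at: "app (shift i) f al = (\<Sum>j=1..<i. (al (i, j) + 1) * f (step i j al))"
  unfolding shift_def app_sum app_times
  by (intro sum.cong refl) (simp add: xvar.rep_eq par.rep_eq xpow_def pd_def step_def)

text \<open>The total degree in the variables x_{i+1,j}, j < i, all of whose exponents are natural numbers.
  It drops by one along each step, which bounds the number of applications of D_i.\<close>

definition bound :: "nat \<Rightarrow> expo \<Rightarrow> nat" where
  "bound i al = (\<Sum>j=1..<i. nat \<lfloor>Re (al (Suc i, j))\<rfloor>)"

lemma bound_step_le: "bound i (step i j al) \<le> bound i al"
  unfolding bound_def by (intro sum_mono) (auto simp: step_def intro!: nat_mono floor_mono)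

lemma bound_step:
  assumes "admissible_expo n (step i j al)" "j \<in> {1..<i}"
  shows "bound i al = Suc (bound i (step i j al))"
proof -
  have "step i j al (Suc i, j) \<in> \<nat>"
    using assms by (auto simp: admissible_expo_def)
  then obtain m where m: "al (Suc i, j) = of_nat (Suc m)"
    by (auto simp: step_def elim!: Nats_cases) (metis add.commute diff_add_cancel)
  have "bound i al = nat \<lfloor>Re (al (Suc i, j))\<rfloor> + (\<Sum>k\<in>{1..<i}-{j}. nat \<lfloor>Re (al (Suc i, k))\<rfloor>)"
    unfolding bound_def using assms(2) by (intro sum.remove) auto
  also have "nat \<lfloor>Re (al (Suc i, j))\<rfloor> = Suc (nat \<lfloor>Re (step i j al (Suc i, j))\<rfloor>)"
    using m by (simp add: step_def nat_add_distrib)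
  also have "(\<Sum>k\<in>{1..<i}-{j}. nat \<lfloor>Re (al (Suc i, k))\<rfloor>) =
      (\<Sum>k\<in>{1..<i}-{j}. nat \<lfloor>Re (step i j al (Suc i, k))\<rfloor>)"
    by (intro sum.cong refl) (auto simp: step_def)
  also have "Suc (nat \<lfloor>Re (step i j al (Suc i, j))\<rfloor>) + (\<Sum>k\<in>{1..<i}-{j}. nat \<lfloor>Re (step i j al (Suc i, k))\<rfloor>)
     = Suc (bound i (step i j al))"
    unfolding bound_def using assms(2) by (subst sum.remove[of _ j]) auto
  finally show ?thesis .
qed

lemma shift_adm:
  assumes "f \<in> adm n" "i < n"
  shows "app (shift i) f \<in> adm n"
proof -
  have "admissible_expo n al" if nz: "app (shift i) f al \<noteq> 0" for al
  proof -
    obtain j where "j \<in> {1..<i}" "(al (i, j) + 1) * f (step i j al) \<noteq> 0"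
      using nz unfolding shift_at by (rule sum.not_neutral_contains_not_neutral)
    then have j: "j \<in> {1..<i}" "al (i, j) + 1 \<noteq> 0" "f (step i j al) \<noteq> 0" by auto
    have a: "admissible_expo n (step i j al)"
      using j assms by (auto simp: adm_def)
    have nat: "al (i, j) \<in> \<nat>" if "j + 2 \<le> i"
    proof -
      have "al (i, j) + 1 \<in> \<nat>"
        using a that unfolding admissible_expo_def step_def by (metis fun_upd_same)
      then obtain m where m: "al (i, j) + 1 = of_nat m" by (auto elim: Nats_cases)
      with j(2) obtain l where "m = Suc l" by (cases m) auto
      with m have "al (i, j) = of_nat l" by simp
      then show ?thesis by simp
    qed
    have nat': "al (Suc i, j) \<in> \<nat>"
    proof -
      have "step i j al (Suc i, j) \<in> \<nat>"
        using a j by (auto simp: admissible_expo_def)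
      then show ?thesis
        by (auto simp: step_def) (metis Nats_1 Nats_add diff_add_cancel)
    qed
    have other: "al (r, c) = step i j al (r, c)" if "(r, c) \<noteq> (i, j)" "(r, c) \<noteq> (Suc i, j)" for r c
      using that by (auto simp: step_def)
    show ?thesis
      unfolding admissible_expo_def
    proof (intro conjI allI impI)
      fix r c assume "\<not> (1 \<le> c \<and> c < r \<and> r \<le> n)"
      then show "al (r, c) = 0"
        using other[of r c] a j assms(2) unfolding admissible_expo_def by auto
    next
      fix r c :: nat assume "c + 2 \<le> r"
      then show "al (r, c) \<in> \<nat>"
        using other[of r c] a nat nat' unfolding admissible_expo_def by auto metis
    qed
  qed
  then show ?thesis by (auto simp: adm_def)
qed

lemma shift_power_adm:
  assumes "f \<in> adm n" "i < n"
  shows "app (shift i ^ p) f \<in> adm n"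
  by (induction p) (use assms in \<open>auto simp: app_simps intro: shift_adm\<close>)

lemma shift_power_eq_0:
  assumes "f \<in> adm n" "i < n" "bound i al < p"
  shows "app (shift i ^ p) f al = 0"
  using assms(3)
proof (induction p arbitrary: al)
  case (Suc p)
  have "app (shift i ^ p) f (step i j al) = 0" if "j \<in> {1..<i}" for j
  proof (rule ccontr)
    assume nz: "app (shift i ^ p) f (step i j al) \<noteq> 0"
    then have "admissible_expo n (step i j al)"
      using shift_power_adm[OF assms(1,2), of p] by (auto simp: adm_def)
    then have "bound i (step i j al) < p"
      using bound_step that Suc.prems by force
    then show False using Suc.IH nz by blast
  qed
  then show ?case by (simp add: app_times shift_at)
qed simp

lemma eta_finite:
  assumes "f \<in> adm n" "i < n" "bound i al \<le> N"
  shows "eta i a f al = (\<Sum>p\<le>N. (a gchoose p) *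
     app (shift i ^ p) f (al((Suc i, i) := al (Suc i, i) - (a - of_nat p))))"
proof -
  have pw: "(eta_der i ^^ p) f = app (shift i ^ p) f" for p
    by (induction p) (simp_all add: eta_der_shift app_simps)
  have b: "bound i (al((Suc i, i) := t)) = bound i al" for t
    unfolding bound_def by (intro sum.cong) auto
  have "eta i a f al = Sum_any (\<lambda>p. (a gchoose p) *
     app (shift i ^ p) f (al((Suc i, i) := al (Suc i, i) - (a - of_nat p))))"
    unfolding eta_def pw xpow_def by simp
  also have "\<dots> = (\<Sum>p\<le>N. (a gchoose p) *
     app (shift i ^ p) f (al((Suc i, i) := al (Suc i, i) - (a - of_nat p))))"
    using shift_power_eq_0[OF assms(1,2)] assms(3) b
    by (intro Sum_any.expand_superset) (auto simp: not_le[symmetric], metis le_trans not_le)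
  finally show ?thesis .
qed

lemma admissible_expo_upd:
  assumes "1 \<le> i" "i < n"
  shows "admissible_expo n (al((Suc i, i) := t)) = admissible_expo n al"
proof -
  have 1: "(al((Suc i, i) := t)) (r, c) = al (r, c)" if "\<not> (1 \<le> c \<and> c < r \<and> r \<le> n) \<or> c + 2 \<le> r" for r c
    using that assms by auto
  show ?thesis
    unfolding admissible_expo_def
    by (intro conj_cong all_cong1 imp_cong refl) (subst 1, blast, rule refl)+
qed

lemma eta_adm:
  assumes "f \<in> adm n" "1 \<le> i" "i < n"
  shows "eta i a f \<in> adm n"
proof -
  have "admissible_expo n al" if nz: "eta i a f al \<noteq> 0" for al
  proof -
    obtain p where "(a gchoose p) *
        app (shift i ^ p) f (al((Suc i, i) := al (Suc i, i) - (a - of_nat p))) \<noteq> 0"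
      using nz unfolding eta_finite[OF assms(1,3) order_refl]
      by (rule sum.not_neutral_contains_not_neutral)
    then have "admissible_expo n (al((Suc i, i) := al (Suc i, i) - (a - of_nat p)))"
      using shift_power_adm[OF assms(1,3), of p] by (auto simp: adm_def)
    then show ?thesis using admissible_expo_upd assms(2,3) by simp
  qed
  then show ?thesis by (auto simp: adm_def)
qed

lemma adm_add: "f \<in> adm n \<Longrightarrow> g \<in> adm n \<Longrightarrow> f + g \<in> adm n"
  by (auto simp: adm_def) (metis add.right_neutral)

lemma adm_scale: "f \<in> adm n \<Longrightarrow> (\<lambda>al. c * f al) \<in> adm n"
  by (auto simp: adm_def)

lemma eta_add:
  assumes "f \<in> adm n" "g \<in> adm n" "i < n"
  shows "eta i a (f + g) al = eta i a f al + eta i a g al"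
  unfolding eta_finite[OF adm_add[OF assms(1,2)] assms(3) order_refl]
    eta_finite[OF assms(1,3) order_refl] eta_finite[OF assms(2,3) order_refl]
  by (simp add: app_add sum.distrib algebra_simps)

lemma eta_scale:
  assumes "f \<in> adm n" "i < n"
  shows "eta i a (\<lambda>al. c * f al) al = c * eta i a f al"
  unfolding eta_finite[OF adm_scale[OF assms(1)] assms(2) order_refl]
    eta_finite[OF assms(1,2) order_refl]
  by (simp add: app_scale sum_distrib_left algebra_simps)

lemma eta_0:
  assumes "f \<in> adm n" "i < n"
  shows "eta i 0 f = f"
proof
  fix al
  have "(\<Sum>p\<le>bound i al. (0 gchoose p) * app (shift i ^ p) f (al((Suc i, i) := al (Suc i, i) - (0 - of_nat p))))
    = (\<Sum>p\<le>bound i al. if p = 0 then f al else 0)"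
    by (intro sum.cong refl) (auto simp: app_simps gr0_conv_Suc)
  then show "eta i 0 f al = f al"
    unfolding eta_finite[OF assms order_refl] by simp
qed

text \<open>Since x_{i+1,i} and D_i commute, this is Pascal's rule in the binomial series.\<close>

lemma eta_Suc:
  assumes f: "f \<in> adm n" and i: "1 \<le> i" "i < n"
  shows "eta i (a + 1) f = app (low (Suc i) i) (eta i a f)"
proof
  fix al
  define g where "g p = app (shift i ^ p) f" for p
  define N where "N = bound i al"
  (* the coefficient of D_i^p f that enters the term of index p for the exponent a + 1 *)
  define h where "h p = g p (al((Suc i, i) := al (Suc i, i) - (a + 1 - of_nat p)))" for p
  have b: "bound i (al((Suc i, i) := t)) = N" for t
    unfolding bound_def N_def by (intro sum.cong) auto
  have h0: "h (Suc (Suc N)) = 0"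
    unfolding h_def g_def by (rule shift_power_eq_0[OF f i(2)]) (simp add: b)
  have "app (xvar (Suc i) i) (eta i a f) al = eta i a f (al((Suc i, i) := al (Suc i, i) - 1))"
    by (simp add: xvar.rep_eq xpow_def)
  also have "\<dots> = (\<Sum>p\<le>Suc N. (a gchoose p) * h p)"
    by (subst eta_finite[OF f i(2), of _ "Suc N"]) (simp_all add: b h_def g_def algebra_simps)
  finally have 1: "app (xvar (Suc i) i) (eta i a f) al = (\<Sum>p\<le>Suc N. (a gchoose p) * h p)" .
  have st: "(step i j al)((Suc i, i) := step i j al (Suc i, i) - t)
      = step i j (al((Suc i, i) := al (Suc i, i) - t))"
    if "j \<in> {1..<i}" for j t
    using that by (auto simp: step_def)
  have "app (shift i) (eta i a f) al =
      (\<Sum>j=1..<i. (al (i, j) + 1) * (\<Sum>p\<le>Suc N. (a gchoose p) * g p (step i j (al((Suc i, i) := al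
          (Suc i, i) - (a - of_nat p))))))"
    unfolding shift_at
  proof (intro sum.cong refl)
    fix j assume j: "j \<in> {1..<i}"
    have "bound i (step i j al) \<le> Suc N" using bound_step_le[of i j al] by (simp add: N_def)
    then show "(al (i, j) + 1) * eta i a f (step i j al) = (al (i, j) + 1) *
       (\<Sum>p\<le>Suc N. (a gchoose p) * g p (step i j (al((Suc i, i) := al (Suc i, i) - (a - of_nat p)))))"
      by (simp only: eta_finite[OF f i(2)] st[OF j] g_def)
  qed
  also have "\<dots> = (\<Sum>p\<le>Suc N. (a gchoose p) *
      app (shift i) (g p) (al((Suc i, i) := al (Suc i, i) - (a - of_nat p))))"
    unfolding shift_at sum_distrib_left by (subst sum.swap) (simp add: algebra_simps)
  also have "\<dots> = (\<Sum>p\<le>Suc N. (a gchoose p) * h (Suc p))"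
    by (simp add: h_def g_def app_simps)
  finally have 2: "app (shift i) (eta i a f) al = (\<Sum>p\<le>Suc N. (a gchoose p) * h (Suc p))" .
  have "eta i (a + 1) f al = (\<Sum>p\<le>Suc N. ((a + 1) gchoose p) * h p)"
    by (subst eta_finite[OF f i(2), of _ "Suc N"]) (simp_all add: N_def h_def g_def)
  also have "\<dots> = h 0 + (\<Sum>p\<le>N. ((a gchoose p) + (a gchoose Suc p)) * h (Suc p))"
    by (subst sum.atMost_Suc_shift) (simp add: gbinomial_Suc_Suc)
  also have "\<dots> = (\<Sum>p\<le>Suc N. (a gchoose p) * h p) + (\<Sum>p\<le>Suc N. (a gchoose p) * h (Suc p))"
    by (subst sum.atMost_Suc_shift) (simp add: algebra_simps sum.distrib h0)
  finally show "eta i (a + 1) f al = app (low (Suc i) i) (eta i a f) al"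
    by (simp add: low_shift app_at 1 2)
qed

lemma eta_of_nat:
  assumes "f \<in> adm n" "1 \<le> i" "i < n"
  shows "eta i (of_nat m) f = app (low (Suc i) i ^ m) f"
proof (induction m)
  case (Suc m)
  have "eta i (of_nat (Suc m)) f = eta i (of_nat m + 1) f" by (simp add: add.commute)
  then show ?case by (simp only: eta_Suc[OF assms] Suc app_power_Suc)
qed (simp add: eta_0[OF assms(1,3)] app_simps)

section \<open>Polynomial dependence on the exponents\<close>

definition poly_fun :: "(complex \<Rightarrow> complex) \<Rightarrow> bool" where
  "poly_fun g \<longleftrightarrow> (\<exists>p. \<forall>a. g a = poly p a)"

lemma poly_fun_const [intro!]: "poly_fun (\<lambda>_. c)"
  unfolding poly_fun_def by (rule exI[of _ "[:c:]"]) simp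

lemma poly_fun_id [intro!]: "poly_fun (\<lambda>a. a)"
  unfolding poly_fun_def by (rule exI[of _ "[:0, 1:]"]) simp

lemma poly_fun_add [intro!]: "poly_fun g \<Longrightarrow> poly_fun h \<Longrightarrow> poly_fun (\<lambda>a. g a + h a)"
  unfolding poly_fun_def by (metis poly_add)

lemma poly_fun_diff [intro!]: "poly_fun g \<Longrightarrow> poly_fun h \<Longrightarrow> poly_fun (\<lambda>a. g a - h a)"
  unfolding poly_fun_def by (metis poly_diff)

lemma poly_fun_mult [intro!]: "poly_fun g \<Longrightarrow> poly_fun h \<Longrightarrow> poly_fun (\<lambda>a. g a * h a)"
  unfolding poly_fun_def by (metis poly_mult)

lemma poly_fun_sum [intro!]: "(\<And>i. i \<in> I \<Longrightarrow> poly_fun (g i)) \<Longrightarrow> poly_fun (\<lambda>a. \<Sum>i\<in>I. g i a)"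
  by (induction I rule: infinite_finite_induct) auto

lemma poly_fun_gchoose [intro!]:
  assumes "poly_fun g"
  shows "poly_fun (\<lambda>a. g a gchoose p)"
proof -
  have "poly_fun (\<lambda>a. \<Prod>i<m. g a - of_nat i)" for m
    by (induction m) (use assms in auto)
  then have "poly_fun (\<lambda>a. (\<Prod>i<p. g a - of_nat i) * inverse (fact p))" by auto
  then show ?thesis by (simp add: gbinomial_prod_rev divide_inverse atLeast0LessThan)
qed

lemma poly_fun_eqI:
  assumes "poly_fun g" "poly_fun h" "\<And>m::nat. g (of_nat m) = h (of_nat m)"
  shows "g a = h a"
proof -
  obtain p q where pq: "\<And>a. g a = poly p a" "\<And>a. h a = poly q a"
    using assms by (auto simp: poly_fun_def)
  have "p - q = 0"
  proof (rule ccontr)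
    assume "p - q \<noteq> 0"
    then have "finite {z. poly (p - q) z = 0}" by (rule poly_roots_finite)
    moreover have "range (of_nat :: nat \<Rightarrow> complex) \<subseteq> {z. poly (p - q) z = 0}"
      using assms(3) by (auto simp: pq)
    ultimately have "finite (range (of_nat :: nat \<Rightarrow> complex))" by (rule finite_subset[rotated])
    then have "finite (UNIV :: nat set)" by (rule finite_imageD) (simp add: inj_of_nat)
    then show False by simp
  qed
  then show ?thesis using pq by simp
qed

text \<open>The coefficients of F a, read at exponents that move by a v, are polynomial functions of a. The
  shift by a v compensates for the factor x_{i+1,i}^a in front of eta_i^a.\<close>

definition poly_family :: "expo \<Rightarrow> (complex \<Rightarrow> fseries) \<Rightarrow> bool" where
  "poly_family v F \<longleftrightarrow> (\<forall>al. poly_fun (\<lambda>a. F a (\<lambda>q. al q + a * v q)))"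

text \<open>This is the principle that carries identities from natural to complex exponents.\<close>

lemma poly_family_eqI:
  assumes "poly_family v F" "poly_family v G" "\<And>m::nat. F (of_nat m) = G (of_nat m)"
  shows "F a = G a"
proof
  fix al
  (* the line through al in the direction v, started at parameter 0 *)
  define be where "be = (\<lambda>q. al q - a * v q)"
  have F: "poly_fun (\<lambda>b. F b (\<lambda>q. be q + b * v q))" and G: "poly_fun (\<lambda>b. G b (\<lambda>q. be q + b * v q))"
    using assms(1,2) unfolding poly_family_def by blast+
  have "F a (\<lambda>q. be q + a * v q) = G a (\<lambda>q. be q + a * v q)"
    by (rule poly_fun_eqI[OF F G]) (simp only: assms(3))
  then show "F a al = G a al" by (simp add: be_def)
qed

lemma poly_family_const: "poly_family (\<lambda>_. 0) (\<lambda>_. f)"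
  by (auto simp: poly_family_def)

lemma poly_family_scale: "poly_fun g \<Longrightarrow> poly_family v F \<Longrightarrow> poly_family v (\<lambda>a al. g a * F a al)"
  by (auto simp: poly_family_def)

text \<open>Operators with polynomial coefficients are tame: they shift exponents by constants and multiply by
  polynomials in the exponents.\<close>

definition tame :: "linop \<Rightarrow> bool" where
  "tame T \<longleftrightarrow> (\<forall>v F. poly_family v F \<longrightarrow> poly_family v (\<lambda>a. app T (F a)))"

lemma tame_add [intro!]: "tame S \<Longrightarrow> tame T \<Longrightarrow> tame (S + T)"
  and tame_diff [intro!]: "tame S \<Longrightarrow> tame T \<Longrightarrow> tame (S - T)"
  and tame_mult [intro!]: "tame S \<Longrightarrow> tame T \<Longrightarrow> tame (S * T)"
  and tame_0: "tame 0"
  and tame_1: "tame 1"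
  by (auto simp: tame_def poly_family_def app_simps)

lemma tame_sum [intro!]: "(\<And>i. i \<in> I \<Longrightarrow> tame (T i)) \<Longrightarrow> tame (sum T I)"
  by (induction I rule: infinite_finite_induct) (auto intro: tame_0)

lemma tame_power: "tame T \<Longrightarrow> tame (T ^ p)"
  by (induction p) (auto intro: tame_1)

lemma tame_scalar [intro!]: "tame (scalar c)"
  by (auto simp: tame_def poly_family_def scalar.rep_eq)

lemma upd_line: "(\<lambda>q. al q + a * v q)((i, j) := al (i, j) + a * v (i, j) + t)
    = (\<lambda>q. (al((i, j) := al (i, j) + t)) q + a * v q)" for al v :: expo
  by (rule ext) simp

lemma tame_x [intro!]: "tame (xvar i j)"
  unfolding tame_def poly_family_def
proof (intro allI impI)
  fix v al :: expo and F assume F: "\<forall>al. poly_fun (\<lambda>a. F a (\<lambda>q. al q + a * v q))"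
  have "app (xvar i j) (F a) (\<lambda>q. al q + a * v q) = F a (\<lambda>q. (al((i, j) := al (i, j) + - 1)) q + a * v q)" for a
    by (simp only: xvar.rep_eq xpow_def diff_conv_add_uminus upd_line)
  then show "poly_fun (\<lambda>a. app (xvar i j) (F a) (\<lambda>q. al q + a * v q))"
    using F by presburger
qed

lemma tame_par [intro!]: "tame (par i j)"
  unfolding tame_def poly_family_def
proof (intro allI impI)
  fix v al :: expo and F assume F: "\<forall>al. poly_fun (\<lambda>a. F a (\<lambda>q. al q + a * v q))"
  have "poly_fun (\<lambda>a. (al (i, j) + a * v (i, j) + 1) * F a (\<lambda>q. (al((i, j) := al (i, j) + 1)) q + a * v q))"
    by (intro poly_fun_mult poly_fun_add poly_fun_const poly_fun_id F[rule_format])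
  moreover have "app (par i j) (F a) (\<lambda>q. al q + a * v q)
      = (al (i, j) + a * v (i, j) + 1) * F a (\<lambda>q. (al((i, j) := al (i, j) + 1)) q + a * v q)" for a
    by (simp only: par.rep_eq pd_def upd_line)
  ultimately show "poly_fun (\<lambda>a. app (par i j) (F a) (\<lambda>q. al q + a * v q))"
    by presburger
qed

lemma tame_shift: "tame (shift i)"
  unfolding shift_def by auto

lemma tame_raise: "tame (raise n lam i)"
  unfolding raise_def cartan_def by auto

text \<open>The direction v vanishes on the variables x_{i+1,j}, j < i, so the number of terms of the
  binomial series does not change along the line.\<close>

lemma poly_family_eta:
  assumes F: "poly_family v F" "\<And>a. F a \<in> adm n" and i: "i < n"
    and v: "\<And>j. j \<in> {1..<i} \<Longrightarrow> v (Suc i, j) = 0"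
    and w: "w = (\<lambda>q. v q + (if q = (Suc i, i) then s else 0))"
  shows "poly_family w (\<lambda>a. eta i (s * a + t) (F a))"
  unfolding poly_family_def
proof
  fix al
  define N where "N = bound i al"
  have b: "bound i (\<lambda>q. al q + a * w q) \<le> N" for a
    unfolding bound_def N_def by (rule eq_refl, intro sum.cong refl) (auto simp: v w)
  have upd: "(\<lambda>q. al q + a * w q)((Suc i, i) := al (Suc i, i) + a * w (Suc i, i) - (s * a + t - of_nat p))
     = (\<lambda>q. (al((Suc i, i) := al (Suc i, i) - t + of_nat p)) q + a * v q)" for a p
    by (auto simp: w algebra_simps)
  have "poly_fun (\<lambda>a. \<Sum>p\<le>N. ((s * a + t) gchoose p) *
      app (shift i ^ p) (F a) (\<lambda>q. (al((Suc i, i) := al (Suc i, i) - t + of_nat p)) q + a * v q))"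
  proof (intro poly_fun_sum poly_fun_mult)
    fix p
    show "poly_fun (\<lambda>a. app (shift i ^ p) (F a) (\<lambda>q. (al((Suc i, i) := al (Suc i, i) - t + of_nat p)) q
        + a * v q))"
      using tame_power[OF tame_shift, of i p] F(1) unfolding tame_def poly_family_def by blast
  qed auto
  then show "poly_fun (\<lambda>a. eta i (s * a + t) (F a) (\<lambda>q. al q + a * w q))"
    unfolding eta_finite[OF F(2) i b] upd .
qed

section \<open>Relations between complex powers\<close>

text \<open>For a natural a the left side applies f_i repeatedly, which raises the exponent by one each time,
  for any complex b.\<close>

lemma eta_eta:
  assumes f: "f \<in> adm n" and i: "1 \<le> i" "i < n"
  shows "eta i a (eta i b f) = eta i (a + b) f"
proof -
  let ?w = "\<lambda>q. if q = (Suc i, i) then 1 else 0"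
  have g: "eta i b f \<in> adm n" by (rule eta_adm[OF f i])
  have L: "poly_family ?w (\<lambda>a. eta i (1 * a + 0) (eta i b f))"
    by (rule poly_family_eta[OF poly_family_const g i(2)]) auto
  have R: "poly_family ?w (\<lambda>a. eta i (1 * a + b) f)"
    by (rule poly_family_eta[OF poly_family_const f i(2)]) auto
  have nat: "eta i (1 * of_nat m + 0) (eta i b f) = eta i (1 * of_nat m + b) f" for m
  proof (induction m)
    case (Suc m)
    have "eta i (of_nat (Suc m)) (eta i b f) = app (low (Suc i) i) (eta i (of_nat m) (eta i b f))"
      by (simp only: eta_of_nat[OF g i] app_power_Suc)
    also have "\<dots> = app (low (Suc i) i) (eta i (of_nat m + b) f)" using Suc by simp
    also have "\<dots> = eta i (of_nat m + b + 1) f" by (rule eta_Suc[OF f i, symmetric])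
    finally show ?case by (simp add: algebra_simps)
  qed (simp add: eta_0[OF g i(2)])
  from poly_family_eqI[OF L R nat, of a] show ?thesis by simp
qed

abbreviation simple_dir :: "nat \<Rightarrow> expo" where
  "simple_dir i \<equiv> \<lambda>q. if q = (Suc i, i) then 1 else 0"

lemma poly_family_eta_const:
  assumes "f \<in> adm n" "i < n"
  shows "poly_family (simple_dir i) (\<lambda>a. eta i (1 * a + t) f)"
  by (rule poly_family_eta[OF poly_family_const assms]) auto

text \<open>The identity is known for natural exponents; it is extended first in a, with b natural, and then
  in b.\<close>

lemma eta_commute:
  assumes f: "f \<in> adm n" and i: "1 \<le> i" "i < n" and k: "1 \<le> k" "k < n" and far: "i + 2 \<le> k"
  shows "eta i a (eta k b f) = eta k b (eta i a f)"
proof -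
  have nat: "eta i (of_nat m) (eta k (of_nat l) f) = eta k (of_nat l) (eta i (of_nat m) f)" for m l
  proof -
    let ?A = "low (Suc i) i" and ?B = "low (Suc k) k"
    have "comm ?A ?B = 0" using comm_low[of i "Suc i" k "Suc k"] i k far by simp
    then have "?A * ?B = ?B * ?A" by (simp add: comm_def)
    then have AB: "?A ^ m * ?B ^ l = ?B ^ l * ?A ^ m"
      by (metis power_commuting_commutes)
    have "eta i (of_nat m) (eta k (of_nat l) f) = app (?A ^ m) (eta k (of_nat l) f)"
      by (rule eta_of_nat[OF eta_adm[OF f k] i])
    also have "\<dots> = app (?A ^ m * ?B ^ l) f" by (simp only: eta_of_nat[OF f k] app_times)
    also have "\<dots> = app (?B ^ l) (eta i (of_nat m) f)"
      unfolding AB by (simp only: eta_of_nat[OF f i] app_times)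
    also have "\<dots> = eta k (of_nat l) (eta i (of_nat m) f)"
      by (rule eta_of_nat[OF eta_adm[OF f i] k, symmetric])
    finally show ?thesis .
  qed
  have 1: "eta i a (eta k (of_nat l) f) = eta k (of_nat l) (eta i a f)" for a l
  proof -
    have L: "poly_family (simple_dir i) (\<lambda>a. eta i (1 * a + 0) (eta k (of_nat l) f))"
      by (rule poly_family_eta_const[OF eta_adm[OF f k] i(2)])
    have R: "poly_family (simple_dir i) (\<lambda>a. eta k (0 * a + of_nat l) (eta i (1 * a + 0) f))"
      by (rule poly_family_eta[OF poly_family_eta_const[OF f i(2)] eta_adm[OF f i] k(2)]) auto
    have "eta i (1 * of_nat m + 0) (eta k (of_nat l) f)
        = eta k (0 * of_nat m + of_nat l) (eta i (1 * of_nat m + 0) f)" for m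
      using nat by simp
    from poly_family_eqI[OF L R this, of a] show ?thesis by simp
  qed
  have L: "poly_family (simple_dir k) (\<lambda>b. eta i (0 * b + a) (eta k (1 * b + 0) f))"
    by (rule poly_family_eta[OF poly_family_eta_const[OF f k(2)] eta_adm[OF f k] i(2)]) (use far in auto)
  have R: "poly_family (simple_dir k) (\<lambda>b. eta k (1 * b + 0) (eta i a f))"
    by (rule poly_family_eta_const[OF eta_adm[OF f i] k(2)])
  have "eta i (0 * of_nat m + a) (eta k (1 * of_nat m + 0) f) = eta k (1 * of_nat m + 0) (eta i a f)" for m
    using 1 by simp
  from poly_family_eqI[OF L R this, of b] show ?thesis by simp
qed

text \<open>As before, heisenberg_braid is extended first in a and then in b. Along each of these lines both
  sides move in the direction x_{i+1,i} x_{i+2,i+1}, since the two exponents grow by the same amount.\<close>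

lemma eta_braid:
  assumes f: "f \<in> adm n" and i: "1 \<le> i" "Suc i < n"
  shows "eta i a (eta (Suc i) (a + b) (eta i b f)) = eta (Suc i) b (eta i (a + b) (eta (Suc i) a f))"
proof -
  let ?w = "\<lambda>q. simple_dir i q + simple_dir (Suc i) q"
  let ?k = "Suc i"
  have i': "i < n" and k: "1 \<le> ?k" "?k < n" using i by auto
  note adm = eta_adm[OF _ i(1) i'] eta_adm[OF _ k]
  have famL: "poly_family ?w (\<lambda>a. eta i (1 * a + s) (eta ?k (1 * a + t) g))" if g: "g \<in> adm n" for g s t
    by (rule poly_family_eta[OF poly_family_eta_const[OF g k(2)] adm(2)[OF g] i']) auto
  have famR: "poly_family ?w (\<lambda>a. eta ?k (1 * a + s) (eta i (1 * a + t) g))" if g: "g \<in> adm n" for g s t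
    by (rule poly_family_eta[OF poly_family_eta_const[OF g i'] adm(1)[OF g] k(2)]) auto
  have nat: "eta i (of_nat a) (eta ?k (of_nat (a + b)) (eta i (of_nat b) f))
    = eta ?k (of_nat b) (eta i (of_nat (a + b)) (eta ?k (of_nat a) f))" for a b
  proof -
    let ?A = "low ?k i" and ?B = "low (Suc ?k) ?k" and ?Z = "low (Suc ?k) i"
    have "comm ?B ?A = ?Z" "comm ?Z ?A = 0" "comm ?Z ?B = 0"
      using i by (simp_all add: comm_low)
    then have braid: "?A ^ a * ?B ^ (a + b) * ?A ^ b = ?B ^ b * ?A ^ (a + b) * ?B ^ a"
      by (intro heisenberg_braid[of _ _ ?Z]) (simp_all add: comm_def algebra_simps)
    have A: "eta i (of_nat m) g = app (?A ^ m) g" if "g \<in> adm n" for m g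
      by (rule eta_of_nat[OF that i(1) i'])
    have B: "eta ?k (of_nat m) g = app (?B ^ m) g" if "g \<in> adm n" for m g
      by (rule eta_of_nat[OF that k])
    have "eta i (of_nat a) (eta ?k (of_nat (a + b)) (eta i (of_nat b) f))
       = app (?A ^ a * ?B ^ (a + b) * ?A ^ b) f"
      unfolding A[OF adm(2)[OF adm(1)[OF f]]] unfolding B[OF adm(1)[OF f]] unfolding A[OF f]
      by (simp only: app_times)
    also have "\<dots> = eta ?k (of_nat b) (eta i (of_nat (a + b)) (eta ?k (of_nat a) f))"
      unfolding B[OF adm(1)[OF adm(2)[OF f]]] unfolding A[OF adm(2)[OF f]] unfolding B[OF f]
      by (simp only: app_times braid)
    finally show ?thesis .
  qed
  have 1: "eta i a (eta ?k (a + of_nat b) (eta i (of_nat b) f))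
      = eta ?k (of_nat b) (eta i (a + of_nat b) (eta ?k a f))" for a b
  proof -
    have L: "poly_family ?w (\<lambda>a. eta i (1 * a + 0) (eta ?k (1 * a + of_nat b) (eta i (of_nat b) f)))"
      by (rule famL[OF adm(1)[OF f]])
    have R: "poly_family ?w (\<lambda>a. eta ?k (0 * a + of_nat b) (eta i (1 * a + of_nat b) (eta ?k (1 * a + 0) f)))"
      by (rule poly_family_eta[OF famL[OF f] adm(1)[OF adm(2)[OF f]] k(2)]) auto
    have "eta i (1 * of_nat m + 0) (eta ?k (1 * of_nat m + of_nat b) (eta i (of_nat b) f))
        = eta ?k (0 * of_nat m + of_nat b) (eta i (1 * of_nat m + of_nat b) (eta ?k (1 * of_nat m
            + 0) f))" for m
      using nat[of m b] by simp
    from poly_family_eqI[OF L R this, of a] show ?thesis by simp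
  qed
  have L: "poly_family ?w (\<lambda>b. eta i (0 * b + a) (eta ?k (1 * b + a) (eta i (1 * b + 0) f)))"
    by (rule poly_family_eta[OF famR[OF f] adm(2)[OF adm(1)[OF f]] i']) auto
  have R: "poly_family ?w (\<lambda>b. eta ?k (1 * b + 0) (eta i (1 * b + a) (eta ?k a f)))"
    by (rule famR[OF adm(2)[OF f]])
  have "eta i (0 * of_nat m + a) (eta ?k (1 * of_nat m + a) (eta i (1 * of_nat m + 0) f))
      = eta ?k (1 * of_nat m + 0) (eta i (1 * of_nat m + a) (eta ?k a f))" for m
    using 1[of a m] by (simp add: add.commute)
  from poly_family_eqI[OF L R this, of b] show ?thesis by (simp add: add.commute)
qed

text \<open>For a natural a this is the commutation rule of sl(2) if i = k, and the vanishing of a commutator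
  otherwise.\<close>

lemma raise_eta:
  assumes f: "f \<in> adm n" and i: "1 \<le> i" "i < n" and k: "1 \<le> k" "k < n"
    and e: "app (raise n lam k) f = 0" and h: "app (coroot n lam i) f = (\<lambda>al. c * f al)"
  shows "app (raise n lam k) (eta i a f) = (\<lambda>al. (if i = k then a * (c - (a - 1)) else 0) * eta i (a - 1) f al)"
proof -
  let ?E = "raise n lam k" and ?F = "low (Suc i) i" and ?H = "coroot n lam i"
  let ?g = "\<lambda>a. if i = k then a * (c - (a - 1)) else 0"
  have nat: "app ?E (eta i (of_nat m) f) = (\<lambda>al. ?g (of_nat m) * eta i (of_nat m - 1) f al)" for m
  proof (cases m)
    case 0
    show ?thesis unfolding 0 by (rule ext) (simp add: eta_0[OF f i(2)] e)
  next
    case (Suc l)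
    show ?thesis
    proof (cases "i = k")
      case True
      have "?E * ?F ^ Suc l = ?F ^ Suc l * ?E + of_nat (Suc l) * (?F ^ l * (?H - of_nat l))"
        using comm_raise_low[OF i k, of lam] comm_coroot_low[OF i, of lam] True
        by (intro sl2_power) (simp_all add: comm_def algebra_simps)
      moreover have "app (?H - of_nat l) f = (\<lambda>al. (c - of_nat l) * f al)"
        by (rule ext) (simp add: app_at h app_of_nat algebra_simps)
      ultimately have "app (?E * ?F ^ Suc l) f = (\<lambda>al. of_nat (Suc l) * ((c - of_nat l) * app (?F ^ l) f al))"
        by (intro ext) (simp add: app_at app_times e app_0 app_of_nat app_scale del: of_nat_Suc power_Suc)
      then have "app ?E (app (?F ^ Suc l) f) = (\<lambda>al. of_nat (Suc l) * ((c - of_nat l) * app (?F ^ l) f al))"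
        by (simp only: app_times)
      moreover have "eta i (of_nat m) f = app (?F ^ Suc l) f" "eta i (of_nat m - 1) f = app (?F ^ l) f"
        using eta_of_nat[OF f i, of m] eta_of_nat[OF f i, of l] Suc by simp_all
      moreover have "?g (of_nat m) = of_nat (Suc l) * (c - of_nat l)" using True Suc by simp
      ultimately show ?thesis by (simp only: mult.assoc)
    next
      case False
      have "?E * ?F = ?F * ?E"
        using comm_raise_low[OF i k, of lam] False by (simp add: comm_def)
      then have "?E * ?F ^ m = ?F ^ m * ?E" by (metis power_commuting_commutes)
      then have "app ?E (app (?F ^ m) f) = 0"
        by (metis app_times e app_0)
      then show ?thesis using False by (intro ext) (simp add: eta_of_nat[OF f i])
    qed
  qed
  have fam: "poly_family (simple_dir i) (\<lambda>a. eta i (1 * a + t) f)" for t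
    by (rule poly_family_eta_const[OF f i(2)])
  have L: "poly_family (simple_dir i) (\<lambda>a. app ?E (eta i (1 * a + 0) f))"
    using tame_raise fam unfolding tame_def by blast
  have R: "poly_family (simple_dir i) (\<lambda>a al. ?g a * eta i (1 * a + (- 1)) f al)"
    by (rule poly_family_scale[OF _ fam]) (cases "i = k"; auto)
  have "app ?E (eta i (1 * of_nat m + 0) f) = (\<lambda>al. ?g (of_nat m) * eta i (1 * of_nat m + (- 1)) f al)" for m
    using nat by simp
  from poly_family_eqI[OF L R this, of a] show ?thesis by simp
qed

section \<open>The Coxeter presentation of the symmetric group\<close>

abbreviation adj :: "nat \<Rightarrow> nat \<Rightarrow> nat" where
  "adj i \<equiv> transpose i (Suc i)"

text \<open>The subgroup generated by the pairs of an adjacent transposition and the corresponding generator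
  of G. The presentation says that it is the graph of a function.\<close>

inductive word_graph :: "('g, 'b) monoid_scheme \<Rightarrow> (nat \<Rightarrow> 'g) \<Rightarrow> nat \<Rightarrow> (nat \<Rightarrow> nat) \<Rightarrow> 'g \<Rightarrow> bool"
  for G t n where
    Nil: "word_graph G t n id \<one>\<^bsub>G\<^esub>"
  | Snoc: "word_graph G t n p g \<Longrightarrow> 1 \<le> i \<Longrightarrow> i < n \<Longrightarrow>
      word_graph G t n (p \<circ> adj i) (g \<otimes>\<^bsub>G\<^esub> t i)"

text \<open>The cycle s_{k+m-1} ... s_{k+1} s_k, which moves k to k + m. These cycles, for k + m = n + 1,
  represent the right cosets of the symmetric group on n letters in the next one.\<close>

primrec cyc :: "nat \<Rightarrow> nat \<Rightarrow> nat \<Rightarrow> nat" where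
  "cyc k 0 = id"
| "cyc k (Suc m) = adj (k + m) \<circ> cyc k m"

primrec cyc_prod :: "('g, 'b) monoid_scheme \<Rightarrow> (nat \<Rightarrow> 'g) \<Rightarrow> nat \<Rightarrow> nat \<Rightarrow> 'g" where
  "cyc_prod G t k 0 = \<one>\<^bsub>G\<^esub>"
| "cyc_prod G t k (Suc m) = t (k + m) \<otimes>\<^bsub>G\<^esub> cyc_prod G t k m"

lemma cyc_Suc: "cyc k (Suc m) = cyc (Suc k) m \<circ> adj k"
  by (induction m) (simp_all add: comp_assoc del: comp_apply id_apply)

lemma cyc_apply: "cyc k m k = k + m"
  by (induction m) simp_all

lemma adj_commute: "Suc i < k \<Longrightarrow> adj i \<circ> adj k = adj k \<circ> adj i"
  by (auto simp: fun_eq_iff transpose_def)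

lemma adj_braid: "adj i \<circ> adj (Suc i) \<circ> adj i = adj (Suc i) \<circ> adj i \<circ> adj (Suc i)"
  by (auto simp: fun_eq_iff transpose_def)

locale coxeter = group G for G (structure) +
  fixes t :: "nat \<Rightarrow> 'a" and N :: nat
  assumes closed: "1 \<le> i \<Longrightarrow> i < N \<Longrightarrow> t i \<in> carrier G"
    and square: "1 \<le> i \<Longrightarrow> i < N \<Longrightarrow> t i \<otimes> t i = \<one>"
    and far: "1 \<le> i \<Longrightarrow> Suc i < k \<Longrightarrow> k < N \<Longrightarrow> t i \<otimes> t k = t k \<otimes> t i"
    and braid: "1 \<le> i \<Longrightarrow> Suc i < N \<Longrightarrow> t i \<otimes> t (Suc i) \<otimes> t i = t (Suc i) \<otimes> t i \<otimes> t (Suc i)"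
begin

lemma word_graph_closed:
  assumes "word_graph G t n p g" "n \<le> N"
  shows "p permutes {1..n}" "g \<in> carrier G"
  using assms(1)
proof (induction rule: word_graph.induct)
  case (Snoc p g i)
  { case 1
    have "adj i permutes {1..n}" using Snoc.hyps by (intro permutes_swap_id) auto
    then show ?case using Snoc.IH by (intro permutes_compose) }
  { case 2 show ?case using Snoc closed assms(2) by simp }
qed auto

lemma cyc_prod_closed: "1 \<le> k \<Longrightarrow> k + m \<le> N \<Longrightarrow> cyc_prod G t k m \<in> carrier G"
  by (induction m) (simp_all add: closed)

lemma cyc_prod_Suc: "1 \<le> k \<Longrightarrow> k + Suc m \<le> N \<Longrightarrow> cyc_prod G t k (Suc m) = cyc_prod G t (Suc k) m \<otimes> t k"
proof (induction m)
  case (Suc m)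
  then show ?case using closed cyc_prod_closed[of "Suc k" m]
    by (simp add: m_assoc)
qed (use closed in auto)

lemma word_graph_mono:
  assumes "word_graph G t n p g" "n \<le> n'"
  shows "word_graph G t n' p g"
  using assms by (induction rule: word_graph.induct) (auto intro: word_graph.intros)

lemma cyc_far:
  assumes "1 \<le> k" "1 \<le> i" "i < N" "k + m \<le> N" "\<And>j. k \<le> j \<Longrightarrow> j < k + m \<Longrightarrow> Suc i < j \<or> Suc j < i"
  shows "cyc k m \<circ> adj i = adj i \<circ> cyc k m \<and> cyc_prod G t k m \<otimes> t i = t i \<otimes> cyc_prod G t k m"
  using assms(4,5)
proof (induction m)
  case (Suc m)
  let ?j = "k + m"
  have IH: "cyc k m \<circ> adj i = adj i \<circ> cyc k m" "cyc_prod G t k m \<otimes> t i = t i \<otimes> cyc_prod G t k m"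
    using Suc.IH Suc.prems by (simp_all del: comp_apply)
  have j: "Suc i < ?j \<or> Suc ?j < i" using Suc.prems(2)[of ?j] by simp
  then have a: "adj ?j \<circ> adj i = adj i \<circ> adj ?j"
    using adj_commute[of i ?j] adj_commute[of ?j i] by auto
  have b: "t ?j \<otimes> t i = t i \<otimes> t ?j"
  proof (rule disjE[OF j])
    assume "Suc i < ?j"
    then show ?thesis using far[of i ?j] assms Suc.prems(1) by simp
  next
    assume "Suc ?j < i"
    then show ?thesis using far[of ?j i] assms by simp
  qed
  have c: "t i \<in> carrier G" "t ?j \<in> carrier G" "cyc_prod G t k m \<in> carrier G"
    using assms Suc.prems by (auto intro: closed cyc_prod_closed)
  have "cyc k (Suc m) \<circ> adj i = adj ?j \<circ> adj i \<circ> cyc k m" using IH(1) by (simp add: comp_assoc del: comp_apply)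
  also have "\<dots> = adj i \<circ> cyc k (Suc m)" unfolding a by (simp add: comp_assoc del: comp_apply)
  finally have 1: "cyc k (Suc m) \<circ> adj i = adj i \<circ> cyc k (Suc m)" .
  have "cyc_prod G t k (Suc m) \<otimes> t i = t ?j \<otimes> t i \<otimes> cyc_prod G t k m" using IH(2) c by (simp add: m_assoc)
  also have "\<dots> = t i \<otimes> cyc_prod G t k (Suc m)" unfolding b using c by (simp add: m_assoc)
  finally show ?case using 1 by blast
qed (use assms closed in auto)

text \<open>A generator s_{i+1} inside the range of a cycle leaves it on the other side as s_i: it passes the
  letters below s_i, the braid relation turns s_{i+1} s_i s_{i+1} into s_i s_{i+1} s_i, and s_i then
  passes the letters above s_{i+1}.\<close>

lemma cyc_near:
  assumes "1 \<le> k" "k \<le> i" "Suc i < k + m" "k + m \<le> N"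
  shows "cyc k m \<circ> adj (Suc i) = adj i \<circ> cyc k m \<and> cyc_prod G t k m \<otimes> t (Suc i) = t i \<otimes> cyc_prod G t k m"
  using assms(3,4)
proof (induction m)
  case (Suc m)
  let ?j = "k + m"
  have c: "t i \<in> carrier G" "t (Suc i) \<in> carrier G" "t ?j \<in> carrier G" "cyc_prod G t k m \<in> carrier G"
    using assms Suc.prems by (auto intro: closed cyc_prod_closed)
  show ?case
  proof (cases "Suc i < ?j")
    case True
    then have IH: "cyc k m \<circ> adj (Suc i) = adj i \<circ> cyc k m" "cyc_prod G t k m \<otimes> t (Suc i)
        = t i \<otimes> cyc_prod G t k m"
      using Suc.IH Suc.prems by (simp_all del: comp_apply)
    have "cyc k (Suc m) \<circ> adj (Suc i) = adj ?j \<circ> adj i \<circ> cyc k m" using IH(1)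
        by (simp add: comp_assoc del: comp_apply)
    also have "adj ?j \<circ> adj i = adj i \<circ> adj ?j" using adj_commute[of i ?j] True by simp
    finally have 1: "cyc k (Suc m) \<circ> adj (Suc i)
        = adj i \<circ> cyc k (Suc m)" by (simp add: comp_assoc del: comp_apply)
    have "cyc_prod G t k (Suc m) \<otimes> t (Suc i) = t ?j \<otimes> t i \<otimes> cyc_prod G t k m" using IH(2) c
        by (simp add: m_assoc)
    also have "t ?j \<otimes> t i = t i \<otimes> t ?j" using far[of i ?j] True assms Suc.prems by simp
    finally have "cyc_prod G t k (Suc m) \<otimes> t (Suc i) = t i \<otimes> cyc_prod G t k (Suc m)"
      using c by (simp add: m_assoc)
    with 1 show ?thesis by blast
  next
    case False
    then have j: "?j = Suc i" using Suc.prems by simp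
    then obtain l where l: "m = Suc l" using assms by (cases m) auto
    have kl: "k + l = i" using j l by simp
    have F: "cyc k l \<circ> adj (Suc i) = adj (Suc i) \<circ> cyc k l"
      "cyc_prod G t k l \<otimes> t (Suc i) = t (Suc i) \<otimes> cyc_prod G t k l"
      using cyc_far[of k "Suc i" l] assms Suc.prems kl by auto
    have cl: "cyc_prod G t k l \<in> carrier G"
      using assms Suc.prems kl by (intro cyc_prod_closed) auto
    have "cyc k (Suc m) \<circ> adj (Suc i) = adj (Suc i) \<circ> adj i \<circ> (cyc k l \<circ> adj (Suc i))"
      using j kl l by (simp add: comp_assoc del: comp_apply)
    also have "\<dots> = (adj (Suc i) \<circ> adj i \<circ> adj (Suc i)) \<circ> cyc k l" unfolding F by (simp only: comp_assoc)
    also have "\<dots> = (adj i \<circ> adj (Suc i) \<circ> adj i) \<circ> cyc k l" by (simp only: adj_braid)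
    also have "\<dots> = adj i \<circ> cyc k (Suc m)" using j kl l by (simp add: comp_assoc del: comp_apply)
    finally have 1: "cyc k (Suc m) \<circ> adj (Suc i) = adj i \<circ> cyc k (Suc m)" .
    have "cyc_prod G t k (Suc m) \<otimes> t (Suc i) = t (Suc i) \<otimes> t i \<otimes> (cyc_prod G t k l \<otimes> t (Suc i))"
      using j kl l c cl by (simp add: m_assoc)
    also have "\<dots> = (t (Suc i) \<otimes> t i \<otimes> t (Suc i)) \<otimes> cyc_prod G t k l"
      unfolding F using c cl by (simp add: m_assoc)
    also have "\<dots> = (t i \<otimes> t (Suc i) \<otimes> t i) \<otimes> cyc_prod G t k l"
      using braid[of i] assms Suc.prems by simp
    also have "\<dots> = t i \<otimes> cyc_prod G t k (Suc m)" using j kl l c cl by (simp add: m_assoc)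
    finally show ?thesis using 1 by blast
  qed
qed (use assms in auto)

lemma word_graph_cyc:
  assumes "word_graph G t n p g" "1 \<le> k" "k + m \<le> n" "n \<le> N"
  shows "word_graph G t n (p \<circ> cyc k m) (g \<otimes> cyc_prod G t k m)"
  using assms
proof (induction m arbitrary: k)
  case 0
  then show ?case using word_graph_closed by simp
next
  case (Suc m)
  have "word_graph G t n (p \<circ> cyc (Suc k) m) (g \<otimes> cyc_prod G t (Suc k) m)"
    using Suc.IH[of "Suc k"] Suc.prems by (simp del: comp_apply)
  then have "word_graph G t n (p \<circ> cyc (Suc k) m \<circ> adj k) (g \<otimes> cyc_prod G t (Suc k) m \<otimes> t k)"
    using Suc.prems by (intro word_graph.Snoc) auto
  moreover have "g \<otimes> cyc_prod G t (Suc k) m \<otimes> t k = g \<otimes> cyc_prod G t k (Suc m)"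
    using Suc.prems word_graph_closed(2)[OF Suc.prems(1,4)] cyc_prod_Suc[of k m] closed[of k]
      cyc_prod_closed[of "Suc k" m] by (simp add: m_assoc del: cyc_prod.simps)
  ultimately show ?case by (simp only: cyc_Suc comp_assoc)
qed

lemma cyc_permutes:
  assumes "1 \<le> k" "k + m \<le> n"
  shows "cyc k m permutes {1..n}"
  using assms(2)
proof (induction m)
  case (Suc m)
  have "adj (k + m) permutes {1..n}" using Suc.prems assms by (intro permutes_swap_id) auto
  then show ?case using Suc by (simp del: comp_apply add: permutes_compose)
qed (simp add: permutes_id)

lemma word_graph_total:
  assumes "n \<le> N" "p permutes {1..n}"
  shows "\<exists>g. word_graph G t n p g"
  using assms
proof (induction n arbitrary: p)
  case 0
  then have "p = id" by simp
  then show ?case using word_graph.Nil by blast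
next
  case (Suc n)
  define k where "k = Hilbert_Choice.inv p (Suc n)"
  have "p k = Suc n" using Suc.prems(2) by (simp add: k_def permutes_inverses)
  moreover have k: "k \<in> {1..Suc n}"
    using Suc.prems(2) by (metis atLeastAtMost_iff calculation le_SucI le_refl not_less_eq_eq
        permutes_not_in zero_less_Suc One_nat_def Suc_leI)
  let ?c = "cyc k (Suc n - k)"
  have c: "?c permutes {1..Suc n}" using k by (intro cyc_permutes) auto
  let ?q = "p \<circ> Hilbert_Choice.inv ?c"
  have q: "?q permutes {1..Suc n}" using c Suc.prems(2) by (intro permutes_compose permutes_inv)
  have "?c k = Suc n" using k by (simp add: cyc_apply)
  then have "?q (Suc n) = Suc n" using c \<open>p k = Suc n\<close> by (metis comp_apply permutes_inverses(2))
  then have "?q permutes {1..n}"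
    by (intro permutes_superset[OF q]) (auto simp: le_Suc_eq)
  then obtain g where "word_graph G t n ?q g" using Suc by auto
  then have "word_graph G t (Suc n) ?q g" by (rule word_graph_mono) simp
  then have "word_graph G t (Suc n) (?q \<circ> ?c) (g \<otimes> cyc_prod G t k (Suc n - k))"
    using Suc.prems k by (intro word_graph_cyc) auto
  moreover have "?q \<circ> ?c = p" using c by (simp add: comp_assoc permutes_inv_o)
  ultimately show ?case by auto
qed

text \<open>The elements of the stated form contain the neutral one and are stable under right multiplication
  by a generator s_i. According to the position of i, the cycle from k absorbs s_i (i = k), becomes
  longer (i = k - 1), or lets it pass to the left unchanged (i < k - 1) or as s_{i-1} (i > k).\<close>

lemma word_graph_normal_form:
  assumes "word_graph G t (Suc n) p g" "Suc n \<le> N"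
  shows "\<exists>q h k. word_graph G t n q h \<and> k \<in> {1..Suc n} \<and>
     p = q \<circ> cyc k (Suc n - k) \<and> g = h \<otimes> cyc_prod G t k (Suc n - k)"
  using assms(1)
proof (induction rule: word_graph.induct)
  case Nil
  show ?case
    by (rule exI[of _ id], rule exI[of _ \<one>], rule exI[of _ "Suc n"], intro conjI word_graph.Nil) auto
next
  case (Snoc p g i)
  then obtain q h k where IH: "word_graph G t n q h" "k \<in> {1..Suc n}"
     "p = q \<circ> cyc k (Suc n - k)" "g = h \<otimes> cyc_prod G t k (Suc n - k)" by blast
  have h: "h \<in> carrier G" using word_graph_closed(2)[OF IH(1)] assms by simp
  have ti: "t i \<in> carrier G" using Snoc assms by (intro closed) auto
  let ?C = "\<lambda>k. cyc k (Suc n - k)" and ?D = "\<lambda>k. cyc_prod G t k (Suc n - k)"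
  have D: "?D k \<in> carrier G" if "k \<in> {1..Suc n}" for k
    using that assms by (intro cyc_prod_closed) auto
  have absorb: "?C k = ?C (Suc k) \<circ> adj k" "?D k = ?D (Suc k) \<otimes> t k" if "k \<in> {1..n}" for k
  proof -
    have s: "Suc n - k = Suc (Suc n - Suc k)" using that by auto
    show "?C k = ?C (Suc k) \<circ> adj k" unfolding s by (rule cyc_Suc)
    show "?D k = ?D (Suc k) \<otimes> t k" unfolding s by (rule cyc_prod_Suc) (use that assms in auto)
  qed
  consider "i = k" | "Suc i = k" | "Suc i < k" | "k < i" by linarith
  then show ?case
  proof cases
    case 1
    have k: "k \<in> {1..n}" using 1 Snoc IH by auto
    have "?C k \<circ> adj k = ?C (Suc k)" unfolding absorb(1)[OF k] by (simp add: comp_assoc del: comp_apply)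
    moreover have "?D k \<otimes> t k = ?D (Suc k)" unfolding absorb(2)[OF k]
      using D[of "Suc k"] ti square[of k] k 1 assms by (simp add: m_assoc)
    ultimately have "p \<circ> adj i = q \<circ> ?C (Suc k)" "g \<otimes> t i = h \<otimes> ?D (Suc k)"
      using 1 IH h D ti by (simp_all add: comp_assoc m_assoc del: comp_apply)
    then show ?thesis using IH(1) k by (intro exI[of _ q] exI[of _ h] exI[of _ "Suc k"]) auto
  next
    case 2
    have i: "i \<in> {1..n}" using 2 Snoc IH by auto
    have "p \<circ> adj i = q \<circ> ?C i" "g \<otimes> t i = h \<otimes> ?D i"
      unfolding IH absorb[OF i] using 2 IH(2) h D[of k] ti by (simp_all add: comp_assoc m_assoc del: comp_apply)
    then show ?thesis using IH(1) i by (intro exI[of _ q] exI[of _ h] exI[of _ i]) auto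
  next
    case 3
    have "?C k \<circ> adj i = adj i \<circ> ?C k \<and> ?D k \<otimes> t i = t i \<otimes> ?D k"
      using 3 Snoc IH assms by (intro cyc_far) auto
    then have "p \<circ> adj i = (q \<circ> adj i) \<circ> ?C k" "g \<otimes> t i = (h \<otimes> t i) \<otimes> ?D k"
      using IH h D ti by (simp_all add: comp_assoc m_assoc del: comp_apply)
    moreover have "word_graph G t n (q \<circ> adj i) (h \<otimes> t i)"
      using IH Snoc 3 by (intro word_graph.Snoc) auto
    ultimately show ?thesis using IH(2) by blast
  next
    case 4
    then obtain l where l: "i = Suc l" by (cases i) auto
    have "?C k \<circ> adj (Suc l) = adj l \<circ> ?C k \<and> ?D k \<otimes> t (Suc l) = t l \<otimes> ?D k"
      using 4 Snoc IH assms l by (intro cyc_near) auto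
    moreover have "t l \<in> carrier G" using 4 l IH Snoc assms by (intro closed) auto
    ultimately have "p \<circ> adj i = (q \<circ> adj l) \<circ> ?C k" "g \<otimes> t i = (h \<otimes> t l) \<otimes> ?D k"
      using IH h D ti l by (simp_all add: comp_assoc m_assoc del: comp_apply)
    moreover have "word_graph G t n (q \<circ> adj l) (h \<otimes> t l)"
      using IH Snoc 4 l by (intro word_graph.Snoc) auto
    ultimately show ?thesis using IH(2) by blast
  qed
qed

text \<open>In the normal form k is determined by p, as the preimage of n + 1, and so is the remaining
  permutation of n letters, to which the induction hypothesis applies.\<close>

lemma word_graph_functional:
  assumes "word_graph G t n p g" "word_graph G t n p g'" "n \<le> N"
  shows "g = g'"
  using assms
proof (induction n arbitrary: p g g')
  case 0
  have "h = \<one>" if "word_graph G t 0 q h" for q h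
    using that by (cases rule: word_graph.cases) auto
  then show ?case using 0 by blast
next
  case (Suc n)
  obtain q h k where 1: "word_graph G t n q h" "k \<in> {1..Suc n}"
     "p = q \<circ> cyc k (Suc n - k)" "g = h \<otimes> cyc_prod G t k (Suc n - k)"
    using word_graph_normal_form[OF Suc.prems(1,3)] by blast
  obtain q' h' k' where 2: "word_graph G t n q' h'" "k' \<in> {1..Suc n}"
     "p = q' \<circ> cyc k' (Suc n - k')" "g' = h' \<otimes> cyc_prod G t k' (Suc n - k')"
    using word_graph_normal_form[OF Suc.prems(2,3)] by blast
  have q: "q permutes {1..n}" "q' permutes {1..n}"
    using 1 2 Suc.prems word_graph_closed by auto
  have "p k = Suc n" using 1 permutes_not_in[OF q(1)] by (simp add: cyc_apply)
  moreover have "p k' = Suc n" using 2 permutes_not_in[OF q(2)] by (simp add: cyc_apply)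
  moreover have "inj p" using word_graph_closed(1)[OF Suc.prems(1,3)] by (rule permutes_inj)
  ultimately have k: "k = k'" by (metis injD)
  have c: "cyc k (Suc n - k) permutes {1..Suc n}" using 1 by (intro cyc_permutes) auto
  have "p = q' \<circ> cyc k (Suc n - k)" using 2(3) k by simp
  then have "p \<circ> Hilbert_Choice.inv (cyc k (Suc n - k)) = q'"
    by (simp only: comp_assoc permutes_inv_o(1)[OF c] comp_id)
  moreover have "p \<circ> Hilbert_Choice.inv (cyc k (Suc n - k)) = q"
    by (simp only: 1(3) comp_assoc permutes_inv_o(1)[OF c] comp_id)
  ultimately have "q = q'" by simp
  then have "h = h'" using Suc.IH 1 2 Suc.prems by auto
  then show ?case using 1 2 k by simp
qed

lemma word_graph_mult:
  assumes "word_graph G t N p g" "word_graph G t N q h"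
  shows "word_graph G t N (p \<circ> q) (g \<otimes> h)"
  using assms(2)
proof (induction rule: word_graph.induct)
  case Nil
  then show ?case using assms word_graph_closed by simp
next
  case (Snoc q h i)
  then have "word_graph G t N (p \<circ> q \<circ> adj i) (g \<otimes> h \<otimes> t i)"
    by (intro word_graph.Snoc)
  moreover have "g \<in> carrier G" "h \<in> carrier G" "t i \<in> carrier G"
    using assms Snoc word_graph_closed closed by auto
  ultimately show ?case by (simp add: m_assoc comp_assoc del: comp_apply)
qed

text \<open>The third property allows induction over words when reasoning about the homomorphism.\<close>

theorem sym_group_presentation:
  obtains \<phi> where "\<phi> \<in> hom (sym_group N) G"
    "\<And>i. 1 \<le> i \<Longrightarrow> i < N \<Longrightarrow> \<phi> (adj i) = t i"
    "\<And>p. p permutes {1..N} \<Longrightarrow> word_graph G t N p (\<phi> p)"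
proof -
  define \<phi> where "\<phi> p = (THE g. word_graph G t N p g)" for p
  have eq: "\<phi> p = g" if "word_graph G t N p g" for p g
    unfolding \<phi>_def using that word_graph_functional by blast
  have in_graph: "word_graph G t N p (\<phi> p)" if "p permutes {1..N}" for p
    using word_graph_total[OF order_refl that] eq by auto
  have "\<phi> \<in> hom (sym_group N) G"
    using in_graph word_graph_closed(2)[OF in_graph] eq[OF word_graph_mult]
    by (auto simp: hom_def sym_group_def)
  moreover have "\<phi> (adj i) = t i" if "1 \<le> i" "i < N" for i
  proof (rule eq)
    have "word_graph G t N (id \<circ> adj i) (\<one> \<otimes> t i)"
      by (intro word_graph.intros that)
    then show "word_graph G t N (adj i) (t i)" using closed that by simp
  qed
  ultimately show thesis using in_graph that by blast
qed

end

section \<open>Weights\<close>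

text \<open>The weight of a monomial, shifted by half the sum of the positive roots and written in coordinates
  of the diagonal matrices (normalised by the last sum): entry k minus entry k + 1 is the eigenvalue
  of zeta_k plus one (zeta_at). In these coordinates sigma_i is a transposition of entries.\<close>

definition wt :: "nat \<Rightarrow> (nat \<Rightarrow> complex) \<Rightarrow> expo \<Rightarrow> nat \<Rightarrow> complex" where
  "wt n lam al k = (if 1 \<le> k \<and> k \<le> n
     then (\<Sum>p=1..<k. al (k, p)) - (\<Sum>j=Suc k..n. al (j, k)) - (\<Sum>m=1..<k. lam m + 1) else 0)"

definition simple_root :: "nat \<Rightarrow> nat \<Rightarrow> complex" where
  "simple_root i k = (if k = i then 1 else 0) - (if k = Suc i then 1 else 0)"

lemma wt_diff:
  assumes "1 \<le> i" "i < n"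
  shows "wt n lam al i - wt n lam al (Suc i) - 1 = lam i + (\<Sum>p=1..<i. al (i, p) - al (Suc i, p))
     + (\<Sum>j=Suc (Suc i)..n. al (j, Suc i) - al (j, i)) - 2 * al (Suc i, i)"
proof -
  have 1: "(\<Sum>p=1..<Suc i. al (Suc i, p)) = (\<Sum>p=1..<i. al (Suc i, p)) + al (Suc i, i)"
    using assms by simp
  have 2: "(\<Sum>j=Suc i..n. al (j, i)) = al (Suc i, i) + (\<Sum>j=Suc (Suc i)..n. al (j, i))"
    using assms by (subst sum.atLeast_Suc_atMost) auto
  have 3: "(\<Sum>m=1..<Suc i. lam m + 1) = (\<Sum>m=1..<i. lam m + 1) + (lam i + 1)"
    using assms by simp
  show ?thesis
    using assms unfolding wt_def 1 2 3 by (simp add: sum_subtractf)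
qed

lemma zeta_at:
  assumes "1 \<le> i" "i < n"
  shows "zeta n lam i f al = (wt n lam al i - wt n lam al (Suc i) - 1) * f al"
proof -
  have e: "xmul j k (pd j k f) al = al (j, k) * f al" for j k
    by (simp add: xpow_def pd_def)
  show ?thesis
    unfolding zeta_def e wt_diff[OF assms] left_diff_distrib[symmetric] sum_distrib_right[symmetric]
    by (simp add: algebra_simps)
qed

lemma wt_upd:
  assumes "1 \<le> c" "c < r" "r \<le> n"
  shows "wt n lam (al((r, c) := al (r, c) + s)) k =
    wt n lam al k + s * ((if k = r then 1 else 0) - (if k = c then 1 else 0))"
proof (cases "1 \<le> k \<and> k \<le> n")
  case True
  let ?be = "al((r, c) := al (r, c) + s)"
  have "(\<Sum>p=1..<k. ?be (k, p)) = (\<Sum>p=1..<k. al (k, p) + (if p = c then if k = r then s else 0 else 0))"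
    by (intro sum.cong) auto
  also have "\<dots> = (\<Sum>p=1..<k. al (k, p)) + (if k = r then s else 0)"
    unfolding sum.distrib using assms by auto
  finally have 1: "(\<Sum>p=1..<k. ?be (k, p)) = (\<Sum>p=1..<k. al (k, p)) + (if k = r then s else 0)" .
  have "(\<Sum>j=Suc k..n. ?be (j, k)) = (\<Sum>j=Suc k..n. al (j, k) + (if j = r then if k = c then s else 0 else 0))"
    by (intro sum.cong) auto
  also have "\<dots> = (\<Sum>j=Suc k..n. al (j, k)) + (if k = c then s else 0)"
    unfolding sum.distrib using assms by auto
  finally have 2: "(\<Sum>j=Suc k..n. ?be (j, k)) = (\<Sum>j=Suc k..n. al (j, k)) + (if k = c then s else 0)" .
  show ?thesis using True unfolding wt_def 1 2 by (auto simp: algebra_simps)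
qed (use assms in \<open>auto simp: wt_def\<close>)

lemma wt_step:
  assumes "j \<in> {1..<i}" "i < n"
  shows "wt n lam (step i j al) k = wt n lam al k + simple_root i k"
proof -
  define ga where "ga = al((Suc i, j) := al (Suc i, j) + - 1)"
  have st: "step i j al = ga((i, j) := ga (i, j) + 1)"
    by (simp add: step_def ga_def)
  have "wt n lam (step i j al) k = wt n lam ga k + 1 * ((if k = i then 1 else 0) - (if k = j then 1 else 0))"
    unfolding st by (rule wt_upd) (use assms in auto)
  also have "wt n lam ga k = wt n lam al k + - 1 * ((if k = Suc i then 1 else 0) - (if k = j then 1 else 0))"
    unfolding ga_def by (rule wt_upd) (use assms in auto)
  finally show ?thesis by (simp add: simple_root_def)
qed

lemma sum_wt: "(\<Sum>k=1..n. wt n lam al k) = - (\<Sum>k=1..n. \<Sum>m=1..<k. lam m + 1)"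
proof -
  have "(\<Sum>k=1..n. \<Sum>p=1..<k. al (k, p)) = (\<Sum>(k, p)\<in>(SIGMA k:{1..n}. {1..<k}). al (k, p))"
    by (simp add: sum.Sigma)
  also have "\<dots> = (\<Sum>(p, k)\<in>(SIGMA p:{1..n}. {Suc p..n}). al (k, p))"
    by (rule sum.reindex_bij_witness[of _ "\<lambda>(a, b). (b, a)" "\<lambda>(a, b). (b, a)"]) auto
  also have "\<dots> = (\<Sum>p=1..n. \<Sum>k=Suc p..n. al (k, p))"
    by (simp add: sum.Sigma)
  finally have "(\<Sum>k=1..n. \<Sum>p=1..<k. al (k, p)) = (\<Sum>k=1..n. \<Sum>j=Suc k..n. al (j, k))" .
  then show ?thesis by (simp add: wt_def sum_subtractf)
qed

text \<open>The sum of all entries of the weight is the same for all monomials, because each variable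
  contributes to one row and to one column.\<close>

lemma wt_eqI:
  assumes "\<And>i. 1 \<le> i \<Longrightarrow> i < n \<Longrightarrow> wt n lam al i - wt n lam al (Suc i) = wt n lam be i - wt n lam be (Suc i)"
  shows "wt n lam al = wt n lam be"
proof
  fix k
  (* the difference of the weights is a constant vector with entries of sum 0 *)
  define d where "d k = wt n lam al k - wt n lam be k" for k
  have d1: "d k = d 1" if "1 \<le> k" "k \<le> n" for k
    using that
  proof (induction k rule: dec_induct)
    case (step k)
    have "wt n lam al k - wt n lam al (Suc k) = wt n lam be k - wt n lam be (Suc k)"
      by (rule assms) (use step in auto)
    then have "d (Suc k) = d k" unfolding d_def by (simp add: algebra_simps)
    with step show ?case by simp
  qed simp
  have "(\<Sum>k=1..n. d k) = 0"
    unfolding d_def sum_subtractf sum_wt by simp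
  moreover have "(\<Sum>k=1..n. d k) = (\<Sum>k=1..n. d 1)" by (intro sum.cong refl d1) auto
  ultimately have "n = 0 \<or> d 1 = 0" by simp
  then have "d k = 0" if "1 \<le> k \<and> k \<le> n" using d1[of k] that by auto
  then show "wt n lam al k = wt n lam be k"
    by (cases "1 \<le> k \<and> k \<le> n") (simp add: d_def, simp only: wt_def if_False)
qed

text \<open>Homogeneity with respect to wt is equivalent to being weighted (weighted_iff_homog), and it keeps
  track of the full weight vector.\<close>

definition homog :: "nat \<Rightarrow> (nat \<Rightarrow> complex) \<Rightarrow> (nat \<Rightarrow> complex) \<Rightarrow> fseries \<Rightarrow> bool" where
  "homog n lam nu f \<longleftrightarrow> (\<forall>al. f al \<noteq> 0 \<longrightarrow> wt n lam al = nu)"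

lemma has_weight_iff:
  "has_weight n lam mu f \<longleftrightarrow>
     (\<forall>al. f al \<noteq> 0 \<longrightarrow> (\<forall>i. 1 \<le> i \<and> i < n \<longrightarrow> wt n lam al i - wt n lam al (Suc i) - 1 = mu i))"
proof -
  have "has_weight n lam mu f \<longleftrightarrow> (\<forall>i. 1 \<le> i \<and> i < n \<longrightarrow> (\<forall>al. zeta n lam i f al = mu i * f al))"
    by (auto simp: has_weight_def fun_eq_iff)
  also have "\<dots> \<longleftrightarrow> (\<forall>i. 1 \<le> i \<and> i < n \<longrightarrow> (\<forall>al. (wt n lam al i - wt n lam al (Suc i) - 1) * f al = mu i * f al))"
    by (simp add: zeta_at)
  finally show ?thesis by auto
qed

lemma homog_has_weight: "homog n lam nu f \<Longrightarrow> has_weight n lam (\<lambda>i. nu i - nu (Suc i) - 1) f"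
  by (auto simp: homog_def has_weight_iff)

lemma weighted_iff_homog: "weighted n lam f \<longleftrightarrow> (\<exists>nu. homog n lam nu f)"
proof
  assume "weighted n lam f"
  then obtain mu where mu: "has_weight n lam mu f" by (auto simp: weighted_def)
  show "\<exists>nu. homog n lam nu f"
  proof (cases "\<exists>be. f be \<noteq> 0")
    case True
    then obtain be where be: "f be \<noteq> 0" ..
    have "wt n lam al = wt n lam be" if "f al \<noteq> 0" for al
    proof (rule wt_eqI)
      fix i assume "1 \<le> i" "i < n"
      then have "wt n lam al i - wt n lam al (Suc i) - 1 = mu i" "wt n lam be i - wt n lam be (Suc i) - 1
          = mu i"
        using mu be that unfolding has_weight_iff by blast+
      then show "wt n lam al i - wt n lam al (Suc i) = wt n lam be i - wt n lam be (Suc i)"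
        by (metis diff_add_cancel)
    qed
    then show ?thesis by (auto simp: homog_def)
  qed (auto simp: homog_def)
qed (auto simp: weighted_def dest: homog_has_weight)

section \<open>The support of a complex power\<close>

lemma shift_power_support:
  assumes "app (shift i ^ p) f al \<noteq> 0" "i < n"
  shows "\<exists>be. f be \<noteq> 0 \<and> (\<forall>k. wt n lam be k = wt n lam al k + of_nat p * simple_root i k) \<and>
    be (Suc i, i) = al (Suc i, i) \<and> (\<forall>k. k \<noteq> i \<longrightarrow> be (Suc k, k) - al (Suc k, k) \<in> \<nat>)"
  using assms(1)
proof (induction p arbitrary: al)
  case 0
  then show ?case by (intro exI[of _ al]) (auto simp: app_simps)
next
  case (Suc p)
  then have nz: "app (shift i) (app (shift i ^ p) f) al \<noteq> 0" by (simp add: app_times)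
  obtain j where "j \<in> {1..<i}" "(al (i, j) + 1) * app (shift i ^ p) f (step i j al) \<noteq> 0"
    using nz unfolding shift_at by (rule sum.not_neutral_contains_not_neutral)
  then have j: "j \<in> {1..<i}" "app (shift i ^ p) f (step i j al) \<noteq> 0" by auto
  obtain be where be: "f be \<noteq> 0" "\<And>k. wt n lam be k = wt n lam (step i j al) k + of_nat p * simple_root i k"
    "be (Suc i, i) = step i j al (Suc i, i)" "\<And>k. k \<noteq> i \<Longrightarrow> be (Suc k, k) - step i j al (Suc k, k) \<in> \<nat>"
    using Suc.IH[OF j(2)] by blast
  have "be (Suc k, k) - al (Suc k, k) \<in> \<nat>" if k: "k \<noteq> i" for k
  proof -
    have "step i j al (Suc k, k) - al (Suc k, k) \<in> \<nat>" using j k by (auto simp: step_def)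
    from Nats_add[OF be(4)[OF k] this] show ?thesis by simp
  qed
  moreover have "be (Suc i, i) = al (Suc i, i)" using be(3) j by (simp add: step_def)
  moreover have "wt n lam be k = wt n lam al k + of_nat (Suc p) * simple_root i k" for k
    using be(2)[of k] wt_step[OF j(1) assms(2), of lam al k] by (simp add: algebra_simps)
  ultimately show ?case using be(1) by blast
qed

text \<open>Where the monomials of eta_i^a(f) come from. In the term of index p the exponent of x_{i+1,i} is
  raised by a - p, and the other exponents of the x_{k+1,k} can only decrease, by natural numbers.\<close>

lemma eta_support:
  assumes "eta i a f al \<noteq> 0" "f \<in> adm n" "1 \<le> i" "i < n"
  obtains be p where "f be \<noteq> 0" "\<And>k. wt n lam be k = wt n lam al k + a * simple_root i k"
    "be (Suc i, i) = al (Suc i, i) - (a - of_nat p)" "\<And>k. k \<noteq> i \<Longrightarrow> be (Suc k, k) - al (Suc k, k) \<in> \<nat>"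
proof -
  let ?al = "\<lambda>p. al((Suc i, i) := al (Suc i, i) - (a - of_nat p))"
  obtain p where "(a gchoose p) * app (shift i ^ p) f (?al p) \<noteq> 0"
    using assms(1) unfolding eta_finite[OF assms(2,4) order_refl]
    by (rule sum.not_neutral_contains_not_neutral)
  then have "app (shift i ^ p) f (?al p) \<noteq> 0" by auto
  from shift_power_support[OF this assms(4), of lam] obtain be where be: "f be \<noteq> 0"
    "\<And>k. wt n lam be k = wt n lam (?al p) k + of_nat p * simple_root i k"
    "be (Suc i, i) = ?al p (Suc i, i)" "\<And>k. k \<noteq> i \<Longrightarrow> be (Suc k, k) - ?al p (Suc k, k) \<in> \<nat>"
    by blast
  have "wt n lam (?al p) k = wt n lam al k + (a - of_nat p) * simple_root i k" for k
    using wt_upd[of i "Suc i" n lam al "- (a - of_nat p)" k] assms(3,4)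
    by (auto simp: simple_root_def algebra_simps)
  then have "wt n lam be k = wt n lam al k + a * simple_root i k" for k
    using be(2)[of k] by (simp add: algebra_simps)
  then show thesis using that[of be p] be by auto
qed

section \<open>The simple reflections\<close>

text \<open>The operator sigma_i on all series. The exponent is read off from the weight of the target monomial
  instead of that of the source; on a series of weight mu both give mu_i + 1 (reflect_has_weight).\<close>

definition reflect :: "nat \<Rightarrow> (nat \<Rightarrow> complex) \<Rightarrow> nat \<Rightarrow> fseries \<Rightarrow> fseries" where
  "reflect n lam i f = (\<lambda>al. eta i (wt n lam al (Suc i) - wt n lam al i) f al)"

lemma reflect_support:
  assumes "reflect n lam i f al \<noteq> 0" "f \<in> adm n" "1 \<le> i" "i < n"
  obtains be p where "f be \<noteq> 0" "wt n lam be = wt n lam al \<circ> adj i"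
    "be (Suc i, i) = al (Suc i, i) - (wt n lam be i - wt n lam be (Suc i) - of_nat p)"
    "\<And>k. k \<noteq> i \<Longrightarrow> be (Suc k, k) - al (Suc k, k) \<in> \<nat>"
proof -
  let ?a = "wt n lam al (Suc i) - wt n lam al i"
  have "eta i ?a f al \<noteq> 0" using assms(1) by (simp add: reflect_def)
  from eta_support[OF this assms(2-4), of lam] obtain be p where be: "f be \<noteq> 0"
    "\<And>k. wt n lam be k = wt n lam al k + ?a * simple_root i k"
    "be (Suc i, i) = al (Suc i, i) - (?a - of_nat p)" "\<And>k. k \<noteq> i \<Longrightarrow> be (Suc k, k) - al (Suc k, k) \<in> \<nat>"
    by blast
  have w: "wt n lam be = wt n lam al \<circ> adj i"
    by (rule ext) (auto simp: be(2) simple_root_def transpose_def)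
  then have "?a = wt n lam be i - wt n lam be (Suc i)" by simp
  then show thesis using that[of be p] be(1,3,4) w by metis
qed

lemma reflect_adm: "f \<in> adm n \<Longrightarrow> 1 \<le> i \<Longrightarrow> i < n \<Longrightarrow> reflect n lam i f \<in> adm n"
  using eta_adm unfolding reflect_def adm_def by blast

lemma reflect_add: "f \<in> adm n \<Longrightarrow> g \<in> adm n \<Longrightarrow> i < n \<Longrightarrow>
    reflect n lam i (f + g) = reflect n lam i f + reflect n lam i g"
  by (rule ext) (simp add: reflect_def eta_add)

lemma reflect_scale: "f \<in> adm n \<Longrightarrow> i < n \<Longrightarrow>
    reflect n lam i (\<lambda>al. c * f al) = (\<lambda>al. c * reflect n lam i f al)"
  by (rule ext) (simp add: reflect_def eta_scale)

text \<open>If the exponents attached to source and target of a monomial differ, both sides vanish there: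
  f_i^a lowers the eigenvalue of zeta_i by 2 a, so a coefficient can be nonzero only if they agree.\<close>

lemma reflect_has_weight:
  assumes f: "f \<in> adm n" and i: "1 \<le> i" "i < n" and mu: "has_weight n lam mu f"
  shows "reflect n lam i f = eta i (mu i + 1) f"
proof
  fix al
  let ?a = "wt n lam al (Suc i) - wt n lam al i"
  have "reflect n lam i f al = 0 \<and> eta i (mu i + 1) f al = 0" if ne: "?a \<noteq> mu i + 1"
  proof (intro conjI; rule ccontr)
    assume "reflect n lam i f al \<noteq> 0"
    then obtain be where be: "f be \<noteq> 0" "wt n lam be = wt n lam al \<circ> adj i"
      using f i by (rule reflect_support)
    have "wt n lam be i - wt n lam be (Suc i) - 1 = mu i"
      using mu i be(1) by (auto simp: has_weight_iff)
    then have "?a - 1 = mu i" by (simp add: be(2))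
    then show False using ne by (metis diff_add_cancel)
  next
    assume "eta i (mu i + 1) f al \<noteq> 0"
    then obtain be where be: "f be \<noteq> 0" "\<And>k. wt n lam be k = wt n lam al k + (mu i + 1) * simple_root i k"
      using f i by (rule eta_support[where lam = lam]) blast
    have "wt n lam be i - wt n lam be (Suc i) - 1 = mu i"
      using mu i be(1) by (auto simp: has_weight_iff)
    then show False using ne by (simp add: be(2) simple_root_def algebra_simps)
  qed
  then show "reflect n lam i f al = eta i (mu i + 1) f al"
    by (cases "?a = mu i + 1") (simp_all add: reflect_def)
qed

lemma reflect_homog:
  assumes f: "f \<in> adm n" and i: "1 \<le> i" "i < n" and nu: "homog n lam nu f"
  shows "reflect n lam i f = eta i (nu i - nu (Suc i)) f" "homog n lam (nu \<circ> adj i) (reflect n lam i f)"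
proof -
  show "reflect n lam i f = eta i (nu i - nu (Suc i)) f"
    using reflect_has_weight[OF f i homog_has_weight[OF nu]] by simp
  show "homog n lam (nu \<circ> adj i) (reflect n lam i f)"
    unfolding homog_def
  proof (intro allI impI)
    fix al assume "reflect n lam i f al \<noteq> 0"
    then obtain be where be: "f be \<noteq> 0" "wt n lam be = wt n lam al \<circ> adj i"
      using f i by (rule reflect_support)
    have "nu \<circ> adj i = wt n lam al \<circ> (adj i \<circ> adj i)"
      using be nu unfolding homog_def by (metis comp_assoc)
    then show "wt n lam al = nu \<circ> adj i" by simp
  qed
qed

text \<open>Identities between the reflections are checked on each weight component.\<close>

definition proj :: "nat \<Rightarrow> (nat \<Rightarrow> complex) \<Rightarrow> (nat \<Rightarrow> complex) \<Rightarrow> fseries \<Rightarrow> fseries" where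
  "proj n lam nu f = (\<lambda>al. if wt n lam al = nu then f al else 0)"

lemma proj_adm: "f \<in> adm n \<Longrightarrow> proj n lam nu f \<in> adm n"
  by (auto simp: adm_def proj_def)

lemma proj_homog: "homog n lam nu (proj n lam nu f)"
  by (auto simp: homog_def proj_def)

lemma eq_by_proj: "(\<And>nu. proj n lam nu f = proj n lam nu g) \<Longrightarrow> f = g"
  by (rule ext) (metis proj_def)

lemma proj_reflect:
  assumes f: "f \<in> adm n" and i: "1 \<le> i" "i < n"
  shows "proj n lam nu (reflect n lam i f) = reflect n lam i (proj n lam (nu \<circ> adj i) f)"
proof
  fix al
  let ?g = "proj n lam (nu \<circ> adj i) f"
  (* f is split into its weight component and a rest h that does not contribute at al *)
  define h where "h = f + (\<lambda>al. - 1 * ?g al)"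
  have g: "?g \<in> adm n" using f by (rule proj_adm)
  have h: "h \<in> adm n" unfolding h_def by (intro adm_add adm_scale f g)
  have "f = ?g + h" by (simp add: h_def fun_eq_iff)
  then have split: "reflect n lam i f al = reflect n lam i ?g al + reflect n lam i h al"
    using reflect_add[OF g h i(2)] by (metis plus_fun_apply)
  show "proj n lam nu (reflect n lam i f) al = reflect n lam i ?g al"
  proof (cases "wt n lam al = nu")
    case True
    have "reflect n lam i h al = 0"
    proof (rule ccontr)
      assume "reflect n lam i h al \<noteq> 0"
      then obtain be where "h be \<noteq> 0" "wt n lam be = wt n lam al \<circ> adj i"
        using h i by (rule reflect_support)
      then show False using True by (simp add: h_def proj_def)
    qed
    then show ?thesis using True split by (simp add: proj_def)
  next
    case False
    have "reflect n lam i ?g al = 0"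
    proof (rule ccontr)
      assume "reflect n lam i ?g al \<noteq> 0"
      then have "wt n lam al = (nu \<circ> adj i) \<circ> adj i"
        using reflect_homog(2)[OF g i proj_homog] unfolding homog_def by blast
      then show False using False by (simp add: comp_assoc)
    qed
    then show ?thesis using False by (simp add: proj_def)
  qed
qed

lemma reflect_involution:
  assumes f: "f \<in> adm n" and i: "1 \<le> i" "i < n"
  shows "reflect n lam i (reflect n lam i f) = f"
proof (rule eq_by_proj)
  fix nu
  have *: "reflect n lam i (reflect n lam i g) = g" if g: "g \<in> adm n" "homog n lam nu g" for g
  proof -
    note 1 = reflect_homog[OF g(1) i g(2)]
    have "reflect n lam i (reflect n lam i g) = eta i (nu (Suc i) - nu i) (reflect n lam i g)"
      using reflect_homog(1)[OF reflect_adm[OF g(1) i] i 1(2)] by simp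
    also have "\<dots> = g"
      unfolding 1(1) eta_eta[OF g(1) i] using eta_0[OF g(1) i(2)] by simp
    finally show ?thesis .
  qed
  have "proj n lam nu (reflect n lam i (reflect n lam i f))
      = reflect n lam i (reflect n lam i (proj n lam nu f))"
    by (simp add: proj_reflect[OF reflect_adm[OF f i] i] proj_reflect[OF f i] comp_assoc)
  also have "\<dots> = proj n lam nu f" by (rule *[OF proj_adm[OF f] proj_homog])
  finally show "proj n lam nu (reflect n lam i (reflect n lam i f)) = proj n lam nu f" .
qed

lemma reflect_commute:
  assumes f: "f \<in> adm n" and i: "1 \<le> i" and k: "Suc i < k" "k < n"
  shows "reflect n lam i (reflect n lam k f) = reflect n lam k (reflect n lam i f)"
proof (rule eq_by_proj)
  fix nu
  have i': "i < n" and k': "1 \<le> k" using k by auto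
  have *: "reflect n lam i (reflect n lam k g) = reflect n lam k (reflect n lam i g)"
    if g: "g \<in> adm n" "homog n lam nu g" for g nu
  proof -
    note 1 = reflect_homog[OF g(1) i i' g(2)] and 2 = reflect_homog[OF g(1) k' k(2) g(2)]
    have "reflect n lam i (reflect n lam k g) = eta i (nu i - nu (Suc i)) (reflect n lam k g)"
      using reflect_homog(1)[OF reflect_adm[OF g(1) k' k(2)] i i' 2(2)] k by (simp add: transpose_def)
    moreover have "reflect n lam k (reflect n lam i g) = eta k (nu k - nu (Suc k)) (reflect n lam i g)"
      using reflect_homog(1)[OF reflect_adm[OF g(1) i i'] k' k(2) 1(2)] k by (simp add: transpose_def)
    ultimately show ?thesis
      unfolding 1(1) 2(1) using eta_commute[OF g(1) i i' k' k(2)] k(1) by simp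
  qed
  have "proj n lam nu (reflect n lam i (reflect n lam k f)) =
      reflect n lam i (reflect n lam k (proj n lam (nu \<circ> (adj i \<circ> adj k)) f))"
    by (simp only: proj_reflect[OF reflect_adm[OF f k' k(2)] i i'] proj_reflect[OF f k' k(2)] comp_assoc)
  also have "\<dots> = reflect n lam k (reflect n lam i (proj n lam (nu \<circ> (adj k \<circ> adj i)) f))"
    unfolding adj_commute[OF k(1)] by (rule *[OF proj_adm[OF f] proj_homog])
  also have "\<dots> = proj n lam nu (reflect n lam k (reflect n lam i f))"
    by (simp only: proj_reflect[OF reflect_adm[OF f i i'] k' k(2)] proj_reflect[OF f i i'] comp_assoc)
  finally show "proj n lam nu (reflect n lam i (reflect n lam k f))
      = proj n lam nu (reflect n lam k (reflect n lam i f))" .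
qed

lemma reflect_braid:
  assumes f: "f \<in> adm n" and i: "1 \<le> i" "Suc i < n"
  shows "reflect n lam i (reflect n lam (Suc i) (reflect n lam i f)) =
    reflect n lam (Suc i) (reflect n lam i (reflect n lam (Suc i) f))"
proof (rule eq_by_proj)
  fix nu
  have i': "i < n" and k: "1 \<le> Suc i" using i by auto
  let ?A = "reflect n lam i" and ?B = "reflect n lam (Suc i)"
  note A = reflect_adm[OF _ i(1) i', of _ lam] and B = reflect_adm[OF _ k i(2), of _ lam]
  note hA = reflect_homog[OF _ i(1) i', where lam = lam] and hB = reflect_homog[OF _ k i(2), where lam = lam]
  note pA = proj_reflect[OF _ i(1) i', of _ lam] and pB = proj_reflect[OF _ k i(2), of _ lam]
  have *: "?A (?B (?A g)) = ?B (?A (?B g))" if g: "g \<in> adm n" "homog n lam nu g" for g nu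
  proof -
    let ?a = "nu (Suc i) - nu (Suc (Suc i))" and ?b = "nu i - nu (Suc i)"
    have "?A (?B (?A g)) = eta i ?a (eta (Suc i) (?a + ?b) (eta i ?b g))"
      using hA(1)[OF B[OF A[OF g(1)]] hB(2)[OF A[OF g(1)] hA(2)[OF g]]]
        hB(1)[OF A[OF g(1)] hA(2)[OF g]] hA(1)[OF g]
      by (simp add: transpose_def)
    moreover have "?B (?A (?B g)) = eta (Suc i) ?b (eta i (?a + ?b) (eta (Suc i) ?a g))"
      using hB(1)[OF A[OF B[OF g(1)]] hA(2)[OF B[OF g(1)] hB(2)[OF g]]]
        hA(1)[OF B[OF g(1)] hB(2)[OF g]] hB(1)[OF g]
      by (simp add: transpose_def)
    ultimately show ?thesis using eta_braid[OF g(1) i, of ?a ?b] by simp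
  qed
  have "proj n lam nu (?A (?B (?A f))) = ?A (?B (?A (proj n lam (nu \<circ> (adj i \<circ> adj (Suc i) \<circ> adj i)) f)))"
    by (simp only: pA[OF B[OF A[OF f]]] pB[OF A[OF f]] pA[OF f] comp_assoc)
  also have "\<dots> = ?B (?A (?B (proj n lam (nu \<circ> (adj (Suc i) \<circ> adj i \<circ> adj (Suc i))) f)))"
    unfolding adj_braid by (rule *[OF proj_adm[OF f] proj_homog])
  also have "\<dots> = proj n lam nu (?B (?A (?B f)))"
    by (simp only: pB[OF A[OF B[OF f]]] pA[OF B[OF f]] pB[OF f] comp_assoc)
  finally show "proj n lam nu (?A (?B (?A f))) = proj n lam nu (?B (?A (?B f)))" .
qed

section \<open>The formula for the reflections\<close>

lemma Sum_any_linear_combination: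
  fixes G :: "'s \<Rightarrow> int \<Rightarrow> complex"
  assumes "finite I" "\<And>s. s \<in> I \<Longrightarrow> finite {j. G s j \<noteq> 0}"
  shows "finite {j. (\<Sum>s\<in>I. c s * G s j) \<noteq> 0}"
    "(\<Sum>s\<in>I. c s * Sum_any (G s)) = Sum_any (\<lambda>j. \<Sum>s\<in>I. c s * G s j)"
proof -
  define J where "J = (\<Union>s\<in>I. {j. G s j \<noteq> 0})"
  have J: "finite J" using assms by (simp add: J_def)
  have sub: "{j. (\<Sum>s\<in>I. c s * G s j) \<noteq> 0} \<subseteq> J"
  proof
    fix j assume "j \<in> {j. (\<Sum>s\<in>I. c s * G s j) \<noteq> 0}"
    then have nz: "(\<Sum>s\<in>I. c s * G s j) \<noteq> 0" by simp
    obtain s where "s \<in> I" "c s * G s j \<noteq> 0"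
      using nz by (rule sum.not_neutral_contains_not_neutral)
    then show "j \<in> J" by (auto simp: J_def)
  qed
  then show "finite {j. (\<Sum>s\<in>I. c s * G s j) \<noteq> 0}" using J by (rule finite_subset)
  have "(\<Sum>s\<in>I. c s * Sum_any (G s)) = (\<Sum>s\<in>I. c s * sum (G s) J)"
    by (intro sum.cong refl arg_cong2[where f = times] Sum_any.expand_superset[OF J]) (auto simp: J_def)
  also have "\<dots> = (\<Sum>j\<in>J. \<Sum>s\<in>I. c s * G s j)"
    unfolding sum_distrib_left by (rule sum.swap)
  also have "\<dots> = Sum_any (\<lambda>j. \<Sum>s\<in>I. c s * G s j)"
    by (rule Sum_any.expand_superset[OF J sub, symmetric])
  finally show "(\<Sum>s\<in>I. c s * Sum_any (G s)) = Sum_any (\<lambda>j. \<Sum>s\<in>I. c s * G s j)" .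
qed

lemma formal_sum_shift_power:
  assumes "formal_sum F f"
  shows "formal_sum (\<lambda>j. app (shift i ^ p) (F j)) (app (shift i ^ p) f)"
proof (induction p)
  case 0
  then show ?case using assms by (simp add: app_simps)
next
  case (Suc p)
  let ?F = "\<lambda>j. app (shift i ^ p) (F j)" and ?f = "app (shift i ^ p) f"
  have fin: "finite {j. ?F j al \<noteq> 0}" and sum: "?f al = Sum_any (\<lambda>j. ?F j al)" for al
    using Suc by (auto simp: formal_sum_def)
  have "finite {j. app (shift i) (?F j) al \<noteq> 0}
      \<and> app (shift i) ?f al = Sum_any (\<lambda>j. app (shift i) (?F j) al)" for al
    unfolding shift_at sum
    using Sum_any_linear_combination[of "{1..<i}" "\<lambda>s j. ?F j (step i s al)" "\<lambda>s. al (i, s) + 1"] fin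
    by simp
  then show ?case by (simp add: formal_sum_def app_times)
qed

lemma formal_sum_adm:
  assumes "formal_sum F f" "\<And>j. F j \<in> adm n"
  shows "f \<in> adm n"
proof -
  have "admissible_expo n al" if "f al \<noteq> 0" for al
  proof -
    have "f al = Sum_any (\<lambda>j. F j al)" using assms(1) by (simp add: formal_sum_def)
    then obtain j where "F j al \<noteq> 0" using \<open>f al \<noteq> 0\<close> by fastforce
    then show ?thesis using assms(2)[of j] by (simp add: adm_def)
  qed
  then show ?thesis by (simp add: adm_def)
qed

lemma formal_sum_reflect:
  assumes F: "formal_sum F f" and adm: "\<And>j. F j \<in> adm n" and i: "1 \<le> i" "i < n"
  shows "formal_sum (\<lambda>j. reflect n lam i (F j)) (reflect n lam i f)"
  unfolding formal_sum_def
proof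
  fix al
  define a where "a = wt n lam al (Suc i) - wt n lam al i"
  define be where "be p = al((Suc i, i) := al (Suc i, i) - (a - of_nat p))" for p
  have "finite {j. app (shift i ^ p) (F j) al \<noteq> 0}"
    "app (shift i ^ p) f al = Sum_any (\<lambda>j. app (shift i ^ p) (F j) al)" for p al
    using formal_sum_shift_power[OF F, of i p] by (auto simp: formal_sum_def)
  then show "finite {j. reflect n lam i (F j) al \<noteq> 0} \<and>
      reflect n lam i f al = Sum_any (\<lambda>j. reflect n lam i (F j) al)"
    unfolding reflect_def a_def[symmetric] eta_finite[OF adm i(2) order_refl]
      eta_finite[OF formal_sum_adm[OF F adm] i(2) order_refl] be_def[symmetric]
    using Sum_any_linear_combination[of "{..bound i al}" "\<lambda>p j. app (shift i ^ p) (F j)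
        (be p)" "\<lambda>p. a gchoose p"]
    by simp
qed

lemma formal_sum_unique: "formal_sum F f \<Longrightarrow> formal_sum F g \<Longrightarrow> f = g"
  by (rule ext) (simp add: formal_sum_def)

text \<open>The monomials of a series are numbered by integers, and each is a weighted series.\<close>

lemma monomial_decomposition:
  assumes count: "countable {al. f al \<noteq> 0}" and V: "\<And>P. (\<lambda>al. if P al then f al else 0) \<in> V"
  obtains F :: "int \<Rightarrow> fseries" and mu
  where "\<And>j. F j \<in> V" "\<And>j. has_weight n lam (mu j) (F j)" "formal_sum F f"
proof -
  obtain e :: "expo \<Rightarrow> nat" where e: "inj_on e {al. f al \<noteq> 0}"
    using count by (auto simp: countable_def)
  (* F j is zero for the integers j that number no monomial; then be j and mu j are arbitrary *)
  define F where "F j = (\<lambda>al. if int (e al) = j then f al else 0)" for j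
  define be where "be j = (SOME al. F j al \<noteq> 0)" for j
  define mu where "mu j i = wt n lam (be j) i - wt n lam (be j) (Suc i) - 1" for j i
  have be: "al = be j" if "F j al \<noteq> 0" for al j
  proof -
    have "F j (be j) \<noteq> 0" unfolding be_def by (rule someI[of "\<lambda>al. F j al \<noteq> 0" al]) (rule that)
    then show ?thesis using that e by (auto simp: F_def inj_on_def split: if_splits)
  qed
  have "has_weight n lam (mu j) (F j)" for j
    unfolding has_weight_iff mu_def using be by blast
  moreover have "formal_sum F f"
    unfolding formal_sum_def
  proof
    fix al
    have sub: "{j. F j al \<noteq> 0} \<subseteq> {int (e al)}" by (auto simp: F_def)
    then have "Sum_any (\<lambda>j. F j al) = (\<Sum>j\<in>{int (e al)}. F j al)"
      by (intro Sum_any.expand_superset) auto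
    then show "finite {j. F j al \<noteq> 0} \<and> f al = Sum_any (\<lambda>j. F j al)"
      using finite_subset[OF sub] by (simp add: F_def)
  qed
  moreover have "F j \<in> V" for j unfolding F_def by (rule V)
  ultimately show thesis by (rule that[rotated])
qed

text \<open>By formal_sum_reflect the right side of the formula for sigma_i is the image of the sum, for every
  decomposition; so the result is unique, and the decomposition into monomials shows existence.\<close>

lemma sigma_rel_iff:
  assumes V: "V \<subseteq> adm n" and i: "1 \<le> i" "i < n" and count: "countable {al. f al \<noteq> 0}"
    and restr: "\<And>P. (\<lambda>al. if P al then f al else 0) \<in> V"
  shows "sigma_rel V n lam i f g \<longleftrightarrow> g = reflect n lam i f"
proof -
  have eta: "(\<lambda>j. eta i (mu j i + 1) (F j)) = (\<lambda>j. reflect n lam i (F j))"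
    if "\<And>j. F j \<in> V" "\<And>j. has_weight n lam (mu j) (F j)" for F :: "int \<Rightarrow> fseries" and mu
    using reflect_has_weight[OF _ i that(2)] that(1) V by (auto simp: subset_iff)
  show ?thesis
  proof
    assume "sigma_rel V n lam i f g"
    then obtain F :: "int \<Rightarrow> fseries" and mu where F: "\<And>j. F j \<in> V" "\<And>j. has_weight n lam (mu j) (F j)"
      "formal_sum F f" "formal_sum (\<lambda>j. eta i (mu j i + 1) (F j)) g"
      unfolding sigma_rel_def by blast
    have "formal_sum (\<lambda>j. reflect n lam i (F j)) (reflect n lam i f)"
      using F V by (intro formal_sum_reflect[OF _ _ i]) auto
    then show "g = reflect n lam i f"
      using F(4) unfolding eta[of F mu, OF F(1,2)] by (rule formal_sum_unique[rotated])
  next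
    assume g: "g = reflect n lam i f"
    obtain F :: "int \<Rightarrow> fseries" and mu where F: "\<And>j. F j \<in> V" "\<And>j. has_weight n lam (mu j)
        (F j)" "formal_sum F f"
      by (rule monomial_decomposition[OF count, of V n lam]) (rule restr, blast)
    have "formal_sum (\<lambda>j. eta i (mu j i + 1) (F j)) g"
      unfolding eta[of F mu, OF F(1,2)] g
      using F V by (intro formal_sum_reflect[OF _ _ i]) auto
    then show "sigma_rel V n lam i f g"
      unfolding sigma_rel_def using F by blast
  qed
qed

section \<open>The spaces of series\<close>

lemma untruncated_iff:
  "f \<in> untruncated n \<longleftrightarrow> f \<in> adm n \<and> (\<exists>P :: (nat \<Rightarrow> complex) set. finite P \<and>
     (\<forall>al. f al \<noteq> 0 \<longrightarrow> (\<exists>a\<in>P. \<forall>k. 1 \<le> k \<and> k < n \<longrightarrow> a k - al (Suc k, k) \<in> \<int>)))"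
  by (simp add: untruncated_def adm_def Ball_def)

lemma truncated_up_iff:
  "f \<in> truncated_up n \<longleftrightarrow> f \<in> adm n \<and> (\<exists>P :: (nat \<Rightarrow> complex) set. finite P \<and>
     (\<forall>al. f al \<noteq> 0 \<longrightarrow> (\<exists>a\<in>P. \<forall>k. 1 \<le> k \<and> k < n \<longrightarrow> a k - al (Suc k, k) \<in> \<nat>))) \<and>
     (\<forall>b :: nat \<Rightarrow> complex. finite {al. f al \<noteq> 0 \<and> (\<forall>k. 1 \<le> k \<and> k < n \<longrightarrow> al (Suc k, k) = b k)})"
  by (simp add: truncated_up_def adm_def Ball_def)

lemma untruncated_adm: "untruncated n \<subseteq> adm n"
  using untruncated_iff by blast

lemma truncated_up_subset: "truncated_up n \<subseteq> untruncated n"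
proof
  fix f assume f: "f \<in> truncated_up n"
  then obtain P :: "(nat \<Rightarrow> complex) set" where "finite P"
    "\<And>al. f al \<noteq> 0 \<Longrightarrow> (\<exists>a\<in>P. \<forall>k. 1 \<le> k \<and> k < n \<longrightarrow> a k - al (Suc k, k) \<in> \<nat>)"
    unfolding truncated_up_iff by blast
  then have "finite P \<and> (\<forall>al. f al \<noteq> 0 \<longrightarrow> (\<exists>a\<in>P. \<forall>k. 1 \<le> k \<and> k < n \<longrightarrow> a k - al (Suc k, k) \<in> \<int>))"
    using Nats_subset_Ints by (meson subsetD)
  then show "f \<in> untruncated n"
    using f unfolding truncated_up_iff untruncated_iff by blast
qed

lemma untruncated_restrict:
  assumes "f \<in> untruncated n"
  shows "(\<lambda>al. if Q al then f al else 0) \<in> untruncated n"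
proof -
  obtain P :: "(nat \<Rightarrow> complex) set" where "finite P"
    "\<forall>al. f al \<noteq> 0 \<longrightarrow> (\<exists>a\<in>P. \<forall>k. 1 \<le> k \<and> k < n \<longrightarrow> a k - al (Suc k, k) \<in> \<int>)"
    using assms unfolding untruncated_iff by blast
  then show ?thesis using assms unfolding untruncated_iff adm_def
    by (intro conjI exI[of _ P]) auto
qed

lemma truncated_up_restrict:
  assumes "f \<in> truncated_up n"
  shows "(\<lambda>al. if Q al then f al else 0) \<in> truncated_up n"
proof -
  obtain P :: "(nat \<Rightarrow> complex) set" where P: "finite P"
    "\<forall>al. f al \<noteq> 0 \<longrightarrow> (\<exists>a\<in>P. \<forall>k. 1 \<le> k \<and> k < n \<longrightarrow> a k - al (Suc k, k) \<in> \<nat>)"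
    using assms unfolding truncated_up_iff by blast
  have "finite {al. (if Q al then f al else 0) \<noteq> 0 \<and> (\<forall>k. 1 \<le> k \<and> k < n \<longrightarrow> al (Suc k, k) = b k)}" for b
    by (rule finite_subset[of _ "{al. f al \<noteq> 0 \<and> (\<forall>k. 1 \<le> k \<and> k < n \<longrightarrow> al (Suc k, k) = b k)}"])
      (use assms in \<open>auto simp: truncated_up_iff\<close>)
  then show ?thesis using assms P unfolding truncated_up_iff adm_def
    by (intro conjI exI[of _ P]) auto
qed

lemma untruncated_add:
  assumes "f \<in> untruncated n" "g \<in> untruncated n"
  shows "(\<lambda>al. f al + g al) \<in> untruncated n"
proof -
  obtain P Q :: "(nat \<Rightarrow> complex) set" where "finite P" "finite Q"
    and P: "\<And>al. f al \<noteq> 0 \<Longrightarrow> (\<exists>a\<in>P. \<forall>k. 1 \<le> k \<and> k < n \<longrightarrow> a k - al (Suc k, k) \<in> \<int>)"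
    and Q: "\<And>al. g al \<noteq> 0 \<Longrightarrow> (\<exists>a\<in>Q. \<forall>k. 1 \<le> k \<and> k < n \<longrightarrow> a k - al (Suc k, k) \<in> \<int>)"
    using assms unfolding untruncated_iff by blast
  have nz: "f al \<noteq> 0 \<or> g al \<noteq> 0" if "f al + g al \<noteq> 0" for al using that by auto
  have "\<exists>a\<in>P \<union> Q. \<forall>k. 1 \<le> k \<and> k < n \<longrightarrow> a k - al (Suc k, k) \<in> \<int>" if "f al + g al \<noteq> 0" for al
    using nz[OF that] P[of al] Q[of al] by blast
  moreover have "(\<lambda>al. f al + g al) \<in> adm n"
    using assms nz unfolding untruncated_iff adm_def by blast
  ultimately show ?thesis using \<open>finite P\<close> \<open>finite Q\<close> unfolding untruncated_iff
    by (intro conjI exI[of _ "P \<union> Q"]) auto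
qed

lemma untruncated_scale:
  assumes "f \<in> untruncated n"
  shows "(\<lambda>al. c * f al) \<in> untruncated n"
proof -
  obtain P :: "(nat \<Rightarrow> complex) set" where "finite P"
    "\<forall>al. f al \<noteq> 0 \<longrightarrow> (\<exists>a\<in>P. \<forall>k. 1 \<le> k \<and> k < n \<longrightarrow> a k - al (Suc k, k) \<in> \<int>)"
    using assms unfolding untruncated_iff by blast
  then show ?thesis using assms adm_scale unfolding untruncated_iff
    by (intro conjI exI[of _ P]) auto
qed

text \<open>An admissible exponent has finitely many entries, each of them natural or congruent modulo the
  integers to one of finitely many numbers.\<close>

lemma countable_support:
  assumes "f \<in> untruncated n"
  shows "countable {al. f al \<noteq> 0}"
proof -
  obtain P :: "(nat \<Rightarrow> complex) set" where P: "finite P"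
    "\<And>al. f al \<noteq> 0 \<Longrightarrow> (\<exists>a\<in>P. \<forall>k. 1 \<le> k \<and> k < n \<longrightarrow> a k - al (Suc k, k) \<in> \<int>)"
    using assms unfolding untruncated_iff by blast
  have adm: "\<And>al. f al \<noteq> 0 \<Longrightarrow> admissible_expo n al"
    using assms unfolding untruncated_iff adm_def by blast
  define T where "T = {0..n} \<times> {0..n}"
  define C where "C = (\<nat> :: complex set) \<union> (\<Union>a\<in>P. \<Union>k\<in>{1..<n}. (\<lambda>z. a k - z) ` \<int>)"
  have countC: "countable C"
    unfolding C_def using P(1)
    by (intro countable_Un countable_UN countable_image) (auto simp: Nats_def Ints_def intro: countable_finite)
  have val: "al q \<in> C" if nz: "f al \<noteq> 0" for al q
  proof (cases q)
    case (Pair r c)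
    consider "\<not> (1 \<le> c \<and> c < r \<and> r \<le> n)" | "c + 2 \<le> r" | "r = Suc c" "1 \<le> c" "c < n" by linarith
    then show ?thesis
    proof cases
      case 3
      obtain a where "a \<in> P" "a c - al (Suc c, c) \<in> \<int>" using P(2)[OF nz] 3 by blast
      moreover have "al (Suc c, c) = a c - (a c - al (Suc c, c))" by simp
      ultimately show ?thesis unfolding C_def Pair 3(1) using 3 by (intro UnI2) fastforce
    qed (use adm[OF nz] in \<open>auto simp: admissible_expo_def C_def Pair\<close>)
  qed
  obtain qs where qs: "set qs = T" using finite_list[of T] by (auto simp: T_def)
  have "inj_on (\<lambda>al. map al qs) {al. f al \<noteq> 0}"
  proof (rule inj_onI)
    fix al be assume ab: "al \<in> {al. f al \<noteq> 0}" "be \<in> {al. f al \<noteq> 0}" "map al qs = map be qs"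
    show "al = be"
    proof
      fix q
      show "al q = be q"
      proof (cases "q \<in> T")
        case True
        then show ?thesis using ab(3) qs by simp
      next
        case False
        obtain r c where q: "q = (r, c)" by (cases q)
        have out: "\<not> (1 \<le> c \<and> c < r \<and> r \<le> n)" using False by (auto simp: q T_def)
        have "al (r, c) = 0" "be (r, c) = 0"
          using ab(1,2) adm[of al] adm[of be] out unfolding admissible_expo_def by blast+
        then show ?thesis by (simp add: q)
      qed
    qed
  qed
  moreover have "countable ((\<lambda>al. map al qs) ` {al. f al \<noteq> 0})"
    by (rule countable_subset[OF _ countable_lists[OF countC]]) (use val in auto)
  ultimately show ?thesis by (rule countable_image_inj_on[rotated])
qed

text \<open>Modulo the integers, the new exponent of x_{i+1,i} is the old one plus nu_i - nu_{i+1}, which is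
  a combination of lambda_i and the exponents of x_{i,i-1}, x_{i+1,i} and x_{i+2,i+1}. So each class of
  leading exponents is sent to one class.\<close>

lemma untruncated_reflect:
  assumes f: "f \<in> untruncated n" and i: "1 \<le> i" "i < n"
  shows "reflect n lam i f \<in> untruncated n"
proof -
  obtain P :: "(nat \<Rightarrow> complex) set" where P: "finite P"
    "\<And>al. f al \<noteq> 0 \<Longrightarrow> (\<exists>a\<in>P. \<forall>k. 1 \<le> k \<and> k < n \<longrightarrow> a k - al (Suc k, k) \<in> \<int>)"
    using f unfolding untruncated_iff by blast
  have adm: "f \<in> adm n" using f unfolding untruncated_iff by blast
  define l where "l a = (if 1 < i then a (i - 1) else 0)" for a :: "nat \<Rightarrow> complex"
  define r where "r a = (if Suc i < n then a (Suc i) else 0)" for a :: "nat \<Rightarrow> complex"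
  (* with the missing neighbours x_{1,0} and x_{n+1,n} counted as exponent 0 *)
  define T where "T a = a(i := lam i + 1 + l a + r a - a i)" for a
  have "\<exists>a\<in>T ` P. \<forall>k. 1 \<le> k \<and> k < n \<longrightarrow> a k - al (Suc k, k) \<in> \<int>"
    if nz: "reflect n lam i f al \<noteq> 0" for al
  proof -
    obtain be p where be: "f be \<noteq> 0" "wt n lam be = wt n lam al \<circ> adj i"
      "be (Suc i, i) = al (Suc i, i) - (wt n lam be i - wt n lam be (Suc i) - of_nat p)"
      "\<And>k. k \<noteq> i \<Longrightarrow> be (Suc k, k) - al (Suc k, k) \<in> \<nat>"
      using nz adm i by (rule reflect_support) blast
    obtain a where a: "a \<in> P" "\<And>k. 1 \<le> k \<Longrightarrow> k < n \<Longrightarrow> a k - be (Suc k, k) \<in> \<int>"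
      using P(2)[OF be(1)] by blast
    have nat: "be (r, c) \<in> \<int>" if "c + 2 \<le> r" for r c
      using adm be(1) that Nats_subset_Ints by (fastforce simp: adm_def admissible_expo_def)
    have row: "l a - (\<Sum>p=1..<i. be (i, p)) \<in> \<int>"
    proof (cases "1 < i")
      case True
      then obtain m where m: "i = Suc m" "1 \<le> m" by (cases i) auto
      have "(\<Sum>p=1..<m. be (i, p)) \<in> \<int>" using m by (intro Ints_sum nat) auto
      moreover have "a m - be (i, m) \<in> \<int>" using a(2)[of m] m i by simp
      ultimately have "(a m - be (i, m)) - (\<Sum>p=1..<m. be (i, p)) \<in> \<int>" by (rule Ints_diff[rotated])
      then show ?thesis using m by (simp add: l_def algebra_simps)
    qed (simp add: l_def)
    have col: "r a - (\<Sum>j=Suc (Suc i)..n. be (j, Suc i)) \<in> \<int>"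
    proof (cases "Suc i < n")
      case True
      have "(\<Sum>j=Suc (Suc (Suc i))..n. be (j, Suc i)) \<in> \<int>" by (intro Ints_sum nat) auto
      moreover have "a (Suc i) - be (Suc (Suc i), Suc i) \<in> \<int>" using a(2)[of "Suc i"] True by simp
      ultimately have "(a (Suc i) - be (Suc (Suc i), Suc i)) - (\<Sum>j=Suc (Suc (Suc i))..n. be (j, Suc i)) \<in> \<int>"
        by (rule Ints_diff[rotated])
      then show ?thesis using True by (simp add: r_def sum.atLeast_Suc_atMost[of "Suc (Suc i)" n] algebra_simps)
    qed (simp add: r_def)
    have rest: "(\<Sum>p=1..<i. be (Suc i, p)) \<in> \<int>" "(\<Sum>j=Suc (Suc i)..n. be (j, i)) \<in> \<int>"
      by (intro Ints_sum nat; simp)+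
    define D where "D = wt n lam be i - wt n lam be (Suc i)"
    have "D - 1 = lam i + (\<Sum>p=1..<i. be (i, p) - be (Suc i, p))
        + (\<Sum>j=Suc (Suc i)..n. be (j, Suc i) - be (j, i)) - 2 * be (Suc i, i)"
      unfolding D_def by (rule wt_diff[OF i])
    then have D: "D = lam i + (\<Sum>p=1..<i. be (i, p) - be (Suc i, p))
        + (\<Sum>j=Suc (Suc i)..n. be (j, Suc i) - be (j, i)) - 2 * be (Suc i, i) + 1"
      by (metis diff_add_cancel)
    have "al (Suc i, i) = be (Suc i, i) + D - of_nat p" using be(3) by (simp add: D_def algebra_simps)
    then have "al (Suc i, i) = lam i + 1 + ((\<Sum>p=1..<i. be (i, p)) - (\<Sum>p=1..<i. be (Suc i, p)))
       + ((\<Sum>j=Suc (Suc i)..n. be (j, Suc i)) - (\<Sum>j=Suc (Suc i)..n. be (j, i))) - be (Suc i, i) - of_nat p"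
      unfolding D by (simp add: sum_subtractf algebra_simps)
    then have "lam i + 1 + l a + r a - a i - al (Suc i, i) =
        (l a - (\<Sum>p=1..<i. be (i, p))) + (r a - (\<Sum>j=Suc (Suc i)..n. be (j, Suc i)))
        + (\<Sum>p=1..<i. be (Suc i, p)) + (\<Sum>j=Suc (Suc i)..n. be (j, i)) - (a i - be (Suc i, i)) + of_nat p"
      by (simp add: algebra_simps)
    also have "\<dots> \<in> \<int>"
      by (rule Ints_add[OF Ints_diff[OF Ints_add[OF Ints_add[OF Ints_add[OF row col] rest(1)] rest(2)]
          a(2)[OF i]]]) simp
    finally have *: "T a i - al (Suc i, i) \<in> \<int>" by (simp add: T_def)
    have "T a k - al (Suc k, k) \<in> \<int>" if k: "1 \<le> k" "k < n" for k
    proof (cases "k = i")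
      case False
      have "be (Suc k, k) - al (Suc k, k) \<in> \<int>" using be(4)[OF False] Nats_subset_Ints by blast
      from Ints_add[OF a(2)[OF k] this] show ?thesis using False by (simp add: T_def)
    qed (use * in simp)
    then show ?thesis using a(1) by blast
  qed
  then show ?thesis using P(1) reflect_adm[OF adm i] unfolding untruncated_iff
    by (intro conjI exI[of _ "T ` P"]) auto
qed

section \<open>Weighted series\<close>

text \<open>The entry c of the weight gives the sum of the exponents in column c once those in row c are known.
  The exponents in row c lie in earlier columns, so induction on c bounds all natural exponents.\<close>

lemma homog_finite:
  assumes g: "g \<in> adm n" "homog n lam nu g"
  shows "finite {al. g al \<noteq> 0 \<and> (\<forall>k. 1 \<le> k \<and> k < n \<longrightarrow> al (Suc k, k) = b k)}" (is "finite ?Q")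
proof -
  have adm: "admissible_expo n al" and wt: "wt n lam al = nu"
    and b: "\<And>k. 1 \<le> k \<Longrightarrow> k < n \<Longrightarrow> al (Suc k, k) = b k" if "al \<in> ?Q" for al
    using g that by (auto simp: adm_def homog_def)
  have zero: "al (r, c) = 0" if "al \<in> ?Q" "\<not> (1 \<le> c \<and> c < r \<and> r \<le> n)" for al r c
    using adm[OF that(1)] that(2) by (auto simp: admissible_expo_def)
  have nat: "al (r, c) \<in> \<nat>" if "al \<in> ?Q" "c + 2 \<le> r" for al r c
    using adm[OF that(1)] that(2) by (auto simp: admissible_expo_def)
  have "\<exists>M. \<forall>al\<in>?Q. \<forall>r. c + 2 \<le> r \<longrightarrow> Re (al (r, c)) \<le> M" for c
  proof (induction c rule: less_induct)
    case (less c)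
    show ?case
    proof (cases "1 \<le> c \<and> c \<le> n")
      case False
      have "Re (al (r, c)) \<le> 0" if "al \<in> ?Q" for al r
        using zero[OF that, of c r] False by auto
      then show ?thesis by blast
    next
      case True
      have "\<forall>p\<in>{..<c}. \<exists>m. \<forall>al\<in>?Q. \<forall>r. p + 2 \<le> r \<longrightarrow> Re (al (r, p)) \<le> m"
        using less.IH by blast
      then obtain M where "\<forall>p\<in>{..<c}. \<forall>al\<in>?Q. \<forall>r. p + 2 \<le> r \<longrightarrow> Re (al (r, p)) \<le> M p"
        unfolding bchoice_iff by blast
      then have M: "\<And>p al r. p < c \<Longrightarrow> al \<in> ?Q \<Longrightarrow> p + 2 \<le> r \<Longrightarrow> Re (al (r, p)) \<le> M p"
        by blast
      (* a bound for the sum of the natural exponents in column c; row c consists of b (c - 1) and of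
         exponents bounded by M *)
      define B where "B = \<bar>Re (nu c + (\<Sum>m=1..<c. lam m + 1) + b c)\<bar> + (\<Sum>p=1..<c. \<bar>M p\<bar> + \<bar>Re (b p)\<bar>)"
      have "Re (al (r, c)) \<le> B" if al: "al \<in> ?Q" and r: "c + 2 \<le> r" for al r
      proof (cases "r \<le> n")
        case False
        then show ?thesis using zero[OF al, of c r] by (auto simp: B_def intro!: add_nonneg_nonneg sum_nonneg)
      next
        case rn: True
        have cn: "c < n" using r rn by simp
        have "nu c = (\<Sum>p=1..<c. al (c, p)) - (al (Suc c, c) + (\<Sum>j=Suc (Suc c)..n. al (j, c)))
            - (\<Sum>m=1..<c. lam m + 1)"
          using wt[OF al] True cn by (auto simp: wt_def sum.atLeast_Suc_atMost[of "Suc c" n])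
        then have "(\<Sum>j=Suc (Suc c)..n. al (j, c))
            = (\<Sum>p=1..<c. al (c, p)) - (nu c + (\<Sum>m=1..<c. lam m + 1) + b c)"
          using b[OF al, of c] True cn by (simp add: algebra_simps)
        then have "Re (\<Sum>j=Suc (Suc c)..n. al (j, c))
            = (\<Sum>p=1..<c. Re (al (c, p))) - Re (nu c + (\<Sum>m=1..<c. lam m + 1) + b c)"
          by simp
        also have "(\<Sum>p=1..<c. Re (al (c, p))) \<le> (\<Sum>p=1..<c. \<bar>M p\<bar> + \<bar>Re (b p)\<bar>)"
        proof (rule sum_mono)
          fix p assume p: "p \<in> {1..<c}"
          show "Re (al (c, p)) \<le> \<bar>M p\<bar> + \<bar>Re (b p)\<bar>"
          proof (cases "c = Suc p")
            case True
            then show ?thesis using b[OF al, of p] p cn by simp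
          next
            case False
            then show ?thesis using M[of p al c] p al by auto
          qed
        qed
        finally have "Re (\<Sum>j=Suc (Suc c)..n. al (j, c)) \<le> B" by (simp add: B_def)
        moreover have "Re (al (r, c)) \<le> (\<Sum>j=Suc (Suc c)..n. Re (al (j, c)))"
        proof (rule member_le_sum)
          fix j assume "j \<in> {Suc (Suc c)..n} - {r}"
          then have "al (j, c) \<in> \<nat>" by (intro nat[OF al]) auto
          then show "0 \<le> Re (al (j, c))" by (auto elim: Nats_cases)
        qed (use r rn in auto)
        ultimately show ?thesis by simp
      qed
      then show ?thesis by blast
    qed
  qed
  then have "\<forall>c. \<exists>m. \<forall>al\<in>?Q. \<forall>r. c + 2 \<le> r \<longrightarrow> Re (al (r, c)) \<le> m"
    by blast
  then obtain M where "\<forall>c. \<forall>al\<in>?Q. \<forall>r. c + 2 \<le> r \<longrightarrow> Re (al (r, c)) \<le> M c"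
    unfolding choice_iff by blast
  then have M: "\<And>c al r. al \<in> ?Q \<Longrightarrow> c + 2 \<le> r \<Longrightarrow> Re (al (r, c)) \<le> M c"
    by blast
  define V where "V = insert 0 (b ` {1..<n} \<union> (\<Union>c\<in>{1..<n}. of_nat ` {..nat \<lfloor>M c\<rfloor>}))"
  have "?Q \<subseteq> {al. \<forall>q. (q \<in> {1..n} \<times> {1..n} \<longrightarrow> al q \<in> V) \<and> (q \<notin> {1..n} \<times> {1..n} \<longrightarrow> al q = 0)}"
  proof (intro subsetI CollectI allI)
    fix al and q :: "nat \<times> nat" assume al: "al \<in> ?Q"
    obtain r c where q: "q = (r, c)" by (cases q)
    consider "\<not> (1 \<le> c \<and> c < r \<and> r \<le> n)" | "1 \<le> c" "c + 2 \<le> r" "r \<le> n" | "r = Suc c" "1 \<le> c" "c < n"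
      by linarith
    then show "(q \<in> {1..n} \<times> {1..n} \<longrightarrow> al q \<in> V) \<and> (q \<notin> {1..n} \<times> {1..n} \<longrightarrow> al q = 0)"
    proof cases
      case 1
      then show ?thesis using zero[OF al 1] by (simp add: q V_def)
    next
      case 2
      obtain m where m: "al (r, c) = of_nat m" using nat[OF al 2(2)] by (auto elim: Nats_cases)
      then have "real m \<le> M c" using M[OF al 2(2)] by simp
      then have "m \<le> nat \<lfloor>M c\<rfloor>" by (simp add: le_nat_floor)
      then have "al (r, c) \<in> V" using m 2 by (auto simp: V_def)
      then show ?thesis using 2 by (auto simp: q)
    next
      case 3
      then show ?thesis using b[OF al 3(2,3)] by (auto simp: q V_def)
    qed
  qed
  moreover have "finite {al. \<forall>q. (q \<in> {1..n} \<times> {1..n} \<longrightarrow> al q \<in> V) \<and> (q \<notin> {1..n} \<times> {1..n} \<longrightarrow> al q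
      = (0::complex))}"
    by (intro finite_set_of_finite_funs) (auto simp: V_def)
  ultimately show ?thesis by (rule finite_subset)
qed

text \<open>On a series of a single weight the exponent of f_i is a constant, so the leading exponents are
  translated by it.\<close>

lemma truncated_up_reflect:
  assumes f: "f \<in> truncated_up n" "weighted n lam f" and i: "1 \<le> i" "i < n"
  shows "reflect n lam i f \<in> truncated_up n" "weighted n lam (reflect n lam i f)"
proof -
  obtain nu where nu: "homog n lam nu f" using f(2) by (auto simp: weighted_iff_homog)
  have adm: "f \<in> adm n" using f unfolding truncated_up_iff by blast
  note r = reflect_homog[OF adm i nu]
  have r_adm: "reflect n lam i f \<in> adm n" using adm i by (rule reflect_adm)
  obtain P :: "(nat \<Rightarrow> complex) set" where P: "finite P"
    "\<And>al. f al \<noteq> 0 \<Longrightarrow> (\<exists>a\<in>P. \<forall>k. 1 \<le> k \<and> k < n \<longrightarrow> a k - al (Suc k, k) \<in> \<nat>)"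
    using f(1) unfolding truncated_up_iff by blast
  define T where "T a = a(i := a i + (nu i - nu (Suc i)))" for a
  have "\<exists>a\<in>T ` P. \<forall>k. 1 \<le> k \<and> k < n \<longrightarrow> a k - al (Suc k, k) \<in> \<nat>"
    if nz: "reflect n lam i f al \<noteq> 0" for al
  proof -
    obtain be p where be: "f be \<noteq> 0"
      "be (Suc i, i) = al (Suc i, i) - (wt n lam be i - wt n lam be (Suc i) - of_nat p)"
      "\<And>k. k \<noteq> i \<Longrightarrow> be (Suc k, k) - al (Suc k, k) \<in> \<nat>"
      using nz adm i by (rule reflect_support) blast
    obtain a where a: "a \<in> P" "\<And>k. 1 \<le> k \<Longrightarrow> k < n \<Longrightarrow> a k - be (Suc k, k) \<in> \<nat>"
      using P(2)[OF be(1)] by blast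
    have "T a k - al (Suc k, k) \<in> \<nat>" if k: "1 \<le> k" "k < n" for k
    proof (cases "k = i")
      case True
      have "wt n lam be = nu" using nu be(1) by (simp add: homog_def)
      then have "T a i - al (Suc i, i) = (a i - be (Suc i, i)) + of_nat p"
        using be(2) by (simp add: T_def algebra_simps)
      also have "\<dots> \<in> \<nat>" using a(2)[OF i] by (intro Nats_add) auto
      finally show ?thesis using True by simp
    next
      case False
      from Nats_add[OF a(2)[OF k] be(3)[OF False]] show ?thesis using False by (simp add: T_def)
    qed
    then show ?thesis using a(1) by blast
  qed
  then show "reflect n lam i f \<in> truncated_up n"
    using P(1) r_adm homog_finite[OF r_adm r(2)] unfolding truncated_up_iff
    by (intro conjI exI[of _ "T ` P"]) auto
  show "weighted n lam (reflect n lam i f)"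
    using r(2) by (auto simp: weighted_iff_homog)
qed

lemma weighted_span_reflect:
  assumes f: "f \<in> weighted_span n lam" and i: "1 \<le> i" "i < n"
  shows "reflect n lam i f \<in> weighted_span n lam"
proof -
  let ?R = "reflect n lam i"
  obtain W where W: "finite W" "\<And>w. w \<in> W \<Longrightarrow> w \<in> truncated_up n \<and> weighted n lam w"
    "f = (\<lambda>al. \<Sum>w\<in>W. w al)"
    using f by (auto simp: weighted_span_def)
  have adm: "w \<in> adm n" if "w \<in> W" for w using W(2)[OF that] unfolding truncated_up_iff by blast
  have sum: "(\<lambda>al. \<Sum>w\<in>U. w al) \<in> adm n \<and> ?R (\<lambda>al. \<Sum>w\<in>U. w al) = (\<lambda>al. \<Sum>w\<in>U. ?R w al)"
    if "U \<subseteq> W" for U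
    using finite_subset[OF that W(1)] that
  proof (induction U rule: finite_induct)
    case empty
    have "?R (\<lambda>_. 0) = (\<lambda>_. 0)"
      using reflect_scale[of "\<lambda>_. 0" n i lam 0] i by (simp add: adm_def)
    then show ?case by (simp add: adm_def)
  next
    case (insert w U)
    have eq: "(\<lambda>al. \<Sum>v\<in>insert w U. v al) = w + (\<lambda>al. \<Sum>v\<in>U. v al)"
      using insert by (auto simp: fun_eq_iff)
    have IH: "(\<lambda>al. \<Sum>v\<in>U. v al) \<in> adm n" "?R (\<lambda>al. \<Sum>v\<in>U. v al) = (\<lambda>al. \<Sum>v\<in>U. ?R v al)"
      using insert by auto
    have w: "w \<in> adm n" using insert.prems adm by simp
    show ?case
      unfolding eq using adm_add[OF w IH(1)] reflect_add[OF w IH(1) i(2), of lam] IH(2) insert.hyps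
      by (auto simp: fun_eq_iff)
  qed
  have inj: "inj_on ?R W"
    by (rule inj_on_inverseI) (rule reflect_involution[OF adm i])
  have "?R f = (\<lambda>al. \<Sum>w\<in>?R ` W. w al)"
    using sum[OF order_refl] W(3) by (simp add: sum.reindex[OF inj])
  moreover have "\<forall>w\<in>?R ` W. w \<in> truncated_up n \<and> weighted n lam w"
    using W(2) truncated_up_reflect[OF _ _ i] by auto
  ultimately show ?thesis unfolding weighted_span_def using W(1) by blast
qed

text \<open>The factor mu_i - (a - 1) in raise_eta vanishes for a = mu_i + 1.\<close>

lemma raise_reflect:
  assumes f: "f \<in> adm n" "weighted n lam f" and d: "\<And>k. 1 \<le> k \<Longrightarrow> k < n \<Longrightarrow> d_op n lam k f = (\<lambda>_. 0)"
    and i: "1 \<le> i" "i < n" and k: "1 \<le> k" "k < n"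
  shows "d_op n lam k (reflect n lam i f) = (\<lambda>_. 0)"
proof -
  obtain mu where mu: "has_weight n lam mu f" using f(2) by (auto simp: weighted_def)
  have "app (raise n lam k) f = 0" using d[OF k] by (simp add: app_raise zero_fun_def)
  moreover have "app (coroot n lam i) f = (\<lambda>al. mu i * f al)"
    using mu i by (auto simp: app_coroot has_weight_def)
  ultimately have "app (raise n lam k) (eta i (mu i + 1) f)
      = (\<lambda>al. (if i = k then (mu i + 1) * (mu i - (mu i + 1 - 1)) else 0) * eta i (mu i + 1 - 1) f al)"
    by (rule raise_eta[OF f(1) i k])
  then show ?thesis
    unfolding reflect_has_weight[OF f(1) i mu] by (simp add: app_raise)
qed

lemma one_series_solution:
  "one_series \<in> truncated_up n" "weighted n lam one_series" "d_op n lam k one_series = (\<lambda>_. 0)"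
proof -
  have adm: "one_series \<in> adm n"
    by (auto simp: adm_def one_series_def admissible_expo_def split: if_splits)
  moreover have hom: "homog n lam (wt n lam (\<lambda>_. 0)) one_series"
    by (auto simp: homog_def one_series_def split: if_splits)
  moreover have "\<forall>al. one_series al \<noteq> 0 \<longrightarrow> (\<exists>a\<in>{\<lambda>_. 0}. \<forall>k. 1 \<le> k \<and> k < n \<longrightarrow> a k - al (Suc k, k) \<in> \<nat>)"
    by (auto simp: one_series_def split: if_splits)
  ultimately show "one_series \<in> truncated_up n"
    using homog_finite[OF adm hom] unfolding truncated_up_iff by (intro conjI exI[of _ "{\<lambda>_. 0}"]) auto
  show "weighted n lam one_series" using hom by (auto simp: weighted_iff_homog)
  have "pd i j one_series = (\<lambda>_. 0)" for i j
  proof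
    fix al
    show "pd i j one_series al = 0"
      by (auto simp: pd_def one_series_def dest!: fun_cong[of _ _ "(i, j)"])
  qed
  then show "d_op n lam k one_series = (\<lambda>_. 0)"
    by (simp add: d_op_def xpow_def pd_def)
qed

section \<open>The action of the symmetric group\<close>

lemma weighted_span_untruncated: "weighted_span n lam \<subseteq> untruncated n"
proof
  fix f assume "f \<in> weighted_span n lam"
  then obtain W where W: "finite W" "\<forall>w\<in>W. w \<in> truncated_up n \<and> weighted n lam w"
    "f = (\<lambda>al. \<Sum>w\<in>W. w al)"
    unfolding weighted_span_def by blast
  have "(\<lambda>al. \<Sum>w\<in>W. w al) \<in> untruncated n"
    using W(1,2)
  proof (induction W rule: finite_induct)
    case empty
    then show ?case unfolding untruncated_iff adm_def by auto
  next
    case (insert w W)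
    then have "w \<in> untruncated n" "(\<lambda>al. \<Sum>w\<in>W. w al) \<in> untruncated n"
      using truncated_up_subset by auto
    then show ?case using untruncated_add insert.hyps by simp
  qed
  then show "f \<in> untruncated n" using W(3) by simp
qed

definition reflection :: "nat \<Rightarrow> (nat \<Rightarrow> complex) \<Rightarrow> nat \<Rightarrow> fseries \<Rightarrow> fseries" where
  "reflection n lam i = restrict (reflect n lam i) (untruncated n)"

lemma reflection_Bij:
  assumes "1 \<le> i" "i < n"
  shows "reflection n lam i \<in> Bij (untruncated n)"
proof -
  let ?E = "untruncated n" and ?R = "reflect n lam i"
  have "bij_betw ?R ?E ?E"
    using untruncated_reflect[OF _ assms] reflect_involution[OF _ assms] untruncated_adm
    by (intro bij_betw_byWitness[where f' = ?R]) blast+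
  then have "bij_betw (restrict ?R ?E) ?E ?E" by (simp cong: bij_betw_cong)
  then show ?thesis by (simp add: Bij_def reflection_def)
qed

lemma BijGroup_mult:
  assumes "g \<in> Bij E" "h \<in> Bij E"
  shows "g \<otimes>\<^bsub>BijGroup E\<^esub> h = compose E g h"
  using assms by (simp add: BijGroup_def)

lemma reflection_coxeter: "coxeter (BijGroup (untruncated n)) (reflection n lam) n"
proof -
  let ?E = "untruncated n"
  let ?G = "BijGroup ?E" and ?t = "reflection n lam" and ?R = "reflect n lam"
  interpret G: group ?G by (rule group_BijGroup)
  have carrier: "?t i \<in> carrier ?G" if "1 \<le> i" "i < n" for i
    using reflection_Bij[OF that] by (simp add: BijGroup_def)
  have adm: "f \<in> adm n" if "f \<in> ?E" for f using that untruncated_adm by blast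
  have mult: "g \<otimes>\<^bsub>?G\<^esub> ?t i = (\<lambda>f\<in>?E. g (?R i f))" if "g \<in> carrier ?G" "1 \<le> i" "i < n" for g i
  proof -
    have "g \<otimes>\<^bsub>?G\<^esub> ?t i = compose ?E g (?t i)"
      using that reflection_Bij[OF that(2,3)] by (intro BijGroup_mult) (simp_all add: BijGroup_def)
    then show ?thesis by (auto simp: compose_def reflection_def restrict_def fun_eq_iff)
  qed
  have mult2: "?t j \<otimes>\<^bsub>?G\<^esub> ?t i = (\<lambda>f\<in>?E. ?R j (?R i f))" if "1 \<le> i" "i < n" "1 \<le> j" "j < n" for i j
    unfolding mult[OF carrier[OF that(3,4)] that(1,2)]
    by (rule restrict_ext) (simp add: reflection_def untruncated_reflect[OF _ that(1,2)])
  have mult3: "?t k \<otimes>\<^bsub>?G\<^esub> ?t j \<otimes>\<^bsub>?G\<^esub> ?t i = (\<lambda>f\<in>?E. ?R k (?R j (?R i f)))"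
    if "1 \<le> i" "i < n" "1 \<le> j" "j < n" "1 \<le> k" "k < n" for i j k
    unfolding mult[OF G.m_closed[OF carrier[OF that(5,6)] carrier[OF that(3,4)]] that(1,2)]
    unfolding mult2[OF that(3-6)]
    by (rule restrict_ext) (simp add: untruncated_reflect[OF _ that(1,2)])
  show ?thesis
  proof
    fix i assume i: "1 \<le> i" "i < n"
    show "?t i \<in> carrier ?G" by (rule carrier[OF i])
    have "(\<lambda>f\<in>?E. ?R i (?R i f)) = (\<lambda>f\<in>?E. f)"
      by (rule restrict_ext) (rule reflect_involution[OF adm i])
    then show "?t i \<otimes>\<^bsub>?G\<^esub> ?t i = \<one>\<^bsub>?G\<^esub>"
      by (simp add: mult2[OF i i]) (simp add: BijGroup_def)
  next
    fix i k assume ik: "1 \<le> i" "Suc i < k" "k < n"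
    have "(\<lambda>f\<in>?E. ?R i (?R k f)) = (\<lambda>f\<in>?E. ?R k (?R i f))"
      by (rule restrict_ext) (rule reflect_commute[OF adm ik])
    then show "?t i \<otimes>\<^bsub>?G\<^esub> ?t k = ?t k \<otimes>\<^bsub>?G\<^esub> ?t i"
      using ik by (simp add: mult2)
  next
    fix i assume i: "1 \<le> i" "Suc i < n"
    have "(\<lambda>f\<in>?E. ?R i (?R (Suc i) (?R i f))) = (\<lambda>f\<in>?E. ?R (Suc i) (?R i (?R (Suc i) f)))"
      by (rule restrict_ext) (rule reflect_braid[OF adm i])
    then show "?t i \<otimes>\<^bsub>?G\<^esub> ?t (Suc i) \<otimes>\<^bsub>?G\<^esub> ?t i = ?t (Suc i) \<otimes>\<^bsub>?G\<^esub> ?t i \<otimes>\<^bsub>?G\<^esub> ?t (Suc i)"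
      using i by (simp add: mult3)
  qed
qed

text \<open>Induction over words, with the group operation unfolded to composition of operators.\<close>

lemma word_graph_induct_apply:
  assumes "word_graph (BijGroup (untruncated n)) (reflection n lam) n p g"
    and "P (\<lambda>f\<in>untruncated n. f)"
    and "\<And>g i. P g \<Longrightarrow> 1 \<le> i \<Longrightarrow> i < n \<Longrightarrow> P (\<lambda>f\<in>untruncated n. g (reflect n lam i f))"
  shows "P g"
proof -
  let ?G = "BijGroup (untruncated n)" and ?t = "reflection n lam"
  interpret coxeter ?G ?t n by (rule reflection_coxeter)
  show ?thesis
    using assms(1)
  proof (induction rule: word_graph.induct)
    case Nil
    have "\<one>\<^bsub>?G\<^esub> = (\<lambda>f\<in>untruncated n. f)" by (simp add: BijGroup_def)
    then show ?case using assms(2) by (simp only:)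
  next
    case (Snoc p g i)
    have "g \<in> Bij (untruncated n)"
      using word_graph_closed(2)[OF Snoc.hyps(1) order_refl] by (simp add: BijGroup_def)
    then have "g \<otimes>\<^bsub>?G\<^esub> ?t i = compose (untruncated n) g (?t i)"
      using reflection_Bij[OF Snoc.hyps(2,3)] by (rule BijGroup_mult)
    also have "\<dots> = (\<lambda>f\<in>untruncated n. g (reflect n lam i f))"
      by (auto simp: compose_def reflection_def restrict_def fun_eq_iff)
    finally show ?case using assms(3)[OF Snoc.IH Snoc.hyps(2,3)] by (simp only:)
  qed
qed

theorem theorem2p5:
  fixes n :: nat and lam :: "nat \<Rightarrow> complex"
  assumes "n \<ge> 2"
  shows "\<exists>\<rho> :: (nat \<Rightarrow> nat) \<Rightarrow> fseries \<Rightarrow> fseries.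
    group_action (sym_group n) (untruncated n) \<rho> \<and>
    (\<forall>\<sigma>\<in>carrier (sym_group n). linear_on_series (untruncated n) (\<rho> \<sigma>)) \<and>
    (\<forall>i\<in>{1..<n}. \<forall>f\<in>untruncated n. \<forall>g.
       sigma_rel (untruncated n) n lam i f g \<longleftrightarrow> g = \<rho> (transpose i (i + 1)) f) \<and>
    truncated_up n \<subseteq> untruncated n \<and>
    (\<forall>i\<in>{1..<n}. \<forall>f\<in>truncated_up n. \<forall>g.
       sigma_rel (truncated_up n) n lam i f g \<longleftrightarrow> g = \<rho> (transpose i (i + 1)) f) \<and>
    (\<forall>\<sigma>\<in>carrier (sym_group n). \<rho> \<sigma> ` weighted_span n lam \<subseteq> weighted_span n lam) \<and>
    (\<forall>\<sigma>\<in>carrier (sym_group n).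
       \<rho> \<sigma> one_series \<in> truncated_up n \<and>
       weighted n lam (\<rho> \<sigma> one_series) \<and>
       (\<forall>i\<in>{1..<n}. d_op n lam i (\<rho> \<sigma> one_series) = (\<lambda>_. 0)))"
proof -
  let ?E = "untruncated n" and ?R = "reflect n lam"
  interpret coxeter "BijGroup ?E" "reflection n lam" n by (rule reflection_coxeter)
  obtain \<rho> where hom: "\<rho> \<in> hom (sym_group n) (BijGroup ?E)"
    and gen: "\<And>i. 1 \<le> i \<Longrightarrow> i < n \<Longrightarrow> \<rho> (adj i) = reflection n lam i"
    and word: "\<And>p. p permutes {1..n} \<Longrightarrow> word_graph (BijGroup ?E) (reflection n lam) n p (\<rho> p)"
    using sym_group_presentation by blast
  have induct: "P (\<rho> \<sigma>)" if "\<sigma> \<in> carrier (sym_group n)" "P (\<lambda>f\<in>?E. f)"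
    "\<And>g i. P g \<Longrightarrow> 1 \<le> i \<Longrightarrow> i < n \<Longrightarrow> P (\<lambda>f\<in>?E. g (?R i f))" for P \<sigma>
    using word_graph_induct_apply[OF word that(2,3)] that(1) by (simp add: sym_group_carrier)
  have stable: "\<rho> \<sigma> f \<in> X" if "\<sigma> \<in> carrier (sym_group n)" "X \<subseteq> ?E"
    "\<And>i f. 1 \<le> i \<Longrightarrow> i < n \<Longrightarrow> f \<in> X \<Longrightarrow> ?R i f \<in> X" "f \<in> X" for \<sigma> X f
  proof -
    have "\<forall>f\<in>X. \<rho> \<sigma> f \<in> X"
      by (rule induct[OF that(1)]) (use that(2,3) in auto)
    then show ?thesis using that(4) by blast
  qed
  have gen_apply: "\<rho> (transpose i (i + 1)) f = ?R i f" if "i \<in> {1..<n}" "f \<in> ?E" for i f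
    using gen[of i] that by (simp add: reflection_def)

  have action: "group_action (sym_group n) ?E \<rho>"
    using hom sym_group_is_group is_group
    by (intro group_action.intro group_hom.intro group_hom_axioms.intro)

  have linear: "linear_on_series ?E (\<rho> \<sigma>)" if "\<sigma> \<in> carrier (sym_group n)" for \<sigma>
  proof (rule induct[OF that])
    show "linear_on_series ?E (\<lambda>f\<in>?E. f)"
      by (simp add: linear_on_series_def untruncated_add untruncated_scale)
  next
    fix g i assume g: "linear_on_series ?E g" and i: "1 \<le> i" "i < n"
    have add: "?R i (\<lambda>al. f al + h al) = (\<lambda>al. ?R i f al + ?R i h al)" if "f \<in> ?E" "h \<in> ?E" for f h
      using reflect_add[of f n h i lam] that i untruncated_adm by (auto simp: plus_fun_def)
    have scale: "?R i (\<lambda>al. c * f al) = (\<lambda>al. c * ?R i f al)" if "f \<in> ?E" for f c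
      using reflect_scale[of f n i lam c] that i untruncated_adm by blast
    have "?R i f \<in> ?E" if "f \<in> ?E" for f using that i by (rule untruncated_reflect)
    then show "linear_on_series ?E (\<lambda>f\<in>?E. g (?R i f))"
      using g unfolding linear_on_series_def
      by (simp add: untruncated_add untruncated_scale add scale)
  qed

  have formula: "sigma_rel ?E n lam i f g \<longleftrightarrow> g = \<rho> (transpose i (i + 1)) f"
    if "i \<in> {1..<n}" "f \<in> ?E" for i f g
    unfolding gen_apply[OF that]
    by (rule sigma_rel_iff[OF untruncated_adm _ _ countable_support[OF that(2)]])
      (use that in \<open>auto intro: untruncated_restrict\<close>)

  have formula': "sigma_rel (truncated_up n) n lam i f g \<longleftrightarrow> g = \<rho> (transpose i (i + 1)) f"
    if "i \<in> {1..<n}" "f \<in> truncated_up n" for i f g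
  proof -
    have f: "f \<in> ?E" using that truncated_up_subset by blast
    have V: "truncated_up n \<subseteq> adm n" using truncated_up_subset untruncated_adm by blast
    show ?thesis
      unfolding gen_apply[OF that(1) f]
      by (rule sigma_rel_iff[OF V _ _ countable_support[OF f]])
        (use that in \<open>auto intro: truncated_up_restrict\<close>)
  qed

  have span: "\<rho> \<sigma> ` weighted_span n lam \<subseteq> weighted_span n lam" if "\<sigma> \<in> carrier (sym_group n)" for \<sigma>
    using stable[OF that weighted_span_untruncated] weighted_span_reflect by blast

  let ?X = "{f \<in> truncated_up n. weighted n lam f \<and> (\<forall>k. 1 \<le> k \<and> k < n \<longrightarrow> d_op n lam k f = (\<lambda>_. 0))}"
  have solution: "\<rho> \<sigma> one_series \<in> ?X" if "\<sigma> \<in> carrier (sym_group n)" for \<sigma>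
  proof (rule stable[OF that])
    show "?X \<subseteq> ?E" using truncated_up_subset by blast
    show "one_series \<in> ?X" using one_series_solution by blast
    fix i f assume i: "1 \<le> i" "i < n" and f: "f \<in> ?X"
    have "f \<in> adm n" using f truncated_up_subset untruncated_adm by blast
    then show "?R i f \<in> ?X"
      using f i truncated_up_reflect[of f n lam i] raise_reflect[of f n lam i] by simp
  qed
  show ?thesis
    using action linear formula truncated_up_subset formula' span solution
    by (intro exI[of _ \<rho>] conjI ballI allI) auto
qed

end
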